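(* Let $\beta\in(0,1]$, $\mu>0$, $\gamma>0$. Let $u(t,x)$, $t>0$, $x\in\mathbb R$, be the random field that solves the fractional Riesz–Bessel equation $$\frac{\partial^\beta u(t,x)}{\partial t^\beta}=-\mu(I-\Delta)^{\gamma/2}(-\Delta)^{\alpha/2}u(t,x),\quad t>0,\qquad u(0,x)=\xi(x),$$ (in the mean-square sense given by the spectral representation in the context), where $\xi(x)$, $x\in\mathbb R$, is a real-valued measurable zero-mean stationary Gaussian process with covariance function $$r(x)=\mathrm{Cov}(\xi(0),\xi(x))=\sum_{j=0}^{n}A_j\frac{\cos(w_jx)}{(1+x^2)^{\kappa_j/2}},\quad x\in\mathbb R,$$ with $\sum_{j=0}^nA_j=1$, $w_0=0$, $w_j>0$ for $j=1,\dots,n$, $\kappa_j\in(0,1)$ for $j=0,1,\dots,n$, and with $A_0\ne0$. Then, for $\alpha>\kappa_0/2$, if $\varepsilon\to0$ ($\varepsilon>0$), the finite-dimensional distributions of the random fields $$U_\varepsilon(t,x)=\varepsilon^{-\frac{\kappa_0\beta}{2\alpha}}\,u\left(\frac t\varepsilon,\frac{x}{\varepsilon^{\beta/\alpha}}\right),\quad t>0,\ x\in\mathbb R,$$ converge weakly to the finite-dimensional distributions of the zero-mean Gaussian random field $$U_0(t,x)=\sqrt{c_2(\kappa_0)A_0}\int_{\mathbb R}\frac{e^{i\lambda x}E_\beta(-\mu|\lambda|^\alpha t^\beta)}{|\lambda|^{(1-\kappa_0)/2}}\,W(d\lambda),$$ which has the covariance function $$\mathrm{Cov}(U_0(t,x),U_0(t',x'))=2A_0c_2(\kappa_0)\int_0^{+\infty}\frac{\cos(\lambda(x-x'))}{|\lambda|^{1-\kappa_0}}\,E_\beta(-\mu|\lambda|^\alpha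 t^\beta)\,E_\beta(-\mu|\lambda|^\alpha(t')^\beta)\,d\lambda .$$
   Context: $\Delta=\partial^2/\partial x^2$. For $\beta=1$, $\partial^\beta u/\partial t^\beta$ is the ordinary time derivative; for $\beta\in(0,1)$ it is the regularized (Caputo–Djrbashian) derivative $\frac{1}{\Gamma(1-\beta)}\left[\frac{\partial}{\partial t}\int_0^t(t-\tau)^{-\beta}u(\tau,x)\,d\tau-\frac{u(0,x)}{t^\beta}\right]$. The operators $(I-\Delta)^{\gamma/2}$ and $(-\Delta)^{\alpha/2}$ are interpreted as the inverses of the Bessel and Riesz potentials (Fourier symbols $(1+|\lambda|^2)^{\gamma/2}$ and $|\lambda|^\alpha$). The Mittag-Leffler function is $E_\beta(s)=\sum_{k=0}^\infty \frac{s^k}{\Gamma(1+\beta k)}$, $s\in\mathbb R$ (so $E_1(s)=e^s$). The process $\xi$ has a spectral density $f$, meaning $r(x)=\int_{\mathbb R}e^{ix\lambda}f(\lambda)\,d\lambda$, and the representation $\xi(x)=\int_{\mathbb R}e^{i\lambda x}\sqrt{f(\lambda)}\,W(d\lambda)$, where $W$ is a Gaussian white-noise random measure on $\mathbb R$ with $\mathbb E|W(d\lambda)|^2=d\lambda$, symmetric (Hermitian) so that all the stochastic integrals are real-valued. The mean-square solution of the initial value problem is $$u(t,x)=\int_{\mathbb R}e^{ix\lambda}E_\beta\left(-\mu|\lambda|^\alpha(1+|\lambda|^2)^{\gamma/2}t^\beta\right)\sqrt{f(\lambda)}\,W(d\lambda).$$ Constant: $c_2(\kappa_0)=\dfrac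{1}{\Gamma(\kappa_0)\cos(\kappa_0\pi/2)}$.
   Formalization: The constant is taken as c_2(κ_0)=1/(2Γ(κ_0)cos(κ_0π/2)) instead of 1/(Γ(κ_0)cos(κ_0π/2)); with r(x)=∫e^{ixλ}f(λ)dλ over all of ℝ, the printed constant gives a limit variance twice too large. *)

theory Defs
  imports "HOL-Probability.Probability"
begin

definition mittag_leffler :: "real \<Rightarrow> real \<Rightarrow> real" where
  "mittag_leffler \<beta> s = (\<Sum>k. s ^ k / Gamma (1 + \<beta> * real k))"

text \<open>
  The constant also occurs in print without the factor 2 in the denominator, and that version is
  wrong here: the factor is forced by the two-sided convention of \<open>spectral_density\<close> below,
  since for \<open>0 < \<kappa> < 1\<close> the spectral density of
  \<open>(1 + x\<^sup>2) powr (- \<kappa> / 2)\<close> is asymptotic to \<open>c2 \<kappa> * \<bar>l\<bar> powr (\<kappa> - 1)\<close> at \<open>l = 0\<close>, where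
  \<open>c2 \<kappa> = Gamma ((1 - \<kappa>) / 2) / (2 powr \<kappa> * sqrt pi * Gamma (\<kappa> / 2))\<close>, and the duplication and
  reflection formulas turn this into the expression used here.
\<close>

definition c2 :: "real \<Rightarrow> real" where
  "c2 \<kappa> = 1 / (2 * Gamma \<kappa> * cos (\<kappa> * pi / 2))"


section \<open>Gaussian and stationary processes\<close>

text \<open>Constants count as (degenerate) Gaussian random variables.\<close>

definition gaussian_rv :: "'w measure \<Rightarrow> ('w \<Rightarrow> real) \<Rightarrow> bool" where
  "gaussian_rv M X \<longleftrightarrow> X \<in> borel_measurable M \<and>
     (\<exists>m. (AE \<omega> in M. X \<omega> = m) \<or>
          (\<exists>\<sigma>>0. distributed M lborel X (\<lambda>x. ennreal (normal_density m \<sigma> x))))"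

definition gaussian_process :: "'w measure \<Rightarrow> 'i set \<Rightarrow> ('i \<Rightarrow> 'w \<Rightarrow> real) \<Rightarrow> bool" where
  "gaussian_process M T X \<longleftrightarrow>
     (\<forall>J c. finite J \<and> J \<subseteq> T \<longrightarrow> gaussian_rv M (\<lambda>\<omega>. \<Sum>i\<in>J. c i * X i \<omega>))"

definition zero_mean :: "'w measure \<Rightarrow> 'i set \<Rightarrow> ('i \<Rightarrow> 'w \<Rightarrow> real) \<Rightarrow> bool" where
  "zero_mean M T X \<longleftrightarrow> (\<forall>i\<in>T. integrable M (X i) \<and> integral\<^sup>L M (X i) = 0)"

definition covariance :: "'w measure \<Rightarrow> ('w \<Rightarrow> real) \<Rightarrow> ('w \<Rightarrow> real) \<Rightarrow> real" where
  "covariance M X Y = (\<integral>\<omega>. (X \<omega> - integral\<^sup>L M X) * (Y \<omega> - integral\<^sup>L M Y) \<partial>M)"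

definition measurable_process :: "'w measure \<Rightarrow> (real \<Rightarrow> 'w \<Rightarrow> real) \<Rightarrow> bool" where
  "measurable_process M X \<longleftrightarrow> (\<lambda>(x, \<omega>). X x \<omega>) \<in> borel_measurable (borel \<Otimes>\<^sub>M M)"

definition stationary_process :: "'w measure \<Rightarrow> (real \<Rightarrow> 'w \<Rightarrow> real) \<Rightarrow> bool" where
  "stationary_process M X \<longleftrightarrow>
     (\<forall>h J. finite J \<longrightarrow>
        distr M (PiM J (\<lambda>_. borel)) (\<lambda>\<omega>. \<lambda>x\<in>J. X (x + h) \<omega>) =
        distr M (PiM J (\<lambda>_. borel)) (\<lambda>\<omega>. \<lambda>x\<in>J. X x \<omega>))"

definition spectral_density :: "(real \<Rightarrow> real) \<Rightarrow> (real \<Rightarrow> real) \<Rightarrow> bool" where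
  "spectral_density r f \<longleftrightarrow> (\<forall>l. 0 \<le> f l) \<and> integrable lborel f \<and>
     (\<forall>x. complex_of_real (r x) =
        (\<integral>l. exp (\<i> * complex_of_real (x * l)) * complex_of_real (f l) \<partial>lborel))"


section \<open>Hermitian Gaussian white noise and its stochastic integral\<close>

definition finite_borel :: "real set set" where
  "finite_borel = {A \<in> sets borel. emeasure lborel A < \<infinity>}"

text \<open>
  The covariance condition is \<open>E |W(dl)|\<^sup>2 = dl\<close> with orthogonal increments. It implies that \<open>W\<close> is
  additive almost surely and countably additive in mean square. The Hermitian symmetry also
  determines \<open>E (W A * W B)\<close>, hence the joint law of all real and imaginary parts.
\<close>

definition hermitian_white_noise :: "'w measure \<Rightarrow> (real set \<Rightarrow> 'w \<Rightarrow> complex) \<Rightarrow> bool" where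
  "hermitian_white_noise M W \<longleftrightarrow>
     gaussian_process M (finite_borel \<times> UNIV)
       (\<lambda>(A, b) \<omega>. if b then Re (W A \<omega>) else Im (W A \<omega>)) \<and>
     zero_mean M (finite_borel \<times> UNIV)
       (\<lambda>(A, b) \<omega>. if b then Re (W A \<omega>) else Im (W A \<omega>)) \<and>
     (\<forall>A\<in>finite_borel. \<forall>B\<in>finite_borel.
        (\<integral>\<omega>. W A \<omega> * cnj (W B \<omega>) \<partial>M) = complex_of_real (measure lborel (A \<inter> B))) \<and>
     (\<forall>A\<in>finite_borel. AE \<omega> in M. W (uminus ` A) \<omega> = cnj (W A \<omega>))"

text \<open>
  A list of pairs \<open>(c, A)\<close> stands for the simple function with value \<open>\<Sum> c * indicator A\<close>; the
  stochastic integral of a square-integrable \<open>g\<close> is the mean-square limit of the integrals of simple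
  functions that tend to \<open>g\<close> in \<open>L\<^sup>2\<close>. It is unique up to null sets, so it is a relation rather than
  a function.
\<close>

definition simple_fun :: "(complex \<times> real set) list \<Rightarrow> real \<Rightarrow> complex" where
  "simple_fun xs l = (\<Sum>(c, A)\<leftarrow>xs. c * indicator A l)"

definition simple_stoch_integral ::
    "(real set \<Rightarrow> 'w \<Rightarrow> complex) \<Rightarrow> (complex \<times> real set) list \<Rightarrow> 'w \<Rightarrow> complex" where
  "simple_stoch_integral W xs \<omega> = (\<Sum>(c, A)\<leftarrow>xs. c * W A \<omega>)"

definition has_stoch_integral ::
    "'w measure \<Rightarrow> (real set \<Rightarrow> 'w \<Rightarrow> complex) \<Rightarrow> (real \<Rightarrow> complex) \<Rightarrow> ('w \<Rightarrow> complex) \<Rightarrow> bool" where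
  "has_stoch_integral M W g X \<longleftrightarrow>
     g \<in> borel_measurable borel \<and> integrable lborel (\<lambda>l. (cmod (g l))\<^sup>2) \<and>
     X \<in> borel_measurable M \<and> integrable M (\<lambda>\<omega>. (cmod (X \<omega>))\<^sup>2) \<and>
     (\<exists>xs :: nat \<Rightarrow> (complex \<times> real set) list.
        (\<forall>n. \<forall>(c, A) \<in> set (xs n). A \<in> finite_borel) \<and>
        (\<lambda>n. \<integral>l. (cmod (g l - simple_fun (xs n) l))\<^sup>2 \<partial>lborel) \<longlonglongrightarrow> 0 \<and>
        (\<lambda>n. \<integral>\<omega>. (cmod (X \<omega> - simple_stoch_integral W (xs n) \<omega>))\<^sup>2 \<partial>M) \<longlonglongrightarrow> 0)"


section \<open>The fractional Riesz--Bessel equation\<close>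

text \<open>
  Mean-square solution, in the sense of the spectral representation, of the initial value problem
  whose spatial operator \<open>- \<mu> (I - \<Delta>)\<^bsup>\<gamma>/2\<^esup> (- \<Delta>)\<^bsup>\<alpha>/2\<^esup>\<close> has the Fourier symbol
  \<open>- \<mu> * \<bar>l\<bar> powr \<alpha> * (1 + l\<^sup>2) powr (\<gamma> / 2)\<close> and whose initial value is
  \<open>\<xi>(x) = \<integral> exp(i l x) sqrt(f(l)) W(dl)\<close>: at each frequency the Caputo--Djrbashian equation in \<open>t\<close>
  with initial value 1 is solved by the Mittag-Leffler factor.
\<close>

definition riesz_bessel_ms_solution ::
    "'w measure \<Rightarrow> (real set \<Rightarrow> 'w \<Rightarrow> complex) \<Rightarrow> (real \<Rightarrow> real) \<Rightarrow> real \<Rightarrow> real \<Rightarrow> real \<Rightarrow> real \<Rightarrow>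
     (real \<Rightarrow> 'w \<Rightarrow> real) \<Rightarrow> (real \<Rightarrow> real \<Rightarrow> 'w \<Rightarrow> real) \<Rightarrow> bool" where
  "riesz_bessel_ms_solution M W f \<beta> \<mu> \<alpha> \<gamma> \<xi> u \<longleftrightarrow>
     (\<forall>x. AE \<omega> in M. u 0 x \<omega> = \<xi> x \<omega>) \<and>
     (\<forall>t>0. \<forall>x. has_stoch_integral M W
        (\<lambda>l. exp (\<i> * complex_of_real (x * l)) *
             complex_of_real
               (mittag_leffler \<beta> (- \<mu> * \<bar>l\<bar> powr \<alpha> * (1 + \<bar>l\<bar>\<^sup>2) powr (\<gamma> / 2) * t powr \<beta>)) *
             complex_of_real (sqrt (f l)))
        (\<lambda>\<omega>. complex_of_real (u t x \<omega>)))"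


section \<open>Weak convergence\<close>

definition weak_conv_measure ::
    "'e filter \<Rightarrow> ('e \<Rightarrow> 'b::topological_space measure) \<Rightarrow> 'b measure \<Rightarrow> bool" where
  "weak_conv_measure F P Q \<longleftrightarrow>
     (\<forall>g :: 'b \<Rightarrow> real. continuous_on UNIV g \<and> bounded (range g) \<longrightarrow>
        ((\<lambda>e. \<integral>z. g z \<partial>P e) \<longlongrightarrow> (\<integral>z. g z \<partial>Q)) F)"

end

theory Submission
  imports Defs
begin

text \<open>
  A real stochastic integral is centred Gaussian with variance the squared \<open>L\<^sup>2\<close> norm of its kernel, so
  the characteristic function of a finite-dimensional distribution of \<open>U\<^sub>\<epsilon>\<close> is governed by integrals
  \<open>\<integral> |Q\<^sub>h(l / h)|\<^sup>2 f(l) dl\<close> with \<open>h = \<epsilon> powr (\<beta> / \<alpha>)\<close>, where \<open>Q\<^sub>h\<close> is a trigonometric combination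
  of Mittag-Leffler factors. Uniqueness of Fourier transforms identifies \<open>f\<close> almost everywhere with a
  sum of shifted Bessel-type densities; only the one with \<open>w\<^sub>0 = 0\<close> is singular at the origin, where
  \<open>f(l) ~ A\<^sub>0 c\<^sub>2(\<kappa>\<^sub>0) |l| powr (\<kappa>\<^sub>0 - 1)\<close>. The bound \<open>0 \<le> E\<^sub>\<beta>(-s) \<le> C / (1 + s)\<close> makes the limit kernel
  square integrable for \<open>\<alpha> > \<kappa>\<^sub>0 / 2\<close>, and dominated convergence after \<open>l = h v\<close> gives convergence of all
  variances. For Gaussian vectors this is weak convergence, by approximation with trigonometric
  polynomials.
\<close>

section \<open>Decay of the Mittag-Leffler function\<close>

text \<open>The Mittag-Leffler bound is read off the Volterra equation of \<open>s powr (\<delta> -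
  1) * mittag_leffler2 \<beta> \<delta> (- (s powr \<beta>))\<close> with Abel kernel
  \<open>(t - s) powr (\<beta> - 1)\<close>: positivity for \<delta> = \<beta>, hence monotonicity
  for \<delta> = 1, hence sign and decay. The stochastic integral is a relation, so existence of the
  limit field must be proved: completeness of \<open>L\<^sup>2\<close> gives an integral, Hermitian
  symmetry a real one. The exponents fit because
  \<open>h powr \<alpha> = \<epsilon> powr \<beta>\<close> trades time \<open>t / \<epsilon>\<close>
  at frequency \<open>l\<close> for time \<open>t\<close> at frequency \<open>l / h\<close>; the
  Bessel factor \<open>(1 + (h * v)\<^sup>2) powr (\<gamma> / 2)\<close> tends to 1 and is at least
  1, so \<gamma> vanishes in the limit and one majorant serves all \<open>h\<close>. Trigonometric
  polynomials approximate only on compact sets; second moments, bounded because the variances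
  converge, supply the tightness. Since \<open>f\<close> is determined only almost everywhere, its
  singularity is stated for an explicit representative, and the sign of
  \<open>A 0 * c2 (\<kappa> 0)\<close> is deduced from nonnegativity of \<open>f\<close>.\<close>

lemma has_integral_imp_set_lborel:
  fixes f :: "real \<Rightarrow> real"
  assumes "(f has_integral I) S" "f \<in> borel_measurable borel" "S \<in> sets borel"
    and "\<And>x. x \<in> S \<Longrightarrow> 0 \<le> f x"
  shows "set_integrable lborel S f" "(LBINT x:S. f x) = I"
proof -
  have a: "f absolutely_integrable_on S"
    using assms by (intro nonnegative_absolutely_integrable_1) auto
  have m: "(\<lambda>x. indicator S x *\<^sub>R f x) \<in> borel_measurable lborel"
    using assms(2,3) by measurable
  show "set_integrable lborel S f"
    using a m unfolding set_integrable_def by (simp add: integrable_completion)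
  have "(LBINT x:S. f x) = (LINT x:S|lebesgue. f x)"
    unfolding set_lebesgue_integral_def using m by (simp add: integral_completion)
  also have "\<dots> = I"
    using set_lebesgue_integral_eq_integral(2)[OF a] assms(1) by (simp add: integral_unique)
  finally show "(LBINT x:S. f x) = I" .
qed

text \<open>The fractional integral of a power is again a power; the scaling
  \<open>s = t * v\<close> reduces it to the Beta integral. This is what allows the Mittag-Leffler
  series to be integrated term by term against the Abel kernel.\<close>

lemma Beta_convolution:
  fixes a b t :: real
  assumes "0 < a" "0 < b" "0 < t"
  shows "set_integrable lborel {0..t} (\<lambda>s. (t - s) powr (a - 1) * s powr (b - 1))"
    and "(LBINT s:{0..t}. (t - s) powr (a - 1) * s powr (b - 1)) = t powr (a + b - 1) * Beta a b"
proof -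
  have "((\<lambda>s. s powr (b - 1) * (1 - s) powr (a - 1)) has_integral Beta b a) {0..1}"
    by (rule has_integral_Beta_real) (use assms in auto)
  from has_integral_stretch_real[OF this, of "1 / t"] assms(3)
  have "((\<lambda>s. (s / t) powr (b - 1) * (1 - s / t) powr (a - 1)) has_integral t * Beta b a) {0..t}"
    using image_mult_atLeastAtMost[of t 0 1] by (simp add: mult.commute[of _ t])
  \<comment> \<open>The factor undoes the homogeneity of the integrand; the remaining power of
    \<open>t\<close> is the Jacobian.\<close>
  from has_integral_mult_right[OF this, of "t powr (a + b - 2)"]
  have *: "((\<lambda>s. t powr (a + b - 2) * ((s / t) powr (b - 1) * (1 - s / t) powr (a - 1)))
      has_integral t powr (a + b - 1) * Beta a b) {0..t}"
    using assms by (simp add: Beta_commute powr_diff power2_eq_square powr_add field_simps)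
  have eq: "t powr (a + b - 2) * ((s / t) powr (b - 1) * (1 - s / t) powr (a - 1)) =
      (t - s) powr (a - 1) * s powr (b - 1)" if "s \<in> {0..t}" for s
  proof -
    have "(s / t) powr (b - 1) = s powr (b - 1) / t powr (b - 1)"
      using that assms by (simp add: powr_divide)
    moreover have "(1 - s / t) powr (a - 1) = (t - s) powr (a - 1) / t powr (a - 1)"
      using that assms by (subst powr_divide[symmetric]) (auto simp: diff_divide_distrib)
    moreover have "t powr (a + b - 2) = t powr (a - 1) * t powr (b - 1)"
      by (simp add: powr_add[symmetric])
    ultimately have eqs: "(s / t) powr (b - 1) = s powr (b - 1) / t powr (b - 1)"
      "(1 - s / t) powr (a - 1) = (t - s) powr (a - 1) / t powr (a - 1)"
      "t powr (a + b - 2) = t powr (a - 1) * t powr (b - 1)" by blast+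
    show ?thesis unfolding eqs using assms by simp
  qed
  have **: "((\<lambda>s. (t - s) powr (a - 1) * s powr (b - 1)) has_integral
      t powr (a + b - 1) * Beta a b) {0..t}"
    using has_integral_cong[THEN iffD1, OF eq *] by simp
  show "set_integrable lborel {0..t} (\<lambda>s. (t - s) powr (a - 1) * s powr (b - 1))"
    and "(LBINT s:{0..t}. (t - s) powr (a - 1) * s powr (b - 1)) = t powr (a + b - 1) * Beta a b"
    by (rule has_integral_imp_set_lborel[OF **]; simp)+
qed

text \<open>On \<open>{R..}\<close> the Gamma integrand is at least
  \<open>R powr (x - 1) * exp (- t)\<close>. Since \<open>R\<close> is free, this gives growth
  faster than any geometric sequence.\<close>

lemma Gamma_ge_powr:
  fixes x R :: real
  assumes "1 \<le> x" "0 \<le> R"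
  shows "R powr (x - 1) * exp (- R) \<le> Gamma x"
proof (rule has_integral_le)
  show "((\<lambda>t. if t \<in> {R..} then R powr (x - 1) * exp (- 1 * t) else 0) has_integral R powr (x - 1) * exp (- R)) {0..}"
    using has_integral_mult_right[OF has_integral_exp_minus_to_infinity[of 1 R], of "R powr (x - 1)"] assms
    by (subst has_integral_restrict) auto
  show "((\<lambda>t. t powr (x - 1) / exp t) has_integral Gamma x) {0..}"
    using Gamma_integral_real[of x] assms by simp
  show "(if t \<in> {R..} then R powr (x - 1) * exp (- 1 * t) else 0) \<le> t powr (x - 1) / exp t" for t
    using assms by (auto simp: exp_minus field_simps intro!: powr_mono2)
qed

text \<open>The two-parameter Mittag-Leffler function, in power series form. \<delta> = 1 is the
  function of the theorem and \<delta> = \<beta> is \<beta> times its derivative.\<close>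

definition mittag_leffler2 :: "real \<Rightarrow> real \<Rightarrow> real \<Rightarrow> real" where
  "mittag_leffler2 \<beta> \<delta> x = (\<Sum>k. inverse (Gamma (\<delta> + \<beta> * real k)) * x ^ k)"

lemma mittag_leffler_eq: "mittag_leffler \<beta> = mittag_leffler2 \<beta> 1"
  by (simp add: mittag_leffler_def mittag_leffler2_def fun_eq_iff field_simps)

lemma summable_mittag_leffler2:
  fixes x :: real
  assumes "0 < \<beta>"
  shows "summable (\<lambda>k. inverse (Gamma (\<delta> + \<beta> * real k)) * x ^ k)"
proof -
  \<comment> \<open>Chosen so that \<open>R powr \<beta>\<close> is twice
    \<open>\<bar>x\<bar> + 1\<close>: the lower bound on Gamma then leaves a geometric series of
    ratio 1/2.\<close>
  define R where "R = (2 * (\<bar>x\<bar> + 1)) powr (1 / \<beta>)"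
  have R: "0 < R" "R powr \<beta> = 2 * (\<bar>x\<bar> + 1)"
    using assms by (simp_all add: R_def powr_powr)
  have "\<forall>\<^sub>F k in sequentially. 1 \<le> \<delta> + \<beta> * real k"
    using assms by (intro eventually_sequentiallyI[of "nat \<lceil>(1 - \<delta>) / \<beta>\<rceil>"]) (simp add: field_simps nat_le_iff ceiling_le_iff)
  then have "\<forall>\<^sub>F k in sequentially. norm (inverse (Gamma (\<delta> + \<beta> * real k)) * x ^ k)
      \<le> (exp R * R powr (1 - \<delta>)) * (1 / 2) ^ k"
  proof eventually_elim
    case (elim k)
    have "R powr (\<delta> + \<beta> * real k - 1) = R powr (\<delta> - 1) * (R powr \<beta>) ^ k"
      using R(1) by (simp add: powr_realpow[symmetric] powr_powr powr_add[symmetric] algebra_simps)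
    then have G: "R powr (\<delta> - 1) * (R powr \<beta>) ^ k * exp (- R) \<le> Gamma (\<delta> + \<beta> * real k)"
      using Gamma_ge_powr[OF elim, of R] R(1) by simp
    have pos: "0 < R powr (\<delta> - 1) * (R powr \<beta>) ^ k * exp (- R)"
      using R by simp
    have "norm (inverse (Gamma (\<delta> + \<beta> * real k)) * x ^ k) = inverse (Gamma (\<delta> + \<beta> * real k)) * \<bar>x\<bar> ^ k"
      using elim by (simp add: abs_mult power_abs)
    also have "\<dots> \<le> inverse (R powr (\<delta> - 1) * (R powr \<beta>) ^ k * exp (- R)) * (\<bar>x\<bar> + 1) ^ k"
      using G pos by (intro mult_mono le_imp_inverse_le power_mono) auto
    also have "\<dots> = exp R * R powr (1 - \<delta>) * ((\<bar>x\<bar> + 1) / (R powr \<beta>)) ^ k"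
      using R(1) by (simp add: power_divide exp_minus powr_diff field_simps)
    also have "(\<bar>x\<bar> + 1) / (R powr \<beta>) = 1 / 2"
      using R(2) by (simp add: divide_simps)
    finally show ?case .
  qed
  then show ?thesis
    by (rule summable_comparison_test_ev) (intro summable_mult summable_geometric, simp)
qed

lemma continuous_mittag_leffler2:
  assumes "0 < \<beta>" shows "continuous_on S (mittag_leffler2 \<beta> \<delta>)"
  unfolding mittag_leffler2_def
  by (intro continuous_at_imp_continuous_on ballI isCont_powser_converges_everywhere
      summable_mittag_leffler2 assms)

lemma measurable_mittag_leffler2 [measurable]:
  assumes "0 < \<beta>" shows "mittag_leffler2 \<beta> \<delta> \<in> borel_measurable borel"
  using continuous_mittag_leffler2[OF assms] by (rule borel_measurable_continuous_onI)

lemma mittag_leffler2_0: "mittag_leffler2 \<beta> \<delta> 0 = inverse (Gamma \<delta>)"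
  by (simp add: mittag_leffler2_def powser_zero[of "\<lambda>k. inverse (Gamma (\<delta> + \<beta> * real k))"])

text \<open>Fractional integration of order \<beta> carries the term of index \<open>k\<close> into
  the term of index \<open>Suc k\<close>, up to sign and the factor \<open>Gamma \<beta>\<close>.
  The integrated series is therefore the original one without its term of index 0, which accounts
  for \<open>inverse (Gamma \<delta>)\<close>.\<close>

lemma mittag_leffler_volterra:
  assumes b: "0 < \<beta>" and d: "0 < \<delta>" and t: "0 < t"
  defines "g \<equiv> (\<lambda>s. (t - s) powr (\<beta> - 1) * (s powr (\<delta> - 1) * mittag_leffler2 \<beta> \<delta> (- (s powr \<beta>))))"
  shows "set_integrable lborel {0..t} g"
    and "(LBINT s:{0..t}. g s) =
      Gamma \<beta> * t powr (\<delta> - 1) * (inverse (Gamma \<delta>) - mittag_leffler2 \<beta> \<delta> (- (t powr \<beta>)))"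
proof -
  define c where "c k = inverse (Gamma (\<delta> + \<beta> * real k))" for k
  define h where "h k s = indicator {0..t} s *\<^sub>R ((t - s) powr (\<beta> - 1) * s powr (\<delta> + \<beta> * real k - 1))" for k s
  define F where "F k s = c k * (-1) ^ k * h k s" for k s
  have pos: "0 < \<delta> + \<beta> * real k" for k
    using b d by (simp add: add_pos_nonneg)
  have cpos: "0 < c k" for k unfolding c_def using pos[of k] by simp
  have h_int: "integrable lborel (h k)" for k
    using Beta_convolution(1)[OF b pos[of k] t] unfolding h_def set_integrable_def .
  \<comment> \<open>In the Beta value the numerator Gamma cancels against \<open>c k\<close> and the
    denominator Gamma is the inverse of \<open>c (Suc k)\<close>.\<close>
  have h_val: "c k * (LBINT s. h k s) = Gamma \<beta> * t powr (\<delta> - 1) * (c (Suc k) * (t powr \<beta>) ^ Suc k)" for k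
  proof -
    have "(LBINT s. h k s) = t powr (\<beta> + (\<delta> + \<beta> * real k) - 1) * Beta \<beta> (\<delta> + \<beta> * real k)"
      using Beta_convolution(2)[OF b pos[of k] t] unfolding h_def set_lebesgue_integral_def .
    moreover have "t powr (\<beta> + (\<delta> + \<beta> * real k) - 1) = t powr (\<delta> - 1) * (t powr \<beta>) ^ Suc k"
      using t by (simp add: powr_realpow[symmetric] powr_powr powr_add[symmetric] algebra_simps del: power_Suc)
    moreover obtain G where "Gamma (\<delta> + \<beta> * real k) = G" "G > 0" using pos[of k] by simp
    ultimately show ?thesis
      by (simp add: c_def Beta_def field_simps)
  qed
  have F_int: "integrable lborel (F k)" for k unfolding F_def using h_int by simp
  have F_norm: "norm (F k s) = c k * h k s" for k s
    using cpos[of k] by (simp add: F_def abs_mult h_def indicator_def)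
  have sm: "summable (\<lambda>k. c k * x ^ k)" for x :: real
    unfolding c_def by (rule summable_mittag_leffler2[OF b])
  have h_eq: "h k s = indicator {0..t} s * (t - s) powr (\<beta> - 1) * s powr (\<delta> - 1) * (s powr \<beta>) ^ k" for k s
  proof (cases "s > 0")
    case True
    then show ?thesis
      by (simp add: h_def powr_realpow[symmetric] powr_powr powr_add[symmetric] algebra_simps)
  qed (auto simp: h_def indicator_def not_less)
  have F_eq: "F k s = indicator {0..t} s * (t - s) powr (\<beta> - 1) * s powr (\<delta> - 1) * (c k * (- (s powr \<beta>)) ^ k)" for k s
    unfolding F_def h_eq by (simp add: power_minus[of "s powr \<beta>"] mult_ac)
  have s1: "summable (\<lambda>k. norm (F k s))" for s
    unfolding F_norm h_eq
    using summable_mult[OF sm[of "s powr \<beta>"], of "indicator {0..t} s * (t - s) powr (\<beta> - 1) * s powr (\<delta> - 1)"]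
    by (simp add: mult_ac)
  \<comment> \<open>The integrals of the norms form the same shifted series at the positive argument
    \<open>t powr \<beta>\<close>, which converges because the power series is entire.\<close>
  have s2: "summable (\<lambda>k. LBINT s. norm (F k s))"
    unfolding F_norm integral_mult_right_zero h_val
    using summable_mult[OF summable_Suc_iff[THEN iffD2, OF sm[of "t powr \<beta>"]]] by blast
  have sumF: "(\<Sum>k. F k s) = indicator {0..t} s *\<^sub>R g s" for s
    unfolding F_eq by (subst suminf_mult[OF sm]) (simp add: g_def mittag_leffler2_def c_def mult_ac)
  have "integrable lborel (\<lambda>s. \<Sum>k. F k s)"
    by (rule integrable_suminf[OF F_int _ s2]) (use s1 in auto)
  then show "set_integrable lborel {0..t} g"
    unfolding sumF set_integrable_def .
  have "(\<lambda>k. LBINT s. F k s) sums (LBINT s. (\<Sum>k. F k s))"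
    by (rule sums_integral[OF F_int _ s2]) (use s1 in auto)
  moreover have "(LBINT s. F k s) = - (Gamma \<beta> * t powr (\<delta> - 1)) * (c (Suc k) * (- (t powr \<beta>)) ^ Suc k)" for k
    unfolding F_def using h_val[of k] by (simp add: power_minus[of "t powr \<beta>"] mult_ac)
  moreover have "(\<lambda>k. c (Suc k) * (- (t powr \<beta>)) ^ Suc k) sums
      (mittag_leffler2 \<beta> \<delta> (- (t powr \<beta>)) - c 0 * (- (t powr \<beta>)) ^ 0)"
    using summable_sums[OF sm[of "- (t powr \<beta>)"]]
    by (subst sums_Suc_iff) (simp add: mittag_leffler2_def c_def[symmetric])
  ultimately have "(LBINT s. (\<Sum>k. F k s)) =
      - (Gamma \<beta> * t powr (\<delta> - 1)) * (mittag_leffler2 \<beta> \<delta> (- (t powr \<beta>)) - c 0)"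
    using sums_unique2 sums_mult by (metis (no_types, lifting) mult.right_neutral power_0 sums_cong)
  then show "(LBINT s:{0..t}. g s) =
      Gamma \<beta> * t powr (\<delta> - 1) * (inverse (Gamma \<delta>) - mittag_leffler2 \<beta> \<delta> (- (t powr \<beta>)))"
    unfolding sumF set_lebesgue_integral_def by (simp add: c_def algebra_simps)
qed

section \<open>Sign, monotonicity and decay from the Volterra equation\<close>

lemma has_integral_powr_endpoint:
  fixes a b \<beta> :: real
  assumes "0 < \<beta>" "a \<le> b"
  shows "((\<lambda>s. (b - s) powr (\<beta> - 1)) has_integral (b - a) powr \<beta> / \<beta>) {a..b}"
proof -
  have "((\<lambda>s. (b - s) powr (\<beta> - 1)) has_integral (- ((b - b) powr \<beta> / \<beta>)) - (- ((b - a) powr \<beta> / \<beta>))) {a..b}"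
  \<comment> \<open>For \<beta> < 1 the antiderivative has infinite slope at \<open>b\<close>, so
    only continuity is available there.\<close>
  proof (rule fundamental_theorem_of_calculus_interior[OF assms(2)])
    show "continuous_on {a..b} (\<lambda>s. - ((b - s) powr \<beta> / \<beta>))"
      using assms by (intro continuous_intros continuous_on_powr') auto
    fix s assume s: "s \<in> {a<..<b}"
    have "((\<lambda>s. - ((b - s) powr \<beta> / \<beta>)) has_real_derivative (b - s) powr (\<beta> - 1)) (at s)"
      by (rule derivative_eq_intros refl | use s assms in simp)+
    then show "((\<lambda>s. - ((b - s) powr \<beta> / \<beta>)) has_vector_derivative (b - s) powr (\<beta> - 1)) (at s)"
      by (simp add: has_real_derivative_iff_has_vector_derivative)
  qed
  then show ?thesis using assms by simp
qed

lemmas set_integral_powr_endpoint =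
  has_integral_imp_set_lborel[OF has_integral_powr_endpoint, simplified]

text \<open>
  The resolvent of a log-convex kernel is positive: at a first zero \<open>t0\<close> the Volterra equations at
  \<open>t0\<close> and at a slightly smaller \<open>t\<close> contradict each other.
\<close>

lemma mittag_leffler2_pos:
  assumes b: "0 < \<beta>" "\<beta> \<le> 1" and x: "0 \<le> x"
  shows "0 < mittag_leffler2 \<beta> \<beta> (- x)"
proof (rule ccontr)
  define q where "q x = mittag_leffler2 \<beta> \<beta> (- x)" for x
  assume "\<not> 0 < mittag_leffler2 \<beta> \<beta> (- x)"
  then have qx: "q x \<le> 0" by (simp add: q_def)
  have qc: "continuous_on A q" for A
    unfolding q_def
    by (rule continuous_on_compose2[OF continuous_mittag_leffler2[OF b(1), of UNIV]]) (auto intro: continuous_intros)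
  \<comment> \<open>The least element of this compact set is the first zero; it is positive because
    \<open>q 0 = inverse (Gamma \<beta>) > 0\<close>.\<close>
  define S where "S = {y \<in> {0..x}. q y \<le> 0}"
  have "compact S"
    using compact_Int_closed[of "{0..x}" "{y. q y \<le> 0}"] closed_Collect_le[OF qc[of UNIV], of "\<lambda>_. 0"]
    by (simp add: S_def Int_def)
  moreover have "S \<noteq> {}" using qx x by (auto simp: S_def)
  ultimately obtain x0 where x0: "x0 \<in> S" "\<And>y. y \<in> S \<Longrightarrow> x0 \<le> y"
    using compact_attains_inf by metis
  have q0: "0 < q 0" using b by (simp add: q_def mittag_leffler2_0)
  have qx0: "q x0 \<le> 0" using x0 by (simp add: S_def)
  have x0pos: "0 < x0" using x0 q0 qx0 by (cases "x0 = 0") (auto simp: S_def)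
  have qpos: "0 < q y" if "0 \<le> y" "y < x0" for y
    using x0 that by (force simp: S_def not_less)
  define t0 where "t0 = x0 powr (1 / \<beta>)"
  have t0: "0 < t0" "t0 powr \<beta> = x0" using x0pos b by (auto simp: t0_def powr_powr)
  define z where "z s = s powr (\<beta> - 1) * q (s powr \<beta>)" for s
  have zpos: "0 < z s" if "0 < s" "s < t0" for s
    using that t0 b by (auto simp: z_def intro!: mult_pos_pos qpos powr_less_mono2[of \<beta> s t0, simplified])
  have zt0: "z t0 \<le> 0" using t0 qx0 by (simp add: z_def mult_nonneg_nonpos)
  have G: "0 < Gamma \<beta>" by (rule Gamma_real_pos[OF b(1)])
  \<comment> \<open>Makes the Abel kernel integrate to \<open>Gamma \<beta> / 4\<close> over an
    interval of length \<eta>.\<close>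
  define \<eta> where "\<eta> = (\<beta> * Gamma \<beta> / 4) powr (1 / \<beta>)"
  have eta: "0 < \<eta>" "\<eta> powr \<beta> / \<beta> = Gamma \<beta> / 4"
  proof -
    define K where "K = \<beta> * Gamma \<beta> / 4"
    have K: "0 < K" "\<eta> = K powr (1 / \<beta>)" "K / \<beta> = Gamma \<beta> / 4"
      using b G by (auto simp: K_def \<eta>_def simp del: Gamma_real_pos)
    then show "0 < \<eta>" "\<eta> powr \<beta> / \<beta> = Gamma \<beta> / 4"
      using b by (auto simp: powr_powr)
  qed
  \<comment> \<open>For \<open>t \<ge> t1\<close> the first bound keeps
    \<open>(t0 / t) powr (\<beta> - 1)\<close> at least 1/2, the second keeps the kernel integral
    over \<open>{t..t0}\<close> at most \<open>Gamma \<beta> / 4\<close>; together these are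
    contradictory.\<close>
  define t1 where "t1 = max (t0 / 2) (t0 - \<eta>)"
  have t1: "0 < t1" "t1 < t0" "t0 / 2 \<le> t1" "t0 - \<eta> \<le> t1" using t0 eta by (auto simp: t1_def)
  have "continuous_on {t1..t0} z"
    unfolding z_def using t1 b
    by (intro continuous_intros continuous_on_compose2[OF qc[of UNIV]] continuous_on_powr') auto
  \<comment> \<open>Comparing \<open>t0\<close> with a maximum point bounds \<open>z\<close> on
    \<open>{t..t0}\<close> by \<open>z t\<close>, so that \<open>z t\<close> can be divided out at
    the end.\<close>
  then obtain t where t: "t \<in> {t1..t0}" and tmax: "\<And>s. s \<in> {t1..t0} \<Longrightarrow> z s \<le> z t"
    using continuous_attains_sup[of "{t1..t0}" z] t1 by auto
  have zt: "0 < z t" using tmax[of t1] zpos[of t1] t1 by auto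
  then have tlt: "t < t0" using zt0 t by (cases "t = t0") auto
  have tpos: "0 < t" using t t1 by auto
  let ?P = "\<lambda>t s. indicator {0..t} s *\<^sub>R ((t - s) powr (\<beta> - 1) * z s)"
  have V: "integrable lborel (?P s)" "(LBINT v. ?P s v) = s powr (\<beta> - 1) - Gamma \<beta> * z s"
    if "0 < s" for s
    using mittag_leffler_volterra[OF b(1) b(1) that] G
    by (simp_all add: z_def q_def set_integrable_def set_lebesgue_integral_def algebra_simps)
  let ?E = "\<lambda>s. indicator {t..t0} s *\<^sub>R ((t0 - s) powr (\<beta> - 1))"
  have E: "integrable lborel ?E" "(LBINT s. ?E s) = (t0 - t) powr \<beta> / \<beta>"
    using set_integral_powr_endpoint[OF b(1), of t t0] tlt
    by (auto simp: set_integrable_def set_lebesgue_integral_def)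
  have PE: "integrable lborel (\<lambda>s. (t0 / t) powr (\<beta> - 1) * ?P t s)" "integrable lborel (\<lambda>s. z t * ?E s)"
    by (rule integrable_mult_right[OF V(1)[OF tpos]], rule integrable_mult_right[OF E(1)])
  \<comment> \<open>For \<open>s < t\<close>, \<open>t0 - s \<ge> (t0 / t) * (t - s)\<close> and the
    exponent is at most 0. With this factor the inhomogeneous terms of the two Volterra equations
    cancel exactly.\<close>
  have "(LBINT s. ?P t0 s) \<le> (LBINT s. ((t0 / t) powr (\<beta> - 1) * ?P t s + z t * ?E s))"
  proof (rule integral_mono)
    fix s
    show "?P t0 s \<le> (t0 / t) powr (\<beta> - 1) * ?P t s + z t * ?E s"
    proof (cases "0 < s \<and> s < t")
      case True
      have "(t0 - s) powr (\<beta> - 1) \<le> ((t0 / t) * (t - s)) powr (\<beta> - 1)"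
        using True tlt b tpos by (intro powr_mono2') (auto simp: field_simps)
      also have "\<dots> = (t0 / t) powr (\<beta> - 1) * (t - s) powr (\<beta> - 1)"
        by (rule powr_mult)
      finally show ?thesis
        using True tlt zpos[of s] by (simp add: mult.assoc[symmetric])
    next
      case False
      then consider "s \<le> 0" | "t \<le> s" "s \<le> t0" | "t0 < s" using tlt by linarith
      then show ?thesis
      proof cases
        case 2
        then show ?thesis
          using mult_right_mono[OF tmax[of s], of "(t0 - s) powr (\<beta> - 1)"] t tpos zt
          by (cases "s = t") (auto simp: mult.commute)
      qed (use tlt tpos in \<open>auto simp: indicator_def z_def\<close>)
    qed
  qed (rule V(1)[OF t0(1)], rule Bochner_Integration.integrable_add[OF PE])
  also have "\<dots> = (t0 / t) powr (\<beta> - 1) * (LBINT s. ?P t s) + z t * (LBINT s. ?E s)"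
    unfolding Bochner_Integration.integral_add[OF PE] by simp
  finally have "t0 powr (\<beta> - 1) - Gamma \<beta> * z t0 \<le>
      (t0 / t) powr (\<beta> - 1) * (t powr (\<beta> - 1) - Gamma \<beta> * z t) + z t * ((t0 - t) powr \<beta> / \<beta>)"
    unfolding V(2)[OF t0(1)] V(2)[OF tpos] E(2) .
  moreover have "(t0 / t) powr (\<beta> - 1) * t powr (\<beta> - 1) = t0 powr (\<beta> - 1)"
    using t0 tpos by (simp add: powr_divide)
  moreover have "Gamma \<beta> * z t0 \<le> 0" using G zt0 by (simp add: mult_nonneg_nonpos)
  ultimately have "z t * ((t0 / t) powr (\<beta> - 1) * Gamma \<beta>) \<le> z t * ((t0 - t) powr \<beta> / \<beta>)"
    by (simp add: algebra_simps)
  then have "(t0 / t) powr (\<beta> - 1) * Gamma \<beta> \<le> (t0 - t) powr \<beta> / \<beta>"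
    using zt by (rule mult_left_le_imp_le)
  also have "\<dots> \<le> \<eta> powr \<beta> / \<beta>"
    using b tlt t t1 by (intro divide_right_mono powr_mono2) auto
  finally have "(t0 / t) powr (\<beta> - 1) \<le> 1 / 4" using eta G by simp
  moreover have "2 powr (- 1) \<le> (2 :: real) powr (\<beta> - 1)" using b by (intro powr_mono) auto
  moreover have "2 powr (\<beta> - 1) \<le> (t0 / t) powr (\<beta> - 1)"
    using b tpos t t1 t0 by (intro powr_mono2') (auto simp: field_simps)
  ultimately show False by (simp add: powr_minus)
qed

text \<open>The factor \<open>Suc k\<close> from termwise differentiation cancels through
  \<open>Gamma (1 + \<beta> * Suc k) = \<beta> * Suc k * Gamma (\<beta> + \<beta> *
  k)\<close>.\<close>

lemma DERIV_mittag_leffler: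
  assumes "0 < \<beta>"
  shows "(mittag_leffler \<beta> has_real_derivative mittag_leffler2 \<beta> \<beta> x / \<beta>) (at x)"
proof -
  define c where "c k = inverse (Gamma (1 + \<beta> * real k))" for k
  have s: "summable (\<lambda>k. c k * y ^ k)" for y :: real
    unfolding c_def by (rule summable_mittag_leffler2[OF assms])
  have d: "diffs c k * x ^ k = (inverse (Gamma (\<beta> + \<beta> * real k)) * x ^ k) / \<beta>" for k
  proof -
    have p: "0 < \<beta> + \<beta> * real k" using assms by (simp add: add_pos_nonneg)
    then have "\<beta> + \<beta> * real k \<notin> \<int>\<^sub>\<le>\<^sub>0"
      by (meson nonpos_Ints_nonpos not_le)
    then have "Gamma (\<beta> + \<beta> * real k + 1) = (\<beta> + \<beta> * real k) * Gamma (\<beta> + \<beta> * real k)"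
      by (rule Gamma_plus1)
    moreover have "\<beta> + \<beta> * real k = \<beta> * real (Suc k)" "\<beta> * real (Suc k) + 1 = 1 + \<beta> * real (Suc k)"
      by (simp_all add: distrib_left)
    ultimately have G: "Gamma (1 + \<beta> * real (Suc k)) = \<beta> * real (Suc k) * Gamma (\<beta> + \<beta> * real k)"
      by (simp only:)
    have "real (Suc k) * inverse (\<beta> * real (Suc k) * g) = inverse g / \<beta>" for g
      using assms by (simp add: divide_inverse)
    then show ?thesis
      unfolding diffs_def c_def G by simp
  qed
  have "((\<lambda>x. \<Sum>k. c k * x ^ k) has_real_derivative (\<Sum>k. diffs c k * x ^ k)) (at x)"
    by (rule termdiffs_strong_converges_everywhere[OF s])
  then show ?thesis
    unfolding d suminf_divide[OF summable_mittag_leffler2[OF assms]]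
    by (simp add: mittag_leffler_eq mittag_leffler2_def[abs_def] c_def)
qed

lemma mittag_leffler_antimono:
  assumes "0 < \<beta>" "\<beta> \<le> 1" "0 \<le> x" "x \<le> y"
  shows "mittag_leffler \<beta> (- y) \<le> mittag_leffler \<beta> (- x)"
proof (rule DERIV_nonpos_imp_nonincreasing[OF assms(4)])
  fix v assume "x \<le> v" "v \<le> y"
  moreover have "((\<lambda>x. mittag_leffler \<beta> (- x)) has_real_derivative
      mittag_leffler2 \<beta> \<beta> (- v) / \<beta> * (- 1)) (at v)"
    by (rule DERIV_chain2[OF DERIV_mittag_leffler]) (auto intro!: derivative_eq_intros assms)
  ultimately show "\<exists>D. ((\<lambda>x. mittag_leffler \<beta> (- x)) has_real_derivative D) (at v) \<and> D \<le> 0"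
    using mittag_leffler2_pos[OF assms(1,2), of v, THEN less_imp_le] assms
    by (intro exI[of _ "mittag_leffler2 \<beta> \<beta> (- v) / \<beta> * (- 1)"]) simp
qed

lemma mittag_leffler_0 [simp]: "mittag_leffler \<beta> 0 = 1"
  by (simp add: mittag_leffler_eq mittag_leffler2_0)

lemma mittag_leffler_le_1:
  assumes "0 < \<beta>" "\<beta> \<le> 1" "0 \<le> x"
  shows "mittag_leffler \<beta> (- x) \<le> 1"
  using mittag_leffler_antimono[OF assms(1,2), of 0 x] assms by simp

text \<open>A negative value \<open>- c\<close> at \<open>x = T powr \<beta>\<close> would, by
  monotonicity, bound the function above by \<open>- c\<close> from then on. The Volterra integral
  up to \<open>T + D\<close> would eventually be nonpositive, while the right side
  \<open>Gamma \<beta> * (1 - y)\<close> stays positive.\<close>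

lemma mittag_leffler_nonneg:
  assumes b: "0 < \<beta>" "\<beta> \<le> 1" and x: "0 \<le> x"
  shows "0 \<le> mittag_leffler \<beta> (- x)"
proof (rule ccontr)
  define y where "y x = mittag_leffler \<beta> (- x)" for x
  define c where "c = - y x"
  assume "\<not> 0 \<le> mittag_leffler \<beta> (- x)"
  then have c: "0 < c" by (simp add: c_def y_def)
  then have xpos: "0 < x" using x by (cases "x = 0") (auto simp: c_def y_def)
  define T where "T = x powr (1 / \<beta>)"
  have T: "0 < T" "T powr \<beta> = x" using xpos b by (auto simp: T_def powr_powr)
  \<comment> \<open>Balances the two estimates: the contribution of \<open>{0..T}\<close> is at most
    \<open>D powr (\<beta> - 1) * T\<close>, that of \<open>{T..T + D}\<close> at most
    \<open>- c * D powr \<beta> / \<beta>\<close>, and their sum is 0.\<close>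
  define D where "D = \<beta> * T / c"
  have D: "0 < D" using b T c by (simp add: D_def)
  \<comment> \<open>\<open>s powr 0\<close> is the factor \<open>s powr (\<delta> - 1)\<close> for
    \<delta> = 1; it is 1 for positive \<open>s\<close> but 0 at \<open>s = 0\<close>.\<close>
  let ?g = "\<lambda>s. indicator {0..T + D} s *\<^sub>R ((T + D - s) powr (\<beta> - 1) * (s powr 0 * y (s powr \<beta>)))"
  have V: "integrable lborel ?g" "(LBINT s. ?g s) = Gamma \<beta> * (1 - y ((T + D) powr \<beta>))"
    using mittag_leffler_volterra[OF b(1) zero_less_one add_pos_pos[OF T(1) D]] T(1) D
    unfolding y_def mittag_leffler_eq set_integrable_def set_lebesgue_integral_def
    by simp_all
  let ?E = "\<lambda>s. indicator {T..T + D} s *\<^sub>R ((T + D - s) powr (\<beta> - 1))"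
  have E: "integrable lborel ?E" "(LBINT s. ?E s) = D powr \<beta> / \<beta>"
    using set_integral_powr_endpoint[OF b(1), of T "T + D"] D
    unfolding set_integrable_def set_lebesgue_integral_def by simp_all
  let ?I = "\<lambda>s. indicator {0..T} s :: real"
  have I: "integrable lborel ?I" "(LBINT s. ?I s) = T" using T by auto
  have yT: "y (s powr \<beta>) \<le> - c" if "T \<le> s" for s
    using mittag_leffler_antimono[OF b, of "x" "s powr \<beta>"] powr_mono2[of \<beta> T s] that T b x
    by (simp add: y_def c_def)
  have IE: "integrable lborel (\<lambda>s. D powr (\<beta> - 1) * ?I s)" "integrable lborel (\<lambda>s. c * ?E s)"
    by (rule integrable_mult_right[OF I(1)], rule integrable_mult_right[OF E(1)])
  have "(LBINT s. ?g s) \<le> (LBINT s. (D powr (\<beta> - 1) * ?I s - c * ?E s))"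
  proof (rule integral_mono)
    fix s
    consider "s < 0" | "0 \<le> s" "s < T" | "T \<le> s" "s \<le> T + D" | "T + D < s" by linarith
    then show "?g s \<le> D powr (\<beta> - 1) * ?I s - c * ?E s"
    proof cases
      case 2
      have "(T + D - s) powr (\<beta> - 1) * (s powr 0 * y (s powr \<beta>)) \<le> (T + D - s) powr (\<beta> - 1) * 1"
        using mittag_leffler_le_1[OF b, of "s powr \<beta>"]
        by (intro mult_left_mono) (auto simp: y_def)
      also have "\<dots> \<le> D powr (\<beta> - 1)" using 2 b D by (auto intro!: powr_mono2')
      finally show ?thesis using 2 T D by simp
    next
      case 3
      have "(T + D - s) powr (\<beta> - 1) * (s powr 0 * y (s powr \<beta>)) \<le> (T + D - s) powr (\<beta> - 1) * (- c)"
        using yT[OF 3(1)] 3 T by (intro mult_left_mono) auto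
      moreover have "0 \<le> D powr (\<beta> - 1) * ?I s" by simp
      ultimately have "(T + D - s) powr (\<beta> - 1) * (s powr 0 * y (s powr \<beta>)) \<le>
          D powr (\<beta> - 1) * ?I s + (T + D - s) powr (\<beta> - 1) * (- c)" by linarith
      then show ?thesis using 3 T by (simp add: mult.commute)
    qed (use T D in \<open>auto simp: indicator_def\<close>)
  qed (rule V(1), rule Bochner_Integration.integrable_diff[OF IE])
  also have "\<dots> = D powr (\<beta> - 1) * T - c * (D powr \<beta> / \<beta>)"
    unfolding Bochner_Integration.integral_diff[OF IE] integral_mult_right_zero E I ..
  also have "D powr \<beta> = D powr (\<beta> - 1) * D" using D by (simp add: powr_diff)
  also have "D powr (\<beta> - 1) * T - c * (D powr (\<beta> - 1) * D / \<beta>) = 0"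
    using b c by (simp add: D_def)
  finally have "Gamma \<beta> * (1 - y ((T + D) powr \<beta>)) \<le> 0" unfolding V(2) .
  moreover have "0 < Gamma \<beta>" by (rule Gamma_real_pos[OF b(1)])
  ultimately show False using yT[of "T + D"] D c by (simp add: mult_le_0_iff)
qed

text \<open>By monotonicity the Volterra integral up to \<open>t = x powr (1 / \<beta>)\<close> is
  at least the final value \<open>y x\<close> times the kernel integral \<open>x / \<beta>\<close>,
  and it equals \<open>Gamma \<beta> * (1 - y x) \<le> Gamma \<beta>\<close>.\<close>

lemma mittag_leffler_le_inverse:
  assumes b: "0 < \<beta>" "\<beta> \<le> 1" and x: "0 \<le> x"
  shows "x * mittag_leffler \<beta> (- x) \<le> Gamma (1 + \<beta>)"
proof (cases "x = 0")
  case False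
  define y where "y x = mittag_leffler \<beta> (- x)" for x
  define t where "t = x powr (1 / \<beta>)"
  have t: "0 < t" "t powr \<beta> = x" using False x b by (auto simp: t_def powr_powr)
  have G1: "Gamma (1 + \<beta>) = \<beta> * Gamma \<beta>"
    unfolding add.commute[of 1 \<beta>] using b by (intro Gamma_plus1) (meson nonpos_Ints_nonpos not_le)
  let ?g = "\<lambda>s. indicator {0..t} s *\<^sub>R ((t - s) powr (\<beta> - 1) * (s powr 0 * y (s powr \<beta>)))"
  let ?h = "\<lambda>s. indicator {0..t} s *\<^sub>R ((t - s) powr (\<beta> - 1) * s powr 0)"
  have V: "integrable lborel ?g" "(LBINT s. ?g s) = Gamma \<beta> * (1 - y x)"
    using mittag_leffler_volterra[OF b(1) zero_less_one t(1)] t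
    unfolding y_def mittag_leffler_eq set_integrable_def set_lebesgue_integral_def
    by simp_all
  have B: "Beta \<beta> 1 = 1 / \<beta>"
  proof -
    obtain g where "Gamma \<beta> = g" "0 < g" using Gamma_real_pos[OF b(1)] by blast
    then show ?thesis using G1 b(1) by (simp add: Beta_def add.commute)
  qed
  have H: "integrable lborel ?h" "(LBINT s. ?h s) = x / \<beta>"
    using Beta_convolution[of \<beta> 1 t] b t B
    by (simp_all add: set_integrable_def set_lebesgue_integral_def)
  have "y x * (x / \<beta>) = (LBINT s. y x * ?h s)" using H by simp
  also have "\<dots> \<le> (LBINT s. ?g s)"
  proof (rule integral_mono)
    fix s
    show "y x * ?h s \<le> ?g s"
    proof (cases "0 < s \<and> s \<le> t")
      case True
      then have "y x \<le> y (s powr \<beta>)"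
        unfolding y_def using b t by (intro mittag_leffler_antimono) (auto intro!: powr_mono2[of \<beta> s t, simplified])
      then show ?thesis
        using True mult_right_mono[of "y x" "y (s powr \<beta>)" "(t - s) powr (\<beta> - 1)"] by (simp add: mult.commute)
    qed (auto simp: indicator_def)
  qed (intro V H integrable_mult_right)+
  also have "\<dots> \<le> Gamma \<beta>"
    unfolding V(2) using Gamma_real_pos[OF b(1)] mittag_leffler_nonneg[OF b x] by (simp add: y_def)
  finally show ?thesis using b G1 by (simp add: y_def field_simps)
qed (use b in \<open>simp add: less_imp_le add_pos_pos\<close>)

lemma mittag_leffler_decay:
  assumes b: "0 < \<beta>" "\<beta> \<le> 1" and x: "0 \<le> x"
  shows "\<bar>mittag_leffler \<beta> (- x)\<bar> \<le> (1 + Gamma (1 + \<beta>)) / (1 + x)"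
  using mittag_leffler_le_inverse[OF assms] mittag_leffler_nonneg[OF assms] mittag_leffler_le_1[OF assms] x
  by (simp add: field_simps)

section \<open>Gaussian stochastic integrals\<close>

abbreviation msq :: "'a measure \<Rightarrow> ('a \<Rightarrow> complex) \<Rightarrow> real" where
  "msq M f \<equiv> \<integral>x. (cmod (f x))\<^sup>2 \<partial>M"

definition sq_integrable :: "'a measure \<Rightarrow> ('a \<Rightarrow> complex) \<Rightarrow> bool" where
  "sq_integrable M f \<longleftrightarrow> f \<in> borel_measurable M \<and> integrable M (\<lambda>x. (cmod (f x))\<^sup>2)"

lemma sq_integrableD:
  assumes "sq_integrable M f"
  shows "f \<in> borel_measurable M" "integrable M (\<lambda>x. (cmod (f x))\<^sup>2)"
  using assms by (simp_all add: sq_integrable_def)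

lemma cmod_add_square_le: "(cmod (x + y))\<^sup>2 \<le> 2 * (cmod x)\<^sup>2 + 2 * (cmod y)\<^sup>2"
proof -
  have "(cmod (x + y))\<^sup>2 \<le> (cmod x + cmod y)\<^sup>2"
    by (intro power_mono norm_triangle_ineq) simp
  also have "\<dots> \<le> 2 * (cmod x)\<^sup>2 + 2 * (cmod y)\<^sup>2"
    using sum_squares_bound[of "cmod x" "cmod y"] by (simp add: power2_sum)
  finally show ?thesis .
qed

lemma sq_integrable_add:
  assumes "sq_integrable M f" "sq_integrable M g"
  shows "sq_integrable M (\<lambda>x. f x + g x)"
proof -
  note [measurable] = sq_integrableD(1)[OF assms(1)] sq_integrableD(1)[OF assms(2)]
  have "integrable M (\<lambda>x. 2 * (cmod (f x))\<^sup>2 + 2 * (cmod (g x))\<^sup>2)"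
    using assms by (simp add: sq_integrable_def)
  then have "integrable M (\<lambda>x. (cmod (f x + g x))\<^sup>2)"
    by (rule Bochner_Integration.integrable_bound) (auto intro!: cmod_add_square_le)
  then show ?thesis by (simp add: sq_integrable_def)
qed

lemma sq_integrable_mult_left:
  "sq_integrable M f \<Longrightarrow> sq_integrable M (\<lambda>x. c * f x)"
  by (auto simp: sq_integrable_def norm_mult power_mult_distrib)

lemma sq_integrable_diff:
  "sq_integrable M f \<Longrightarrow> sq_integrable M g \<Longrightarrow> sq_integrable M (\<lambda>x. f x - g x)"
  using sq_integrable_add[OF _ sq_integrable_mult_left[of M g "-1"], of f] by simp

lemma sq_integrable_0: "sq_integrable M (\<lambda>x. 0)"
  by (simp add: sq_integrable_def)

lemma borel_measurable_cnj [measurable (raw)]: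
  "f \<in> borel_measurable M \<Longrightarrow> (\<lambda>x. cnj (f x)) \<in> borel_measurable M"
  by (rule measurable_compose[OF _ borel_measurable_continuous_onI]) (auto intro: continuous_intros)

lemma sq_integrable_mult_cnj:
  assumes "sq_integrable M f" "sq_integrable M g"
  shows "integrable M (\<lambda>x. f x * cnj (g x))"
proof -
  note [measurable] = sq_integrableD(1)[OF assms(1)] sq_integrableD(1)[OF assms(2)]
  have "(\<lambda>x. f x * cnj (g x)) \<in> borel_measurable M"
    by measurable
  have "integrable M (\<lambda>x. (cmod (f x))\<^sup>2 + (cmod (g x))\<^sup>2)"
    using assms by (simp add: sq_integrable_def)
  then show ?thesis
  proof (rule Bochner_Integration.integrable_bound)
    have "2 * (cmod (f x) * cmod (g x)) \<le> (cmod (f x))\<^sup>2 + (cmod (g x))\<^sup>2" for x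
      using sum_squares_bound[of "cmod (f x)" "cmod (g x)"] by simp
    moreover have "0 \<le> cmod (f x) * cmod (g x)" for x by simp
    ultimately have "cmod (f x) * cmod (g x) \<le> (cmod (f x))\<^sup>2 + (cmod (g x))\<^sup>2" for x
      by (smt (verit))
    then show "AE x in M. norm (f x * cnj (g x)) \<le> norm ((cmod (f x))\<^sup>2 + (cmod (g x))\<^sup>2)"
      by (simp add: norm_mult)
  qed measurable
qed

text \<open>Young's inequality with weight \<open>d\<close>. Only \<open>y\<close> occurs in the
  term carrying \<open>d\<close>, so \<open>d\<close> can be fixed before \<open>x\<close> runs
  through an approximating sequence.\<close>

lemma cmod_square_diff_le:
  assumes "0 < d"
  shows "\<bar>(cmod x)\<^sup>2 - (cmod y)\<^sup>2\<bar> \<le> (1 + 1 / d) * (cmod (y - x))\<^sup>2 + d * (cmod y)\<^sup>2"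
proof -
  define a b e where "a = cmod x" "b = cmod y" "e = cmod (y - x)"
  have t: "\<bar>a - b\<bar> \<le> e" "0 \<le> a" "0 \<le> b" "0 \<le> e"
    using norm_triangle_ineq3[of y x] by (auto simp: a_b_e_def abs_minus_commute)
  have "\<bar>a\<^sup>2 - b\<^sup>2\<bar> = \<bar>a - b\<bar> * (a + b)"
    using t by (simp add: power2_eq_square square_diff_square_factored abs_mult)
  also have "\<dots> \<le> e * (2 * b + e)" using t by (intro mult_mono) auto
  also have "\<dots> \<le> (1 + 1 / d) * e\<^sup>2 + d * b\<^sup>2"
  proof -
    \<comment> \<open>Completing this square is the bound on \<open>2 * e * b\<close>.\<close>
    have "0 \<le> (e / sqrt d - sqrt d * b)\<^sup>2" by simp
    also have "\<dots> = e\<^sup>2 / d + d * b\<^sup>2 - 2 * e * b"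
      using assms by (simp add: power2_diff power_divide power_mult_distrib)
    finally show ?thesis by (simp add: power2_eq_square algebra_simps)
  qed
  finally show ?thesis by (simp add: a_b_e_def)
qed

lemma sq_integrable_norm_tendsto:
  assumes f: "sq_integrable M f" and g: "\<And>n. sq_integrable M (g n)"
    and lim: "(\<lambda>n. \<integral>x. (cmod (f x - g n x))\<^sup>2 \<partial>M) \<longlonglongrightarrow> 0"
  shows "(\<lambda>n. \<integral>x. (cmod (g n x))\<^sup>2 \<partial>M) \<longlonglongrightarrow> (msq M (\<lambda>x. f x))"
proof (rule LIMSEQ_I)
  fix r :: real assume r: "0 < r"
  define K where "K = (msq M (\<lambda>x. f x))"
  \<comment> \<open>The summand 1 covers \<open>K = 0\<close> and makes \<open>d * K < r / 2\<close>
    strict.\<close>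
  define d where "d = r / (2 * (K + 1))"
  have K: "0 \<le> K" by (simp add: K_def)
  have d: "0 < d" "d * K < r / 2"
    using K r by (auto simp: d_def field_simps)
  have b: "\<bar>(msq M (\<lambda>x. g n x)) - K\<bar> \<le> (1 + 1 / d) * (msq M (\<lambda>x. f x - g n x)) + d * K" for n
  proof -
    note i = sq_integrableD(2)[OF f] sq_integrableD(2)[OF g[of n]]
      sq_integrableD(2)[OF sq_integrable_diff[OF f g[of n]]]
    have "\<bar>(msq M (\<lambda>x. g n x)) - K\<bar> = \<bar>\<integral>x. (cmod (g n x))\<^sup>2 - (cmod (f x))\<^sup>2 \<partial>M\<bar>"
      using i by (simp add: K_def)
    also have "\<dots> \<le> (\<integral>x. \<bar>(cmod (g n x))\<^sup>2 - (cmod (f x))\<^sup>2\<bar> \<partial>M)"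
      by (rule integral_abs_bound)
    also have "\<dots> \<le> (\<integral>x. (1 + 1 / d) * (cmod (f x - g n x))\<^sup>2 + d * (cmod (f x))\<^sup>2 \<partial>M)"
      using i by (intro integral_mono cmod_square_diff_le d) auto
    also have "\<dots> = (1 + 1 / d) * (msq M (\<lambda>x. f x - g n x)) + d * K"
      using i by (simp add: K_def)
    finally show ?thesis .
  qed
  have "(\<lambda>n. (1 + 1 / d) * (msq M (\<lambda>x. f x - g n x))) \<longlonglongrightarrow> (1 + 1 / d) * 0"
    by (intro tendsto_intros lim)
  then have "eventually (\<lambda>n. (1 + 1 / d) * (msq M (\<lambda>x. f x - g n x)) < r / 2) sequentially"
    using r by (intro order_tendstoD(2)) auto
  then obtain N where N: "\<And>n. N \<le> n \<Longrightarrow> (1 + 1 / d) * (msq M (\<lambda>x. f x - g n x)) < r / 2"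
    by (auto simp: eventually_sequentially)
  show "\<exists>N. \<forall>n\<ge>N. norm ((msq M (\<lambda>x. g n x)) - (msq M (\<lambda>x. f x))) < r"
    using order_le_less_trans[OF b add_strict_mono[OF N d(2)]] by (auto simp: K_def)
qed

section \<open>Centred Gaussian variables, their characteristic functions and mean-square
  limits\<close>

lemma char_normal_density:
  assumes "0 < \<sigma>"
  shows "char (density lborel (normal_density 0 \<sigma>)) \<theta> = exp (- (\<theta>\<^sup>2 * \<sigma>\<^sup>2) / 2)"
proof -
  let ?N = "density lborel (normal_density 0 \<sigma>)"
  interpret N: prob_space ?N by (rule prob_space_normal_density[OF assms])
  have d: "distributed ?N lborel (\<lambda>x. x) (normal_density 0 \<sigma>)"
    by (auto simp: distributed_def distr_id2)
  then have "distributed ?N lborel (\<lambda>x. (x - 0) / \<sigma>) std_normal_density"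
    using N.normal_standard_normal_convert[OF assms, of "\<lambda>x. x" 0] by simp
  then have *: "distr ?N lborel (\<lambda>x. x / \<sigma>) = density lborel std_normal_density"
    by (simp add: distributed_distr_eq_density)
  have "char ?N \<theta> = (CLINT x|?N. iexp ((\<theta> * \<sigma>) * (x / \<sigma>)))"
    using assms by (simp add: char_def)
  also have "\<dots> = (CLINT y|distr ?N lborel (\<lambda>x. x / \<sigma>). iexp ((\<theta> * \<sigma>) * y))"
    by (subst integral_distr) auto
  also have "\<dots> = char std_normal_distribution (\<theta> * \<sigma>)"
    unfolding * by (simp add: char_def)
  finally show ?thesis
    by (simp add: char_std_normal_distribution power_mult_distrib)
qed

context prob_space
begin

lemma gaussian_rv_sq_integrable:
  assumes "gaussian_rv M X"
  shows "integrable M (\<lambda>w. (X w)\<^sup>2)"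
proof -
  have [measurable]: "X \<in> borel_measurable M" using assms by (simp add: gaussian_rv_def)
  obtain m where "(AE w in M. X w = m) \<or> (\<exists>\<sigma>>0. distributed M lborel X (\<lambda>x. ennreal (normal_density m \<sigma> x)))"
    using assms by (auto simp: gaussian_rv_def)
  then show ?thesis
  proof (elim disjE exE conjE)
    assume "AE w in M. X w = m"
    then have ae: "AE w in M. m\<^sup>2 = (X w)\<^sup>2" by auto
    have "integrable M (\<lambda>w. m\<^sup>2)" by simp
    then show ?thesis by (rule integrable_cong_AE_imp) (use ae in auto)
  next
    fix \<sigma> :: real assume s: "0 < \<sigma>" and d: "distributed M lborel X (\<lambda>x. ennreal (normal_density m \<sigma> x))"
    have "integrable lborel (\<lambda>x. normal_density m \<sigma> x * x\<^sup>2)"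
    proof -
      \<comment> \<open>Expansion of \<open>x\<^sup>2\<close> around \<open>m\<close>, which reduces
        the second moment to central moments.\<close>
      have "integrable lborel (\<lambda>x. normal_density m \<sigma> x * (x - m) ^ 2 + (2 * m) * (normal_density m \<sigma> x * (x - m) ^ 1) + m\<^sup>2 * normal_density m \<sigma> x)"
        by (intro Bochner_Integration.integrable_add integrable_mult_right integrable_normal_moment integrable_normal_density s)
      moreover have "normal_density m \<sigma> x * (x - m) ^ 2 + (2 * m) * (normal_density m \<sigma> x * (x - m) ^ 1) + m\<^sup>2 * normal_density m \<sigma> x = normal_density m \<sigma> x * x\<^sup>2" for x
        by (simp add: power2_eq_square algebra_simps)
      ultimately show ?thesis by simp
    qed
    then show ?thesis
      using distributed_integrable[OF d, of "\<lambda>x. x\<^sup>2"] by simp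
  qed
qed

lemma gaussian_rv_char:
  assumes "gaussian_rv M X" "expectation X = 0"
  shows "char (distr M borel X) \<theta> = exp (- (\<theta>\<^sup>2 * expectation (\<lambda>w. (X w)\<^sup>2)) / 2)"
proof -
  have [measurable]: "X \<in> borel_measurable M" using assms by (simp add: gaussian_rv_def)
  obtain m where "(AE w in M. X w = m) \<or> (\<exists>\<sigma>>0. distributed M lborel X (\<lambda>x. ennreal (normal_density m \<sigma> x)))"
    using assms by (auto simp: gaussian_rv_def)
  then show ?thesis
  proof (elim disjE exE conjE)
    assume ae: "AE w in M. X w = m"
    have "expectation X = expectation (\<lambda>_. m)" by (rule integral_cong_AE) (use ae in auto)
    then have m: "m = 0" using assms by (simp add: prob_space)
    have "expectation (\<lambda>w. (X w)\<^sup>2) = expectation (\<lambda>_. 0)"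
      by (rule integral_cong_AE) (use ae m in auto)
    moreover have "char (distr M borel X) \<theta> = expectation (\<lambda>w. iexp (\<theta> * X w))"
      by (simp add: char_def integral_distr)
    moreover have "\<dots> = expectation (\<lambda>_. 1 :: complex)"
      by (rule integral_cong_AE) (use ae m in auto)
    ultimately show ?thesis by (simp add: prob_space)
  next
    fix \<sigma> :: real assume s: "0 < \<sigma>" and d: "distributed M lborel X (\<lambda>x. ennreal (normal_density m \<sigma> x))"
    have m: "m = 0" using normal_distributed_expectation[OF s d] assms by simp
    have v: "expectation (\<lambda>w. (X w)\<^sup>2) = \<sigma>\<^sup>2"
      using normal_distributed_variance[OF s d] assms by simp
    have "distr M borel X = density lborel (normal_density 0 \<sigma>)"
      using distributed_distr_eq_density[OF d] m by (simp cong: distr_cong)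
    then show ?thesis using char_normal_density[OF s, of \<theta>] v by simp
  qed
qed

text \<open>Zero variance gives the degenerate alternative of \<open>gaussian_rv\<close>; otherwise
  Levy uniqueness identifies the law with a normal density.\<close>

lemma gaussian_rv_of_char:
  assumes X: "X \<in> borel_measurable M" and i: "integrable M (\<lambda>w. (X w)\<^sup>2)"
    and c: "\<And>\<theta>. char (distr M borel X) \<theta> = exp (- (\<theta>\<^sup>2 * expectation (\<lambda>w. (X w)\<^sup>2)) / 2)"
  shows "gaussian_rv M X"
proof (cases "expectation (\<lambda>w. (X w)\<^sup>2) = 0")
  case True
  then have "AE w in M. (X w)\<^sup>2 = 0"
    using i by (subst (asm) integral_nonneg_eq_0_iff_AE) auto
  then show ?thesis using X by (auto simp: gaussian_rv_def)
next
  case False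
  define \<sigma> where "\<sigma> = sqrt (expectation (\<lambda>w. (X w)\<^sup>2))"
  have "0 < expectation (\<lambda>w. (X w)\<^sup>2)" using False by (simp add: less_le)
  then have s: "0 < \<sigma>" "\<sigma>\<^sup>2 = expectation (\<lambda>w. (X w)\<^sup>2)"
    using False by (auto simp: \<sigma>_def)
  have "distr M borel X = density lborel (normal_density 0 \<sigma>)"
  proof (rule Levy_uniqueness)
    show "real_distribution (distr M borel X)"
      using X by (rule real_distribution_distr)
    show "real_distribution (density lborel (normal_density 0 \<sigma>))"
      using prob_space_normal_density[OF s(1)]
      by (auto simp: real_distribution_def real_distribution_axioms_def)
    show "char (distr M borel X) = char (density lborel (normal_density 0 \<sigma>))"
      using c s char_normal_density[OF s(1)] by auto
  qed
  then have "distributed M lborel X (\<lambda>x. ennreal (normal_density 0 \<sigma> x))"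
    using X by (auto simp: distributed_def cong: distr_cong)
  then show ?thesis using X s by (auto simp: gaussian_rv_def)
qed

text \<open>The Cauchy-Schwarz bound, as nonnegativity of the variance of
  \<open>\<bar>X\<bar>\<close>.\<close>

lemma expectation_abs_le_sqrt:
  assumes "X \<in> borel_measurable M" "integrable M (\<lambda>w. (X w)\<^sup>2)"
  shows "integrable M X" "expectation (\<lambda>w. \<bar>X w\<bar>) \<le> sqrt (expectation (\<lambda>w. (X w)\<^sup>2))"
proof -
  show i: "integrable M X"
    by (rule square_integrable_imp_integrable[OF assms])
  have "0 \<le> variance (\<lambda>w. \<bar>X w\<bar>)" by (rule variance_positive)
  also have "\<dots> = expectation (\<lambda>w. (X w)\<^sup>2) - (expectation (\<lambda>w. \<bar>X w\<bar>))\<^sup>2"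
    using i assms by (subst variance_eq) auto
  finally show "expectation (\<lambda>w. \<bar>X w\<bar>) \<le> sqrt (expectation (\<lambda>w. (X w)\<^sup>2))"
    by (intro real_le_rsqrt) simp
qed

text \<open>Mean-square convergence gives convergence in mean, and characteristic functions at
  \<theta> differ by at most \<open>\<bar>\<theta>\<bar>\<close> times the mean distance. Variances
  converge too, so the limit again has a Gaussian characteristic function.\<close>

lemma gaussian_rv_limit:
  assumes R: "\<And>n. gaussian_rv M (R n)" "\<And>n. expectation (R n) = 0"
    and X: "X \<in> borel_measurable M" "integrable M (\<lambda>w. (X w)\<^sup>2)"
    and lim: "(\<lambda>n. expectation (\<lambda>w. (X w - R n w)\<^sup>2)) \<longlonglongrightarrow> 0"
  shows "gaussian_rv M X" "expectation X = 0"
proof -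
  have borel_measurable_R [measurable]: "R n \<in> borel_measurable M" for n
    using R(1)[of n] by (simp add: gaussian_rv_def)
  note X(1) [measurable]
  have Ri: "integrable M (\<lambda>w. (R n w)\<^sup>2)" for n
    by (rule gaussian_rv_sq_integrable[OF R(1)])
  have Rs: "sq_integrable M (\<lambda>w. of_real (R n w))" for n
    using Ri by (simp add: sq_integrable_def)
  have Xs: "sq_integrable M (\<lambda>w. of_real (X w))"
    using X by (simp add: sq_integrable_def)
  have c2: "(cmod (complex_of_real a - complex_of_real b))\<^sup>2 = (a - b)\<^sup>2" for a b
    unfolding of_real_diff[symmetric] norm_of_real by simp
  have Di: "integrable M (\<lambda>w. (X w - R n w)\<^sup>2)" for n
    using sq_integrableD(2)[OF sq_integrable_diff[OF Xs Rs[of n]]] by (simp add: c2)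
  note D = expectation_abs_le_sqrt[OF _ Di]
  have lim1: "(\<lambda>n. expectation (\<lambda>w. \<bar>X w - R n w\<bar>)) \<longlonglongrightarrow> 0"
  proof (rule tendsto_sandwich[OF _ _ tendsto_const])
    show "(\<lambda>n. sqrt (expectation (\<lambda>w. (X w - R n w)\<^sup>2))) \<longlonglongrightarrow> 0"
      using tendsto_real_sqrt[OF lim] by simp
  qed (use D in auto)
  have Rint: "integrable M (R n)" for n by (rule expectation_abs_le_sqrt[OF _ Ri]) simp
  have Xint: "integrable M X" by (rule expectation_abs_le_sqrt[OF _ X(2)]) simp
  have "\<bar>expectation X\<bar> \<le> expectation (\<lambda>w. \<bar>X w - R n w\<bar>)" for n
  proof -
    have "\<bar>expectation X\<bar> = \<bar>expectation (\<lambda>w. X w - R n w)\<bar>"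
      using Rint Xint R(2) by simp
    also have "\<dots> \<le> expectation (\<lambda>w. \<bar>X w - R n w\<bar>)" by (rule integral_abs_bound)
    finally show ?thesis .
  qed
  then have "\<bar>expectation X\<bar> \<le> 0"
    by (intro LIMSEQ_le_const[OF lim1]) auto
  then show "expectation X = 0" by simp
  have v: "(\<lambda>n. expectation (\<lambda>w. (R n w)\<^sup>2)) \<longlonglongrightarrow> expectation (\<lambda>w. (X w)\<^sup>2)"
    using sq_integrable_norm_tendsto[OF Xs Rs] lim by (simp add: c2)
  show "gaussian_rv M X"
  proof (rule gaussian_rv_of_char[OF X])
    fix \<theta>
    have ch: "char (distr M borel Y) \<theta> = expectation (\<lambda>w. iexp (\<theta> * Y w))"
      if [measurable]: "Y \<in> borel_measurable M" for Y
      by (simp add: char_def integral_distr)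
    have ib: "integrable M (\<lambda>w. iexp (\<theta> * Y w))" if [measurable]: "Y \<in> borel_measurable M" for Y
      by (rule integrable_const_bound[of _ 1]) auto
    have e: "cmod (iexp a - iexp b) \<le> \<bar>a - b\<bar>" for a b
    proof -
      have "\<i> * complex_of_real b + \<i> * complex_of_real (a - b) = \<i> * complex_of_real a"
        by (simp add: algebra_simps)
      then have "iexp b * iexp (a - b) = iexp a"
        by (metis exp_add)
      then have "iexp a - iexp b = iexp b * (iexp (a - b) - 1)"
        by (simp add: right_diff_distrib)
      then have "cmod (iexp a - iexp b) = cmod (iexp (a - b) - 1)"
        by (simp add: norm_mult)
      also have "\<dots> \<le> \<bar>a - b\<bar>" using iexp_approx1[of "a - b" 0] by simp
      finally show ?thesis .
    qed
    have "cmod (char (distr M borel X) \<theta> - char (distr M borel (R n)) \<theta>) \<le>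
        \<bar>\<theta>\<bar> * expectation (\<lambda>w. \<bar>X w - R n w\<bar>)" for n
    proof -
      have "cmod (char (distr M borel X) \<theta> - char (distr M borel (R n)) \<theta>) =
          cmod (expectation (\<lambda>w. iexp (\<theta> * X w) - iexp (\<theta> * R n w)))"
        unfolding ch[OF X(1)] ch[OF borel_measurable_R]
        by (subst Bochner_Integration.integral_diff[OF ib ib]) (simp_all add: borel_measurable_R X)
      also have "\<dots> \<le> expectation (\<lambda>w. cmod (iexp (\<theta> * X w) - iexp (\<theta> * R n w)))"
        by (rule integral_norm_bound)
      also have "\<dots> \<le> expectation (\<lambda>w. \<bar>\<theta>\<bar> * \<bar>X w - R n w\<bar>)"
      proof (rule integral_mono)
        show "cmod (iexp (\<theta> * X w) - iexp (\<theta> * R n w)) \<le> \<bar>\<theta>\<bar> * \<bar>X w - R n w\<bar>" for w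
          using e[of "\<theta> * X w" "\<theta> * R n w"] by (simp add: abs_mult[symmetric] right_diff_distrib)
      qed (use ib Rint Xint in auto)
      finally show ?thesis by simp
    qed
    then have "(\<lambda>n. char (distr M borel X) \<theta> - char (distr M borel (R n)) \<theta>) \<longlonglongrightarrow> 0"
      by (intro Lim_null_comparison[OF _ tendsto_mult_right_zero[OF lim1, of "\<bar>\<theta>\<bar>"]] always_eventually allI)
    from tendsto_diff[OF tendsto_const[of "char (distr M borel X) \<theta>"] this]
    have "(\<lambda>n. char (distr M borel (R n)) \<theta>) \<longlonglongrightarrow> char (distr M borel X) \<theta>"
      by simp
    moreover have "(\<lambda>n. char (distr M borel (R n)) \<theta>) \<longlonglongrightarrow>
        complex_of_real (exp (- (\<theta>\<^sup>2 * expectation (\<lambda>w. (X w)\<^sup>2)) / 2))"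
      unfolding gaussian_rv_char[OF R] by (intro tendsto_intros v) simp
    ultimately show "char (distr M borel X) \<theta> = exp (- (\<theta>\<^sup>2 * expectation (\<lambda>w. (X w)\<^sup>2)) / 2)"
      using LIMSEQ_unique by blast
  qed
qed

end

section \<open>Isometry, linearity and Gaussianity of the stochastic integral\<close>

locale white_noise = prob_space M for M :: "'w measure" +
  fixes W :: "real set \<Rightarrow> 'w \<Rightarrow> complex"
  assumes hermitian: "hermitian_white_noise M W"
begin

abbreviation part :: "real set \<times> bool \<Rightarrow> 'w \<Rightarrow> real" where
  "part \<equiv> (\<lambda>(A, b) w. if b then Re (W A w) else Im (W A w))"

lemma part_gaussian: "finite J \<Longrightarrow> J \<subseteq> finite_borel \<times> UNIV \<Longrightarrow> gaussian_rv M (\<lambda>w. \<Sum>i\<in>J. c i * part i w)"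
  using hermitian by (auto simp: hermitian_white_noise_def gaussian_process_def)

lemma part_mean: "i \<in> finite_borel \<times> UNIV \<Longrightarrow> integrable M (part i) \<and> expectation (part i) = 0"
  using hermitian unfolding hermitian_white_noise_def zero_mean_def by blast

text \<open>Gaussianity of the real and imaginary parts supplies the finite second moment.\<close>

lemma sq_integrable_W:
  assumes "A \<in> finite_borel"
  shows "sq_integrable M (W A)"
proof -
  have "gaussian_rv M (part (A, b))" for b
    using part_gaussian[of "{(A, b)}" "\<lambda>_. 1"] assms by simp
  from this[of True] this[of False]
  have g: "gaussian_rv M (\<lambda>w. Re (W A w))" "gaussian_rv M (\<lambda>w. Im (W A w))" by simp_all
  then have "W A \<in> borel_measurable M"
    by (simp add: borel_measurable_complex_iff gaussian_rv_def)
  moreover have "integrable M (\<lambda>w. (cmod (W A w))\<^sup>2)"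
    unfolding cmod_power2
    using g by (intro Bochner_Integration.integrable_add gaussian_rv_sq_integrable)
  ultimately show ?thesis by (simp add: sq_integrable_def)
qed

abbreviation SI :: "(complex \<times> real set) list \<Rightarrow> 'w \<Rightarrow> complex" where
  "SI \<equiv> simple_stoch_integral W"

abbreviation elementary :: "(complex \<times> real set) list \<Rightarrow> bool" where
  "elementary xs \<equiv> (\<forall>(c, A)\<in>set xs. A \<in> finite_borel)"

lemma sq_integrable_indicator:
  "A \<in> finite_borel \<Longrightarrow> sq_integrable lborel (indicator A)"
proof -
  assume "A \<in> finite_borel"
  moreover have "(\<lambda>x. (cmod (indicator A x))\<^sup>2) = indicator A"
    by (auto simp: indicator_def)
  ultimately show "sq_integrable lborel (indicator A)"
    by (auto simp: sq_integrable_def finite_borel_def)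
qed

lemma sq_integrable_simple_stoch_integral:
  "elementary xs \<Longrightarrow> sq_integrable M (SI xs)"
proof (induction xs)
  case (Cons p xs)
  then show ?case
    using sq_integrable_add[OF sq_integrable_mult_left[OF sq_integrable_W], of "snd p" "SI xs" "fst p"]
    by (cases p) (simp add: simple_stoch_integral_def[abs_def])
qed (simp add: simple_stoch_integral_def[abs_def] sq_integrable_0)

lemma sq_integrable_simple_fun:
  "elementary xs \<Longrightarrow> sq_integrable lborel (simple_fun xs)"
proof (induction xs)
  case (Cons p xs)
  then show ?case
    using sq_integrable_add[OF sq_integrable_mult_left[OF sq_integrable_indicator], of "snd p" "simple_fun xs" "fst p"]
    by (cases p) (simp add: simple_fun_def[abs_def])
qed (simp add: simple_fun_def[abs_def] sq_integrable_0)

lemma W_covariance: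
  assumes "A \<in> finite_borel" "B \<in> finite_borel"
  shows "(\<integral>w. W A w * cnj (W B w) \<partial>M) = (LBINT l. indicator A l * cnj (indicator B l))"
proof -
  have "(LBINT l. indicator A l * cnj (indicator B l)) = (LBINT l. complex_of_real (indicator (A \<inter> B) l))"
    by (intro Bochner_Integration.integral_cong) (auto simp: indicator_def)
  also have "\<dots> = complex_of_real (measure lborel (A \<inter> B))"
    unfolding integral_complex_of_real by simp
  finally show ?thesis
    using hermitian assms by (simp add: hermitian_white_noise_def)
qed

text \<open>Sesquilinearity is used one argument at a time, here in the second and in
  \<open>simple_inner\<close> in the first. Sets within a list may overlap, since the covariance
  rule holds for arbitrary pairs.\<close>

lemma simple_isometry_aux:
  assumes A: "A \<in> finite_borel" and ys: "elementary ys"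
  shows "(\<integral>w. W A w * cnj (SI ys w) \<partial>M) =
    (LBINT l. indicator A l * cnj (simple_fun ys l))"
  using ys
proof (induction ys)
  case (Cons p ys)
  obtain c B where p: "p = (c, B)" by (cases p)
  have B: "B \<in> finite_borel" and ys: "elementary ys" using Cons.prems p by auto
  note i = sq_integrable_mult_cnj[OF sq_integrable_W[OF A] sq_integrable_W[OF B]]
    sq_integrable_mult_cnj[OF sq_integrable_W[OF A] sq_integrable_simple_stoch_integral[OF ys]]
    sq_integrable_mult_cnj[OF sq_integrable_indicator[OF A] sq_integrable_indicator[OF B]]
    sq_integrable_mult_cnj[OF sq_integrable_indicator[OF A] sq_integrable_simple_fun[OF ys]]
  have "(\<integral>w. W A w * cnj (SI (p # ys) w) \<partial>M) =
      (\<integral>w. cnj c * (W A w * cnj (W B w)) + W A w * cnj (SI ys w) \<partial>M)"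
    by (simp add: p simple_stoch_integral_def algebra_simps)
  also have "\<dots> = cnj c * (\<integral>w. W A w * cnj (W B w) \<partial>M) + (\<integral>w. W A w * cnj (SI ys w) \<partial>M)"
    using i by (simp del: complex_cnj_mult)
  also have "\<dots> = cnj c * (LBINT l. indicator A l * cnj (indicator B l)) + (LBINT l. indicator A l * cnj (simple_fun ys l))"
    unfolding W_covariance[OF A B] Cons.IH[OF ys] ..
  also have "\<dots> = (LBINT l. (cnj c * (indicator A l * cnj (indicator B l)) + indicator A l * cnj (simple_fun ys l)))"
    unfolding Bochner_Integration.integral_add[OF integrable_mult_right[OF i(3)] i(4)] by simp
  also have "\<dots> = (LBINT l. indicator A l * cnj (simple_fun (p # ys) l))"
    by (simp add: p simple_fun_def algebra_simps)
  finally show ?case .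
qed (simp add: simple_stoch_integral_def simple_fun_def)

lemma simple_inner:
  assumes xs: "elementary xs" and ys: "elementary ys"
  shows "(\<integral>w. SI xs w * cnj (SI ys w) \<partial>M) =
    (LBINT l. simple_fun xs l * cnj (simple_fun ys l))"
  using xs
proof (induction xs)
  case (Cons p xs)
  obtain c B where p: "p = (c, B)" by (cases p)
  have B: "B \<in> finite_borel" and xs: "elementary xs" using Cons.prems p by auto
  note i = sq_integrable_mult_cnj[OF sq_integrable_W[OF B] sq_integrable_simple_stoch_integral[OF ys]]
    sq_integrable_mult_cnj[OF sq_integrable_simple_stoch_integral[OF xs] sq_integrable_simple_stoch_integral[OF ys]]
    sq_integrable_mult_cnj[OF sq_integrable_indicator[OF B] sq_integrable_simple_fun[OF ys]]
    sq_integrable_mult_cnj[OF sq_integrable_simple_fun[OF xs] sq_integrable_simple_fun[OF ys]]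
  let ?s = simple_fun
  have "(\<integral>w. SI (p # xs) w * cnj (SI ys w) \<partial>M) =
      (\<integral>w. c * (W B w * cnj (SI ys w)) + SI xs w * cnj (SI ys w) \<partial>M)"
    by (simp add: p simple_stoch_integral_def algebra_simps)
  also have "\<dots> = c * (\<integral>w. W B w * cnj (SI ys w) \<partial>M) + (\<integral>w. SI xs w * cnj (SI ys w) \<partial>M)"
    unfolding Bochner_Integration.integral_add[OF integrable_mult_right[OF i(1)] i(2)] by simp
  also have "\<dots> = c * (LBINT l. indicator B l * cnj (?s ys l)) + (LBINT l. ?s xs l * cnj (?s ys l))"
    unfolding simple_isometry_aux[OF B ys] Cons.IH[OF xs] ..
  also have "\<dots> = (LBINT l. (c * (indicator B l * cnj (?s ys l)) + ?s xs l * cnj (?s ys l)))"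
    unfolding Bochner_Integration.integral_add[OF integrable_mult_right[OF i(3)] i(4)] by simp
  also have "\<dots> = (LBINT l. ?s (p # xs) l * cnj (?s ys l))"
    by (simp add: p simple_fun_def algebra_simps)
  finally show ?case .
qed (simp add: simple_stoch_integral_def simple_fun_def)

lemma simple_isometry:
  assumes xs: "elementary xs"
  shows "(msq M (\<lambda>w. SI xs w)) = (msq lborel (\<lambda>l. simple_fun xs l))"
proof -
  have "complex_of_real (msq M (\<lambda>w. SI xs w)) =
      complex_of_real (msq lborel (\<lambda>l. simple_fun xs l))"
    using simple_inner[OF xs xs]
    unfolding complex_norm_square[symmetric] integral_complex_of_real .
  then show ?thesis by simp
qed

lemma simple_real_part:
  assumes "elementary xs"
  shows "\<exists>J c. finite J \<and> J \<subseteq> finite_borel \<times> UNIV \<and>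
    (\<forall>w. Re (SI xs w) = (\<Sum>i\<in>J. c i * part i w))"
  using assms
proof (induction xs)
  case Nil
  show ?case by (rule exI[of _ "{}"]) (simp add: simple_stoch_integral_def)
next
  case (Cons p xs)
  obtain a A where p: "p = (a, A)" by (cases p)
  have A: "A \<in> finite_borel" using Cons.prems p by auto
  obtain J c where J: "finite J" "J \<subseteq> finite_borel \<times> UNIV"
    and e: "\<And>w. Re (SI xs w) = (\<Sum>i\<in>J. c i * part i w)"
    using Cons by auto
  define K where "K = J \<union> {(A, True), (A, False)}"
  \<comment> \<open>The set \<open>A\<close> may already occur in the tail of the list, so
    coefficients are added rather than assigned. The signs are those of
    \<open>Re (a * W A)\<close>.\<close>
  define d where "d i = (if i \<in> J then c i else 0) + (if i = (A, True) then Re a else 0) +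
    (if i = (A, False) then - Im a else 0)" for i
  have K: "finite K" "K \<subseteq> finite_borel \<times> UNIV" using J A by (auto simp: K_def)
  have "Re (SI (p # xs) w) = (\<Sum>i\<in>K. d i * part i w)" for w
  proof -
    have "(\<Sum>i\<in>K. d i * part i w) = (\<Sum>i\<in>K. (if i \<in> J then c i * part i w else 0)) +
        (\<Sum>i\<in>K. (if i = (A, True) then Re a * part i w else 0)) + (\<Sum>i\<in>K. (if i = (A, False) then - Im a * part i w else 0))"
      unfolding sum.distrib[symmetric] by (intro sum.cong refl) (auto simp: d_def algebra_simps)
    also have "(\<Sum>i\<in>K. (if i \<in> J then c i * part i w else 0)) = (\<Sum>i\<in>J. c i * part i w)"
      using K J by (subst sum.inter_restrict[symmetric]) (auto simp: K_def Int_absorb1 intro!: sum.cong)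
    also have "(\<Sum>i\<in>K. (if i = (A, True) then Re a * part i w else 0)) = Re a * Re (W A w)"
      using K by (subst sum.delta) (auto simp: K_def)
    also have "(\<Sum>i\<in>K. (if i = (A, False) then - Im a * part i w else 0)) = - Im a * Im (W A w)"
      using K by (subst sum.delta) (auto simp: K_def)
    finally show ?thesis
      using e[of w] by (simp add: p simple_stoch_integral_def)
  qed
  then show ?case using K by blast
qed

lemma simple_real_part_gaussian:
  assumes "elementary xs"
  shows "gaussian_rv M (\<lambda>w. Re (SI xs w))"
    and "expectation (\<lambda>w. Re (SI xs w)) = 0"
proof -
  obtain J c where J: "finite J" "J \<subseteq> finite_borel \<times> UNIV"
    and e: "\<And>w. Re (SI xs w) = (\<Sum>i\<in>J. c i * part i w)"
    using simple_real_part[OF assms] by blast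
  show "gaussian_rv M (\<lambda>w. Re (SI xs w))"
    unfolding e by (rule part_gaussian[OF J])
  have p: "integrable M (part i)" "expectation (part i) = 0" if "i \<in> J" for i
    using part_mean J(2) that by blast+
  have "expectation (\<lambda>w. \<Sum>i\<in>J. c i * part i w) = (\<Sum>i\<in>J. c i * expectation (part i))"
    using p(1) by (subst Bochner_Integration.integral_sum) auto
  also have "\<dots> = 0" using p(2) by simp
  finally show "expectation (\<lambda>w. Re (SI xs w)) = 0"
    unfolding e .
qed

lemma has_stoch_integralD:
  assumes "has_stoch_integral M W g X"
  shows "sq_integrable lborel g" "sq_integrable M X"
  using assms by (auto simp: has_stoch_integral_def sq_integrable_def)

lemma has_stoch_integralE:
  assumes "has_stoch_integral M W g X"
  obtains xs where "\<And>n. elementary (xs n)"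
    "(\<lambda>n. msq lborel (\<lambda>l. g l - simple_fun (xs n) l)) \<longlonglongrightarrow> 0"
    "(\<lambda>n. \<integral>w. (cmod (X w - SI (xs n) w))\<^sup>2 \<partial>M) \<longlonglongrightarrow> 0"
  using assms unfolding has_stoch_integral_def by blast

lemma has_stoch_integralI:
  assumes "sq_integrable lborel g" "sq_integrable M X" "\<And>n. elementary (xs n)"
    "(\<lambda>n. msq lborel (\<lambda>l. g l - simple_fun (xs n) l)) \<longlonglongrightarrow> 0"
    "(\<lambda>n. \<integral>w. (cmod (X w - SI (xs n) w))\<^sup>2 \<partial>M) \<longlonglongrightarrow> 0"
  shows "has_stoch_integral M W g X"
  using assms unfolding has_stoch_integral_def sq_integrable_def by auto

text \<open>By \<open>simple_isometry\<close>, both sides are limits of the same sequence of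
  numbers.\<close>

lemma stoch_integral_isometry:
  assumes "has_stoch_integral M W g X"
  shows "(msq M (\<lambda>w. X w)) = (msq lborel (\<lambda>l. g l))"
proof -
  obtain xs where xs: "\<And>n. elementary (xs n)"
    and l: "(\<lambda>n. msq lborel (\<lambda>l. g l - simple_fun (xs n) l)) \<longlonglongrightarrow> 0"
      "(\<lambda>n. \<integral>w. (cmod (X w - SI (xs n) w))\<^sup>2 \<partial>M) \<longlonglongrightarrow> 0"
    by (rule has_stoch_integralE[OF assms]) blast
  note d = has_stoch_integralD[OF assms]
  show ?thesis
    using sq_integrable_norm_tendsto[OF d(2) sq_integrable_simple_stoch_integral[OF xs] l(2)]
      sq_integrable_norm_tendsto[OF d(1) sq_integrable_simple_fun[OF xs] l(1)]
    unfolding simple_isometry[OF xs] by (rule LIMSEQ_unique)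
qed

lemma square_norm_lim_add:
  assumes "\<And>n. sq_integrable N (f n)" "\<And>n. sq_integrable N (g n)"
    "(\<lambda>n. \<integral>x. (cmod (f n x))\<^sup>2 \<partial>N) \<longlonglongrightarrow> 0" "(\<lambda>n. \<integral>x. (cmod (g n x))\<^sup>2 \<partial>N) \<longlonglongrightarrow> 0"
  shows "(\<lambda>n. \<integral>x. (cmod (f n x + g n x))\<^sup>2 \<partial>N) \<longlonglongrightarrow> 0"
proof (rule tendsto_sandwich[OF _ _ tendsto_const])
  show "(\<lambda>n. 2 * (msq N (\<lambda>x. f n x)) + 2 * (msq N (\<lambda>x. g n x))) \<longlonglongrightarrow> 0"
    using tendsto_add[OF tendsto_mult_right_zero[OF assms(3), of 2] tendsto_mult_right_zero[OF assms(4), of 2]] by simp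
  have "(msq N (\<lambda>x. f n x + g n x)) \<le> 2 * (msq N (\<lambda>x. f n x)) + 2 * (msq N (\<lambda>x. g n x))" for n
  proof -
    have "(msq N (\<lambda>x. f n x + g n x)) \<le> (\<integral>x. 2 * (cmod (f n x))\<^sup>2 + 2 * (cmod (g n x))\<^sup>2 \<partial>N)"
      using sq_integrableD(2)[OF sq_integrable_add[OF assms(1,2)]] sq_integrableD(2)[OF assms(1)] sq_integrableD(2)[OF assms(2)]
      by (intro integral_mono cmod_add_square_le) auto
    then show ?thesis
      using sq_integrableD(2)[OF assms(1)] sq_integrableD(2)[OF assms(2)] by simp
  qed
  then show "\<forall>\<^sub>F n in sequentially. (msq N (\<lambda>x. f n x + g n x)) \<le> 2 * (msq N (\<lambda>x. f n x)) + 2 * (msq N (\<lambda>x. g n x))"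
    by simp
qed simp

lemma simple_append:
  "simple_fun (xs @ ys) l = simple_fun xs l + simple_fun ys l"
  "SI (xs @ ys) w = SI xs w + SI ys w"
  by (simp_all add: simple_fun_def simple_stoch_integral_def)

lemma simple_scale:
  "simple_fun (map (\<lambda>(a, A). (c * a, A)) xs) l = c * simple_fun xs l"
  "SI (map (\<lambda>(a, A). (c * a, A)) xs) w = c * SI xs w"
  by (induction xs) (auto simp: simple_fun_def simple_stoch_integral_def algebra_simps)

lemma has_stoch_integral_add:
  assumes "has_stoch_integral M W g X" "has_stoch_integral M W h Y"
  shows "has_stoch_integral M W (\<lambda>l. g l + h l) (\<lambda>w. X w + Y w)"
proof -
  obtain xs where xs: "\<And>n. elementary (xs n)"
    and lx: "(\<lambda>n. msq lborel (\<lambda>l. g l - simple_fun (xs n) l)) \<longlonglongrightarrow> 0"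
      "(\<lambda>n. \<integral>w. (cmod (X w - SI (xs n) w))\<^sup>2 \<partial>M) \<longlonglongrightarrow> 0"
    by (rule has_stoch_integralE[OF assms(1)]) blast
  obtain ys where ys: "\<And>n. elementary (ys n)"
    and ly: "(\<lambda>n. \<integral>l. (cmod (h l - simple_fun (ys n) l))\<^sup>2 \<partial>lborel) \<longlonglongrightarrow> 0"
      "(\<lambda>n. \<integral>w. (cmod (Y w - SI (ys n) w))\<^sup>2 \<partial>M) \<longlonglongrightarrow> 0"
    by (rule has_stoch_integralE[OF assms(2)]) blast
  note d = has_stoch_integralD[OF assms(1)] has_stoch_integralD[OF assms(2)]
  show ?thesis
  proof (rule has_stoch_integralI[where xs = "\<lambda>n. xs n @ ys n"])
    show "elementary (xs n @ ys n)" for n using xs[of n] ys[of n] by auto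
    show "(\<lambda>n. \<integral>l. (cmod (g l + h l - simple_fun (xs n @ ys n) l))\<^sup>2 \<partial>lborel) \<longlonglongrightarrow> 0"
      using square_norm_lim_add[OF sq_integrable_diff[OF d(1) sq_integrable_simple_fun[OF xs]]
          sq_integrable_diff[OF d(3) sq_integrable_simple_fun[OF ys]] lx(1) ly(1)]
      by (simp add: simple_append algebra_simps)
    show "(\<lambda>n. \<integral>w. (cmod (X w + Y w - SI (xs n @ ys n) w))\<^sup>2 \<partial>M) \<longlonglongrightarrow> 0"
      using square_norm_lim_add[OF sq_integrable_diff[OF d(2) sq_integrable_simple_stoch_integral[OF xs]]
          sq_integrable_diff[OF d(4) sq_integrable_simple_stoch_integral[OF ys]] lx(2) ly(2)]
      by (simp add: simple_append algebra_simps)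
  qed (intro sq_integrable_add d)+
qed

lemma has_stoch_integral_scale:
  assumes "has_stoch_integral M W g X"
  shows "has_stoch_integral M W (\<lambda>l. c * g l) (\<lambda>w. c * X w)"
proof -
  obtain xs where xs: "\<And>n. elementary (xs n)"
    and lx: "(\<lambda>n. msq lborel (\<lambda>l. g l - simple_fun (xs n) l)) \<longlonglongrightarrow> 0"
      "(\<lambda>n. \<integral>w. (cmod (X w - SI (xs n) w))\<^sup>2 \<partial>M) \<longlonglongrightarrow> 0"
    by (rule has_stoch_integralE[OF assms(1)]) blast
  note d = has_stoch_integralD[OF assms(1)]
  let ?ys = "\<lambda>n. map (\<lambda>(a, A). (c * a, A)) (xs n)"
  show ?thesis
  proof (rule has_stoch_integralI[where xs = ?ys])
    show "elementary (?ys n)" for n using xs[of n] by auto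
    show "(\<lambda>n. \<integral>l. (cmod (c * g l - simple_fun (?ys n) l))\<^sup>2 \<partial>lborel) \<longlonglongrightarrow> 0"
      using tendsto_mult_right_zero[OF lx(1), of "(cmod c)\<^sup>2"]
      by (simp add: simple_scale right_diff_distrib[symmetric] norm_mult power_mult_distrib)
    show "(\<lambda>n. \<integral>w. (cmod (c * X w - SI (?ys n) w))\<^sup>2 \<partial>M) \<longlonglongrightarrow> 0"
      using tendsto_mult_right_zero[OF lx(2), of "(cmod c)\<^sup>2"]
      by (simp add: simple_scale right_diff_distrib[symmetric] norm_mult power_mult_distrib)
  qed (intro sq_integrable_mult_left d)+
qed

lemma has_stoch_integral_0: "has_stoch_integral M W (\<lambda>l. 0) (\<lambda>w. 0)"
  by (rule has_stoch_integralI[where xs = "\<lambda>_. []"])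
    (auto simp: sq_integrable_0 simple_fun_def simple_stoch_integral_def)

lemma has_stoch_integral_sum:
  assumes "\<And>i. i \<in> J \<Longrightarrow> has_stoch_integral M W (g i) (X i)"
  shows "has_stoch_integral M W (\<lambda>l. \<Sum>i\<in>J. c i * g i l) (\<lambda>w. \<Sum>i\<in>J. c i * X i w)"
  using assms
proof (induction J rule: infinite_finite_induct)
  case (insert i J)
  have "has_stoch_integral M W (\<lambda>l. c i * g i l + (\<Sum>i\<in>J. c i * g i l)) (\<lambda>w. c i * X i w + (\<Sum>i\<in>J. c i * X i w))"
    by (rule has_stoch_integral_add[OF has_stoch_integral_scale]) (use insert in simp_all)
  then show ?case using insert by simp
qed (simp_all add: has_stoch_integral_0)

text \<open>The approximating simple integrals are complex, but since the limit is real, passing to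
  their real parts does not increase the mean-square distance. The real parts are Gaussian by
  assumption on the noise, and Gaussianity passes to the limit.\<close>

lemma real_stoch_integral_gaussian:
  assumes "has_stoch_integral M W g (\<lambda>w. of_real (X w))"
  shows "X \<in> borel_measurable M" "integrable M (\<lambda>w. (X w)\<^sup>2)" "gaussian_rv M X" "expectation X = 0"
    "expectation (\<lambda>w. (X w)\<^sup>2) = (msq lborel (\<lambda>l. g l))"
proof -
  obtain xs where xs: "\<And>n. elementary (xs n)"
    and "(\<lambda>n. msq lborel (\<lambda>l. g l - simple_fun (xs n) l)) \<longlonglongrightarrow> 0"
    and lx: "(\<lambda>n. \<integral>w. (cmod (X w - SI (xs n) w))\<^sup>2 \<partial>M) \<longlonglongrightarrow> 0"
    by (rule has_stoch_integralE[OF assms]) blast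
  note d = has_stoch_integralD(2)[OF assms]
  show m: "X \<in> borel_measurable M"
    using measurable_compose[OF sq_integrableD(1)[OF d] borel_measurable_Re]
    unfolding Re_complex_of_real .
  show i: "integrable M (\<lambda>w. (X w)\<^sup>2)" using sq_integrableD(2)[OF d] by simp
  show "expectation (\<lambda>w. (X w)\<^sup>2) = (msq lborel (\<lambda>l. g l))"
    using stoch_integral_isometry[OF assms] by simp
  have "(\<lambda>n. expectation (\<lambda>w. (X w - Re (SI (xs n) w))\<^sup>2)) \<longlonglongrightarrow> 0"
  proof (rule tendsto_sandwich[OF _ _ tendsto_const lx])
    have "expectation (\<lambda>w. (X w - Re (SI (xs n) w))\<^sup>2) \<le>
        (msq M (\<lambda>w. X w - SI (xs n) w))" for n
    proof (rule integral_mono')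
      show "integrable M (\<lambda>w. (cmod (X w - SI (xs n) w))\<^sup>2)"
        by (intro sq_integrableD sq_integrable_diff d sq_integrable_simple_stoch_integral xs)
      show "(X w - Re (SI (xs n) w))\<^sup>2 \<le> (cmod (X w - SI (xs n) w))\<^sup>2" for w
        by (simp add: cmod_power2)
    qed simp
    then show "\<forall>\<^sub>F n in sequentially. expectation (\<lambda>w. (X w - Re (SI (xs n) w))\<^sup>2) \<le>
        (msq M (\<lambda>w. X w - SI (xs n) w))" by simp
  qed simp
  note lim = gaussian_rv_limit[OF simple_real_part_gaussian[OF xs] m i this]
  show "gaussian_rv M X" by (rule lim(1))
  show "expectation X = 0" by (rule lim(2))
qed

end

section \<open>Density of simple functions and existence of stochastic integrals\<close>

lemma integral_lborel_uminus:
  fixes f :: "real \<Rightarrow> 'a::{banach, second_countable_topology}"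
  shows "(LBINT l. f (- l)) = (LBINT l. f l)"
  using lborel_integral_real_affine[of "-1" f 0] by simp

lemma integrable_lborel_uminus_iff:
  fixes f :: "real \<Rightarrow> 'a::{banach, second_countable_topology}"
  shows "integrable lborel (\<lambda>l. f (- l)) \<longleftrightarrow> integrable lborel f"
  using lborel_integrable_real_affine_iff[of "-1" f 0] by simp

lemma sq_integrable_uminus:
  fixes f :: "real \<Rightarrow> complex"
  assumes "sq_integrable lborel f"
  shows "sq_integrable lborel (\<lambda>l. f (- l))"
  using assms integrable_lborel_uminus_iff[of "\<lambda>l. (cmod (f l))\<^sup>2"]
  by (auto simp: sq_integrable_def)

lemma finite_borel_uminus:
  assumes "A \<in> finite_borel"
  shows "uminus ` A \<in> finite_borel"
proof -
  have e: "uminus ` A = uminus -` A \<inter> space borel" by (auto simp: image_iff) (metis minus_minus)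
  have A: "A \<in> sets borel" using assms by (simp add: finite_borel_def)
  have m: "uminus -` A \<inter> space borel \<in> sets (borel :: real measure)"
    by (rule measurable_sets[OF _ A]) measurable
  have "emeasure lborel A = emeasure (distr lborel borel uminus) A"
    by (simp add: lborel_distr_uminus)
  also have "\<dots> = emeasure lborel (uminus -` A \<inter> space borel)"
    using A by (subst emeasure_distr) auto
  finally show ?thesis
    using assms m unfolding e finite_borel_def by simp
qed

lemma simple_function_as_list:
  fixes F :: "real \<Rightarrow> complex"
  assumes F: "simple_function lborel F" "sq_integrable lborel F"
  shows "\<exists>xs. (\<forall>(c, A)\<in>set xs. A \<in> finite_borel) \<and> simple_fun xs = F"
proof -
  \<comment> \<open>The value 0 is left out: its level set may have infinite measure and contributes
    nothing to the sum.\<close>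
  have fin: "finite (range F - {0})"
    using simple_functionD(1)[OF F(1)] by simp
  then obtain ys where ys: "set ys = range F - {0}" "distinct ys"
    using finite_distinct_list by blast
  have "F -` {y} \<in> finite_borel" if "y \<noteq> 0" for y
  proof -
    have S: "F -` {y} \<in> sets borel"
      using simple_functionD(2)[OF F(1), of "{y}"] by simp
    \<comment> \<open>Chebyshev: this function dominates the indicator of the level set of a nonzero
      value \<open>y\<close>.\<close>
    have "integrable lborel (\<lambda>x. (cmod (F x))\<^sup>2 / (cmod y)\<^sup>2)"
      using F(2) by (simp add: sq_integrable_def)
    then have "integrable lborel (indicator (F -` {y}) :: real \<Rightarrow> real)"
      by (rule Bochner_Integration.integrable_bound) (use S that in \<open>auto simp: indicator_def\<close>)
    then show ?thesis
      using S by (simp add: integrable_indicator_iff finite_borel_def)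
  qed
  moreover have "simple_fun (map (\<lambda>y. (y, F -` {y})) ys) l = F l" for l
  proof -
    have "simple_fun (map (\<lambda>y. (y, F -` {y})) ys) l = (\<Sum>y\<in>set ys. y * indicator (F -` {y}) l)"
      using ys(2) by (simp add: simple_fun_def o_def sum_list_distinct_conv_sum_set)
    also have "\<dots> = (\<Sum>y\<in>range F - {0}. if y = F l then y else 0)"
      unfolding ys(1) by (intro sum.cong) (auto simp: indicator_def)
    also have "\<dots> = F l" using fin by (auto simp: sum.delta)
    finally show ?thesis .
  qed
  ultimately show ?thesis
    using ys(1) by (intro exI[of _ "map (\<lambda>y. (y, F -` {y})) ys"]) auto
qed

lemma simple_fun_dense:
  assumes g: "sq_integrable lborel g" and e: "0 < e"
  shows "\<exists>xs. (\<forall>(c, A)\<in>set xs. A \<in> finite_borel) \<and> (msq lborel (\<lambda>l. g l - simple_fun xs l)) < e"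
proof -
  have gm [measurable]: "g \<in> borel_measurable lborel" using sq_integrableD(1)[OF g] .
  \<comment> \<open>The pointwise bound by \<open>2 * cmod (g x)\<close> yields the majorant
    \<open>(3 * cmod (g l))\<^sup>2\<close> for the squared error.\<close>
  obtain F where F: "\<And>i. simple_function lborel (F i)" "\<And>x. (\<lambda>i. F i x) \<longlonglongrightarrow> g x"
    "\<And>i x. dist (F i x) 0 \<le> 2 * dist (g x) 0"
    using borel_measurable_implies_sequence_metric[OF gm, of 0] by (force simp del: dist_0_norm)
  have Fm [measurable]: "F i \<in> borel_measurable lborel" for i
    by (rule borel_measurable_simple_function[OF F(1)])
  have Fb: "cmod (F i x) \<le> 2 * cmod (g x)" for i x using F(3)[of i x] by simp
  have Fs: "sq_integrable lborel (F i)" for i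
  proof -
    have "integrable lborel (\<lambda>x. (2 * cmod (g x))\<^sup>2)"
      using g by (simp add: sq_integrable_def power_mult_distrib)
    then have "integrable lborel (\<lambda>x. (cmod (F i x))\<^sup>2)"
      by (rule Bochner_Integration.integrable_bound) (use power_mono[OF Fb[of i], of _ 2] in simp_all)
    then show ?thesis by (simp add: sq_integrable_def)
  qed
  have "(\<lambda>i. \<integral>l. (cmod (g l - F i l))\<^sup>2 \<partial>lborel) \<longlonglongrightarrow> (\<integral>l. 0 \<partial>(lborel :: real measure))"
  proof (rule integral_dominated_convergence[where w = "\<lambda>l. (3 * cmod (g l))\<^sup>2"])
    show "integrable lborel (\<lambda>l. (3 * cmod (g l))\<^sup>2)"
      using g by (simp add: sq_integrable_def power_mult_distrib)
    have "(\<lambda>i. (cmod (g l - F i l))\<^sup>2) \<longlonglongrightarrow> (cmod (g l - g l))\<^sup>2" for l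
      by (intro tendsto_intros F)
    then show "AE l in lborel. (\<lambda>i. (cmod (g l - F i l))\<^sup>2) \<longlonglongrightarrow> 0" by simp
    show "AE l in lborel. norm ((cmod (g l - F i l))\<^sup>2) \<le> (3 * cmod (g l))\<^sup>2" for i
    proof (rule AE_I2)
      fix l
      have "cmod (g l - F i l) \<le> cmod (g l) + cmod (F i l)" by (rule norm_triangle_ineq4)
      also have "\<dots> \<le> 3 * cmod (g l)" using Fb[of i l] by simp
      finally show "norm ((cmod (g l - F i l))\<^sup>2) \<le> (3 * cmod (g l))\<^sup>2"
        using power_mono[of "cmod (g l - F i l)" "3 * cmod (g l)" 2] by simp
    qed
  qed measurable
  then have "\<forall>\<^sub>F i in sequentially. (msq lborel (\<lambda>l. g l - F i l)) < e"
    using e by (intro order_tendstoD(2)) auto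
  then obtain i where i: "(msq lborel (\<lambda>l. g l - F i l)) < e"
    by (auto simp: eventually_sequentially)
  obtain xs where "\<forall>(c, A)\<in>set xs. A \<in> finite_borel" "simple_fun xs = F i"
    using simple_function_as_list[OF F(1) Fs] by metis
  then show ?thesis using i by metis
qed

context prob_space
begin

text \<open>Riesz-Fischer argument: the geometric rate makes the increments summable in mean, so the
  sequence converges almost surely, and Fatou's lemma carries the mean-square bound over to the
  limit.\<close>

lemma sq_integrable_limit:
  assumes S: "\<And>n. sq_integrable M (S n)"
    and d: "\<And>m n. n \<le> m \<Longrightarrow> (msq M (\<lambda>w. S m w - S n w)) \<le> 4 * (1 / 4) ^ n"
  shows "\<exists>X. sq_integrable M X \<and> (\<lambda>n. \<integral>w. (cmod (X w - S n w))\<^sup>2 \<partial>M) \<longlonglongrightarrow> 0"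
proof -
  note [measurable] = sq_integrableD(1)[OF S]
  define D where "D n w = S (Suc n) w - S n w" for n w
  have [measurable]: "D n \<in> borel_measurable M" for n unfolding D_def by measurable
  have Ds: "sq_integrable M (D n)" for n
    unfolding D_def by (intro sq_integrable_diff S)
  have D1: "integrable M (\<lambda>w. cmod (D n w))" "expectation (\<lambda>w. cmod (D n w)) \<le> 2 * (1 / 2) ^ n" for n
  proof -
    note e = expectation_abs_le_sqrt[of "\<lambda>w. cmod (D n w)", OF _ sq_integrableD(2)[OF Ds]]
    show "integrable M (\<lambda>w. cmod (D n w))" by (rule e) measurable
    have "expectation (\<lambda>w. cmod (D n w)) \<le> sqrt (msq M (\<lambda>w. D n w))"
      using e(2) by simp
    also have "\<dots> \<le> sqrt (4 * (1 / 4) ^ n)"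
      using d[of n "Suc n"] by (intro real_sqrt_le_mono) (simp add: D_def)
    also have "\<dots> = 2 * (1 / 2) ^ n"
      by (simp add: real_sqrt_mult real_sqrt_power real_sqrt_divide)
    finally show "expectation (\<lambda>w. cmod (D n w)) \<le> 2 * (1 / 2) ^ n" .
  qed
  have "(\<integral>\<^sup>+w. (\<Sum>n. ennreal (cmod (D n w))) \<partial>M) = (\<Sum>n. \<integral>\<^sup>+w. ennreal (cmod (D n w)) \<partial>M)"
    by (rule nn_integral_suminf) measurable
  also have "\<dots> = (\<Sum>n. ennreal (expectation (\<lambda>w. cmod (D n w))))"
    using D1(1) by (intro suminf_cong nn_integral_eq_integral) auto
  also have "\<dots> \<le> (\<Sum>n. ennreal (2 * (1 / 2) ^ n))"
    using D1(2) by (intro suminf_le ennreal_leI) auto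
  also have "\<dots> = ennreal (\<Sum>n. 2 * (1 / 2) ^ n)"
    by (intro suminf_ennreal2 summable_mult summable_geometric) auto
  also have "\<dots> < \<infinity>" by simp
  finally have "AE w in M. (\<Sum>n. ennreal (cmod (D n w))) \<noteq> \<infinity>"
    by (intro nn_integral_noteq_infinite) (auto simp: less_top)
  then have conv: "AE w in M. convergent (\<lambda>n. S n w)"
  proof eventually_elim
    case (elim w)
    then have "summable (\<lambda>n. cmod (D n w))"
      by (intro summable_suminf_not_top) auto
    then have "summable (\<lambda>n. D n w)" by (rule summable_norm_cancel)
    then have "convergent (\<lambda>n. S 0 w + (\<Sum>k<n. D k w))"
      by (intro convergent_add convergent_const) (simp add: summable_iff_convergent)
    moreover have "S 0 w + (\<Sum>k<n. D k w) = S n w" for n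
      by (induction n) (auto simp: D_def add.assoc[symmetric])
    ultimately show ?case by simp
  qed
  \<comment> \<open>On the null set of divergence this is an unspecified value; the function is
    measurable all the same.\<close>
  define X where "X w = lim (\<lambda>n. S n w)" for w
  have [measurable]: "X \<in> borel_measurable M"
    unfolding X_def by (rule borel_measurable_lim_metric) measurable
  have bound: "(\<integral>\<^sup>+w. ennreal ((cmod (X w - S n w))\<^sup>2) \<partial>M) \<le> ennreal (4 * (1 / 4) ^ n)" for n
  proof -
    have "(\<integral>\<^sup>+w. ennreal ((cmod (X w - S n w))\<^sup>2) \<partial>M) =
        (\<integral>\<^sup>+w. liminf (\<lambda>m. ennreal ((cmod (S m w - S n w))\<^sup>2)) \<partial>M)"
    proof (rule nn_integral_cong_AE)
      show "AE w in M. ennreal ((cmod (X w - S n w))\<^sup>2) = liminf (\<lambda>m. ennreal ((cmod (S m w - S n w))\<^sup>2))"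
        using conv
      proof eventually_elim
        case (elim w)
        then have "(\<lambda>m. S m w) \<longlonglongrightarrow> X w" by (simp add: X_def convergent_LIMSEQ_iff)
        then have "(\<lambda>m. ennreal ((cmod (S m w - S n w))\<^sup>2)) \<longlonglongrightarrow> ennreal ((cmod (X w - S n w))\<^sup>2)"
          by (intro tendsto_intros)
        then show ?case by (intro lim_imp_Liminf[symmetric]) auto
      qed
    qed
    also have "\<dots> \<le> liminf (\<lambda>m. \<integral>\<^sup>+w. ennreal ((cmod (S m w - S n w))\<^sup>2) \<partial>M)"
      by (rule nn_integral_liminf) measurable
    also have "\<dots> \<le> liminf (\<lambda>m. ennreal (4 * (1 / 4) ^ n))"
    proof (rule Liminf_mono)
      show "\<forall>\<^sub>F m in sequentially. (\<integral>\<^sup>+w. ennreal ((cmod (S m w - S n w))\<^sup>2) \<partial>M) \<le> ennreal (4 * (1 / 4) ^ n)"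
        using eventually_ge_at_top[of n]
      proof eventually_elim
        case (elim m)
        have "(\<integral>\<^sup>+w. ennreal ((cmod (S m w - S n w))\<^sup>2) \<partial>M) = ennreal (msq M (\<lambda>w. S m w - S n w))"
          using sq_integrableD(2)[OF sq_integrable_diff[OF S S]] by (intro nn_integral_eq_integral) auto
        then show ?case using d[OF elim] by (simp add: ennreal_leI)
      qed
    qed
    also have "\<dots> = ennreal (4 * (1 / 4) ^ n)" by (simp add: Liminf_const)
    finally show ?thesis .
  qed
  have Xd: "sq_integrable M (\<lambda>w. X w - S n w)" for n
    unfolding sq_integrable_def
    using order_le_less_trans[OF bound[of n] ennreal_less_top]
    by (auto intro!: integrableI_bounded)
  have "sq_integrable M X"
    using sq_integrable_add[OF Xd[of 0] S[of 0]] by simp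
  moreover have "(\<lambda>n. \<integral>w. (cmod (X w - S n w))\<^sup>2 \<partial>M) \<longlonglongrightarrow> 0"
  proof (rule tendsto_sandwich[OF _ _ tendsto_const])
    have "(msq M (\<lambda>w. X w - S n w)) \<le> 4 * (1 / 4) ^ n" for n
    proof -
      have "ennreal (msq M (\<lambda>w. X w - S n w)) = (\<integral>\<^sup>+w. ennreal ((cmod (X w - S n w))\<^sup>2) \<partial>M)"
        using sq_integrableD(2)[OF Xd] by (intro nn_integral_eq_integral[symmetric]) auto
      also note bound[of n]
      finally show ?thesis by (subst (asm) ennreal_le_iff) auto
    qed
    then show "\<forall>\<^sub>F n in sequentially. (msq M (\<lambda>w. X w - S n w)) \<le> 4 * (1 / 4) ^ n" by simp
    show "(\<lambda>n. 4 * (1 / 4 :: real) ^ n) \<longlonglongrightarrow> 0"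
      by (intro tendsto_mult_right_zero LIMSEQ_realpow_zero) auto
  qed simp
  ultimately show ?thesis by blast
qed

end

context white_noise
begin

text \<open>The isometry turns simple approximants of \<open>g\<close> into a Cauchy sequence of
  simple integrals. Errors below \<open>(1 / 4) ^ n\<close> give, by the factor 2 in
  \<open>cmod_add_square_le\<close>, the rate \<open>4 * (1 / 4) ^ n\<close> required by
  \<open>sq_integrable_limit\<close>.\<close>

lemma stoch_integral_exists:
  assumes g: "sq_integrable lborel g"
  shows "\<exists>X. has_stoch_integral M W g X"
proof -
  have "\<exists>xs. elementary xs \<and> (msq lborel (\<lambda>l. g l - simple_fun xs l)) < (1 / 4) ^ n" for n
    by (rule simple_fun_dense[OF g]) simp
  then obtain xs where xs: "\<And>n. elementary (xs n)"
    and a: "\<And>n. (msq lborel (\<lambda>l. g l - simple_fun (xs n) l)) < (1 / 4) ^ n"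
    by metis
  let ?S = "\<lambda>n. SI (xs n)"
  note s = sq_integrable_simple_fun[OF xs]
  have "(msq M (\<lambda>w. ?S m w - ?S n w)) \<le> 4 * (1 / 4) ^ n" if "n \<le> m" for m n
  proof -
    \<comment> \<open>A list representing the difference of the two simple functions, so that the
      isometry for lists applies to it.\<close>
    let ?ys = "xs m @ map (\<lambda>(a, A). (- 1 * a, A)) (xs n)"
    have el: "elementary ?ys" using xs[of m] xs[of n] by auto
    have "SI ?ys w = ?S m w - ?S n w" "simple_fun ?ys l = simple_fun (xs m) l - simple_fun (xs n) l" for w l
      unfolding simple_append simple_scale by simp_all
    then have "(msq M (\<lambda>w. ?S m w - ?S n w)) = (msq lborel (\<lambda>l. simple_fun (xs m) l - simple_fun (xs n) l))"
      using simple_isometry[OF el] by simp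
    also have "\<dots> \<le> (LBINT l. (2 * (cmod (g l - simple_fun (xs n) l))\<^sup>2 + 2 * (cmod (g l - simple_fun (xs m) l))\<^sup>2))"
    proof (rule integral_mono)
      show "(cmod (simple_fun (xs m) l - simple_fun (xs n) l))\<^sup>2 \<le> 2 * (cmod (g l - simple_fun (xs n) l))\<^sup>2 + 2 * (cmod (g l - simple_fun (xs m) l))\<^sup>2" for l
        using cmod_add_square_le[of "g l - simple_fun (xs n) l" "- (g l - simple_fun (xs m) l)"]
        by (simp add: norm_minus_commute)
    qed (use sq_integrableD(2)[OF sq_integrable_diff[OF g s]] sq_integrableD(2)[OF sq_integrable_diff[OF s s]] in auto)
    also have "\<dots> = 2 * (msq lborel (\<lambda>l. g l - simple_fun (xs n) l)) + 2 * (msq lborel (\<lambda>l. g l - simple_fun (xs m) l))"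
      using sq_integrableD(2)[OF sq_integrable_diff[OF g s]] by simp
    also have "\<dots> \<le> 2 * (1 / 4) ^ n + 2 * (1 / 4) ^ m"
      using a[of n] a[of m] by simp
    also have "(1 / 4 :: real) ^ m \<le> (1 / 4) ^ n" using that by (intro power_decreasing) auto
    finally show ?thesis by simp
  qed
  then obtain X where X: "sq_integrable M X" "(\<lambda>n. \<integral>w. (cmod (X w - ?S n w))\<^sup>2 \<partial>M) \<longlonglongrightarrow> 0"
    using sq_integrable_limit[of ?S] sq_integrable_simple_stoch_integral[OF xs] by blast
  have "(\<lambda>n. msq lborel (\<lambda>l. g l - simple_fun (xs n) l)) \<longlonglongrightarrow> 0"
  proof (rule tendsto_sandwich[OF _ _ tendsto_const])
    show "(\<lambda>n. (1 / 4 :: real) ^ n) \<longlonglongrightarrow> 0" by (intro LIMSEQ_realpow_zero) auto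
  qed (use a in \<open>auto intro: less_imp_le always_eventually\<close>)
  then show ?thesis by (intro exI[of _ X] has_stoch_integralI[OF g X(1) xs _ X(2)])
qed

section \<open>Hermitian kernels and real-valued integrals\<close>

lemma W_uminus: "A \<in> finite_borel \<Longrightarrow> AE w in M. W (uminus ` A) w = cnj (W A w)"
  using hermitian by (simp add: hermitian_white_noise_def)

text \<open>Conjugating the coefficients and reflecting the sets conjugates the integral. A list has
  finitely many entries, so the exceptional sets of the Hermitian symmetry add up to a null
  set.\<close>

lemma simple_reflect:
  assumes "elementary xs"
  defines "ys \<equiv> map (\<lambda>(c, A). (cnj c, uminus ` A)) xs"
  shows "elementary ys" "simple_fun ys l = cnj (simple_fun xs (- l))"
    "AE w in M. SI ys w = cnj (SI xs w)"
proof -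
  have i: "indicator (uminus ` A) l = (indicator A (- l) :: complex)" for A :: "real set" and l
    by (auto simp: indicator_def image_iff) (metis minus_minus)
  have "elementary ys \<and> (\<forall>l. simple_fun ys l = cnj (simple_fun xs (- l))) \<and>
    (AE w in M. SI ys w = cnj (SI xs w))"
    using assms(1) unfolding ys_def
  proof (induction xs)
    case (Cons p xs)
    obtain c A where p: "p = (c, A)" by (cases p)
    have A: "A \<in> finite_borel" using Cons.prems p by auto
    have IH: "elementary (map (\<lambda>(c, A). (cnj c, uminus ` A)) xs)"
      "\<And>l. simple_fun (map (\<lambda>(c, A). (cnj c, uminus ` A)) xs) l = cnj (simple_fun xs (- l))"
      "AE w in M. SI (map (\<lambda>(c, A). (cnj c, uminus ` A)) xs) w = cnj (SI xs w)"
      using Cons by auto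
    have "AE w in M. SI (map (\<lambda>(c, A). (cnj c, uminus ` A)) (p # xs)) w = cnj (SI (p # xs) w)"
      using IH(3) W_uminus[OF A] by eventually_elim (simp add: p simple_stoch_integral_def)
    moreover have "simple_fun (map (\<lambda>(c, A). (cnj c, uminus ` A)) (p # xs)) l = cnj (simple_fun (p # xs) (- l))" for l
      using IH(2)[of l] by (simp add: p simple_fun_def i) (simp add: indicator_def)
    ultimately show ?case using IH(1) A by (simp add: p finite_borel_uminus)
  qed (simp add: simple_fun_def simple_stoch_integral_def)
  then show "elementary ys" "simple_fun ys l = cnj (simple_fun xs (- l))"
    "AE w in M. SI ys w = cnj (SI xs w)" by blast+
qed

lemma has_stoch_integral_reflect:
  assumes X: "has_stoch_integral M W g X"
  shows "has_stoch_integral M W (\<lambda>l. cnj (g (- l))) (\<lambda>w. cnj (X w))"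
proof -
  obtain xs where xs: "\<And>n. elementary (xs n)"
    and lx: "(\<lambda>n. msq lborel (\<lambda>l. g l - simple_fun (xs n) l)) \<longlonglongrightarrow> 0"
      "(\<lambda>n. \<integral>w. (cmod (X w - SI (xs n) w))\<^sup>2 \<partial>M) \<longlonglongrightarrow> 0"
    by (rule has_stoch_integralE[OF X]) blast
  let ?ys = "\<lambda>n. map (\<lambda>(c, A). (cnj c, uminus ` A)) (xs n)"
  note R = simple_reflect[OF xs]
  note d = has_stoch_integralD[OF X]
  have c: "cmod (cnj a - cnj b) = cmod (a - b)" for a b
    unfolding complex_cnj_diff[symmetric] by (rule complex_mod_cnj)
  show ?thesis
  proof (rule has_stoch_integralI[where xs = ?ys])
    show "sq_integrable lborel (\<lambda>l. cnj (g (- l)))"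
      using sq_integrable_uminus[OF d(1)] by (auto simp: sq_integrable_def)
    show Xc: "sq_integrable M (\<lambda>w. cnj (X w))"
      using d(2) by (auto simp: sq_integrable_def)
    show "elementary (?ys n)" for n by (rule R(1))
    show "(\<lambda>n. \<integral>l. (cmod (cnj (g (- l)) - simple_fun (?ys n) l))\<^sup>2 \<partial>lborel) \<longlonglongrightarrow> 0"
      unfolding R(2) c integral_lborel_uminus[of "\<lambda>l. (cmod (g l - simple_fun (xs _) l))\<^sup>2"] by (rule lx)
    have "(msq M (\<lambda>w. cnj (X w) - SI (?ys n) w)) =
        (msq M (\<lambda>w. X w - SI (xs n) w))" for n
    proof (rule integral_cong_AE)
      show "AE w in M. (cmod (cnj (X w) - SI (?ys n) w))\<^sup>2 =
          (cmod (X w - SI (xs n) w))\<^sup>2"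
        using R(3)[of n] by eventually_elim (simp only: c)
    qed (intro borel_measurable_integrable sq_integrableD(2) sq_integrable_diff Xc d(2)
        sq_integrable_simple_stoch_integral xs R(1))+
    then show "(\<lambda>n. \<integral>w. (cmod (cnj (X w) - SI (?ys n) w))\<^sup>2 \<partial>M) \<longlonglongrightarrow> 0"
      using lx(2) by simp
  qed
qed

text \<open>For a Hermitian kernel both \<open>X\<close> and its conjugate are integrals of
  \<open>g\<close>, hence so is their mean, the real part of \<open>X\<close>.\<close>

lemma real_stoch_integral_exists:
  assumes g: "sq_integrable lborel g" and herm: "\<And>l. g (- l) = cnj (g l)"
  shows "\<exists>X. has_stoch_integral M W g (\<lambda>w. of_real (X w))"
proof -
  obtain X where X: "has_stoch_integral M W g X" using stoch_integral_exists[OF g] by blast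
  have "1 / 2 * (g l + cnj (g (- l))) = g l" for l
    by (simp add: herm)
  moreover have "1 / 2 * (X w + cnj (X w)) = complex_of_real (Re (X w))" for w
    by (simp add: complex_eq_iff)
  ultimately have "has_stoch_integral M W g (\<lambda>w. of_real (Re (X w)))"
    using has_stoch_integral_scale[OF has_stoch_integral_add[OF X has_stoch_integral_reflect[OF X]], of "1 / 2"]
    by (simp only:)
  then show ?thesis by (intro exI[of _ "\<lambda>w. Re (X w)"])
qed

end

section \<open>Weak convergence from trigonometric test functions\<close>

text \<open>The phase \<open>b\<close> covers sines, leaving a single kind of generator. The class
  is an algebra by the product-to-sum formula, and the expectation of a generator at a Gaussian
  vector is explicit.\<close>

inductive trig_poly :: "('a::euclidean_space \<Rightarrow> real) \<Rightarrow> bool" where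
  trig_poly_cos: "trig_poly (\<lambda>x. a * cos (s \<bullet> x + b))"
| trig_poly_add: "trig_poly f \<Longrightarrow> trig_poly g \<Longrightarrow> trig_poly (\<lambda>x. f x + g x)"

lemma trig_poly_const: "trig_poly (\<lambda>x. c)"
  using trig_poly_cos[of c 0 0] by simp

lemma trig_poly_mult:
  assumes "trig_poly f" "trig_poly g"
  shows "trig_poly (\<lambda>x. f x * g x)"
  using assms(1)
proof (induction rule: trig_poly.induct)
  case (trig_poly_cos a s b)
  show ?case using assms(2)
  proof (induction rule: trig_poly.induct)
    case (trig_poly_cos a' s' b')
    have "trig_poly (\<lambda>x. (a * a' / 2) * cos ((s - s') \<bullet> x + (b - b')) + (a * a' / 2) * cos ((s + s') \<bullet> x + (b + b')))"
      by (intro trig_poly.intros)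
    moreover have "(a * a' / 2) * cos ((s - s') \<bullet> x + (b - b')) + (a * a' / 2) * cos ((s + s') \<bullet> x + (b + b')) =
        a * cos (s \<bullet> x + b) * (a' * cos (s' \<bullet> x + b'))" for x
    proof -
      have e: "(s - s') \<bullet> x + (b - b') = (s \<bullet> x + b) - (s' \<bullet> x + b')"
        "(s + s') \<bullet> x + (b + b') = (s \<bullet> x + b) + (s' \<bullet> x + b')"
        by (simp_all add: inner_diff_left inner_add_left)
      show ?thesis unfolding e cos_add cos_diff by (simp add: field_simps)
    qed
    ultimately show ?case by simp
  next
    case (trig_poly_add f g)
    then show ?case using trig_poly.trig_poly_add by (simp add: distrib_left)
  qed
next
  case (trig_poly_add f g)
  then show ?case using trig_poly.trig_poly_add by (simp add: distrib_right)
qed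

lemma trig_poly_continuous: "trig_poly f \<Longrightarrow> continuous_on S f"
  by (induction rule: trig_poly.induct) (intro continuous_intros; assumption)+

lemma trig_poly_bounded: "trig_poly f \<Longrightarrow> \<exists>B. \<forall>x. \<bar>f x\<bar> \<le> B"
proof (induction rule: trig_poly.induct)
  case (trig_poly_cos a s b)
  have "\<bar>a * cos (s \<bullet> x + b)\<bar> \<le> \<bar>a\<bar>" for x
    using mult_left_mono[OF abs_cos_le_one[of "s \<bullet> x + b"], of "\<bar>a\<bar>"] by (simp add: abs_mult)
  then show ?case by blast
next
  case (trig_poly_add f g)
  then obtain B C where "\<And>x. \<bar>f x\<bar> \<le> B" "\<And>x. \<bar>g x\<bar> \<le> C" by blast
  then have "\<bar>f x + g x\<bar> \<le> B + C" for x
    using abs_triangle_ineq[of "f x" "g x"] by (smt (verit))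
  then show ?case by blast
qed

lemma trig_poly_compose_polynomial:
  fixes q :: "real \<Rightarrow> real"
  assumes "real_polynomial_function q" "trig_poly f"
  shows "trig_poly (\<lambda>x. q (f x))"
  using assms(1)
proof (induction rule: real_polynomial_function.induct)
  case (linear h)
  interpret bounded_linear h by (rule linear)
  have "h y = h 1 * y" for y
    using scaleR[of y 1] by (simp add: mult.commute)
  then have "(\<lambda>x. h (f x)) = (\<lambda>x. h 1 * f x)" by metis
  then show ?case using trig_poly_mult[OF trig_poly_const assms(2)] by simp
qed (auto intro: trig_poly_const trig_poly_add trig_poly_mult)

lemma trig_poly_function_ring:
  "compact S \<Longrightarrow> function_ring_on (Collect trig_poly) S"
proof
  fix x y :: 'a assume "x \<in> S" "y \<in> S" "x \<noteq> y"
  \<comment> \<open>Normalised so that \<open>s \<bullet> (x - y) = 1\<close>; the phase then gives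
    the values \<open>cos 1\<close> at \<open>x\<close> and \<open>cos 0\<close> at
    \<open>y\<close>.\<close>
  define s where "s = (x - y) /\<^sub>R (norm (x - y))\<^sup>2"
  have "s \<bullet> x + - (s \<bullet> y) = s \<bullet> (x - y)" by (simp add: inner_diff_right)
  also have "\<dots> = 1" using \<open>x \<noteq> y\<close> by (simp add: s_def power2_norm_eq_inner)
  finally have "1 * cos (s \<bullet> x + - (s \<bullet> y)) = cos 1" by simp
  moreover have "1 * cos (s \<bullet> y + - (s \<bullet> y)) = cos 0" by simp
  moreover have "cos 1 < cos (0 :: real)" using pi_gt3 by (intro cos_monotone_0_pi) auto
  ultimately show "\<exists>f\<in>Collect trig_poly. f x \<noteq> f y"
    using trig_poly_cos[of 1 s "- (s \<bullet> y)"] by (intro bexI[of _ "\<lambda>x. 1 * cos (s \<bullet> x + - (s \<bullet> y))"]) auto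
qed (auto intro: trig_poly_continuous trig_poly_add trig_poly_mult trig_poly_const)

text \<open>
  An approximation on a ball is composed with a polynomial close to the truncation at \<open>\<plusminus>B\<close>, which keeps
  it bounded off the ball independently of the radius.
\<close>

lemma trig_poly_approx:
  fixes g :: "'a::euclidean_space \<Rightarrow> real"
  assumes g: "continuous_on UNIV g" "\<And>x. \<bar>g x\<bar> \<le> B" and d: "0 < d" and L: "0 < L"
  shows "\<exists>Q. trig_poly Q \<and> (\<forall>x. \<bar>g x - Q x\<bar> \<le> 2 * d + (2 * B + d) * ((norm x)\<^sup>2 / L\<^sup>2))"
proof -
  have B: "0 \<le> B" using g(2)[of 0] by simp
  interpret function_ring_on "Collect trig_poly" "cball 0 L :: 'a set"
    by (rule trig_poly_function_ring) simp
  obtain P where P: "trig_poly P" "\<And>x. x \<in> cball 0 L \<Longrightarrow> \<bar>g x - P x\<bar> < d"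
    using Stone_Weierstrass_basic[OF continuous_on_subset[OF g(1)] d] by blast
  \<comment> \<open>A bound on the whole space, so the polynomial \<open>q\<close> has to be close
    to \<open>clip\<close> only on the compact interval \<open>{- C..C}\<close>.\<close>
  obtain C where C: "\<And>x. \<bar>P x\<bar> \<le> C" using trig_poly_bounded[OF P(1)] by blast
  define clip where "clip y = max (- B) (min B y)" for y
  have "continuous_on {- C..C} clip" unfolding clip_def by (intro continuous_intros)
  then obtain q where q: "real_polynomial_function q" "\<And>y. y \<in> {- C..C} \<Longrightarrow> \<bar>clip y - q y\<bar> < d"
    using Stone_Weierstrass_real_polynomial_function[OF compact_Icc _ d] by metis
  have qP: "\<bar>clip (P x) - q (P x)\<bar> < d" for x
    using C[of x] by (intro q(2)) (auto simp: abs_le_iff)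
  have "\<bar>g x - q (P x)\<bar> \<le> 2 * d + (2 * B + d) * ((norm x)\<^sup>2 / L\<^sup>2)" for x
  proof (cases "x \<in> cball 0 L")
    case True
    \<comment> \<open>Truncation is nonexpansive and fixes \<open>g x\<close>.\<close>
    have "\<bar>g x - clip (P x)\<bar> \<le> \<bar>g x - P x\<bar>" using g(2)[of x] by (auto simp: clip_def)
    then have "\<bar>g x - q (P x)\<bar> \<le> 2 * d" using P(2)[OF True] qP[of x] by linarith
    moreover have "0 \<le> (2 * B + d) * ((norm x)\<^sup>2 / L\<^sup>2)" using B d by (intro mult_nonneg_nonneg) auto
    ultimately show ?thesis by linarith
  next
    case False
    then have "L\<^sup>2 \<le> (norm x)\<^sup>2" using L by (intro power_mono) auto
    then have "1 \<le> (norm x)\<^sup>2 / L\<^sup>2" using L by simp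
    then have "(2 * B + d) * 1 \<le> (2 * B + d) * ((norm x)\<^sup>2 / L\<^sup>2)"
      using B d by (intro mult_left_mono) auto
    moreover have "\<bar>clip (P x)\<bar> \<le> B" using B by (auto simp: clip_def)
    then have "\<bar>g x - q (P x)\<bar> \<le> 2 * B + d" using g(2)[of x] qP[of x] by linarith
    ultimately show ?thesis using d by simp
  qed
  then show ?thesis using trig_poly_compose_polynomial[OF q(1) P(1)] by blast
qed

text \<open>The approximation error carries the weight \<open>(norm x)\<^sup>2 / L\<^sup>2\<close>,
  whose expectation is at most \<open>C / L\<^sup>2\<close> uniformly along the filter. The moment
  bound thus takes the place of tightness.\<close>

lemma weak_conv_measure_trig:
  fixes X :: "'e \<Rightarrow> 'w \<Rightarrow> 'a::euclidean_space" and Y :: "'w \<Rightarrow> 'a"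
  assumes "prob_space M"
    and X: "\<forall>\<^sub>F e in F. X e \<in> borel_measurable M" and Y: "Y \<in> borel_measurable M"
    and Xi: "\<forall>\<^sub>F e in F. integrable M (\<lambda>w. (norm (X e w))\<^sup>2) \<and> (\<integral>w. (norm (X e w))\<^sup>2 \<partial>M) \<le> C"
    and Yi: "integrable M (\<lambda>w. (norm (Y w))\<^sup>2)" "(\<integral>w. (norm (Y w))\<^sup>2 \<partial>M) \<le> C"
    and lim: "\<And>s b. ((\<lambda>e. \<integral>w. cos (s \<bullet> X e w + b) \<partial>M) \<longlongrightarrow> (\<integral>w. cos (s \<bullet> Y w + b) \<partial>M)) F"
  shows "weak_conv_measure F (\<lambda>e. distr M borel (X e)) (distr M borel Y)"
  unfolding weak_conv_measure_def
proof (intro allI impI, elim conjE)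
  interpret prob_space M by fact
  note [measurable] = Y
  have ti: "integrable M (\<lambda>w. Q (Z w))" if tp: "trig_poly Q" and [measurable]: "Z \<in> borel_measurable M" for Q and Z :: "'w \<Rightarrow> 'a"
  proof -
    obtain B where "\<And>x. \<bar>Q x\<bar> \<le> B" using trig_poly_bounded[OF tp] by blast
    moreover have [measurable]: "Q \<in> borel_measurable borel"
      by (rule borel_measurable_continuous_onI[OF trig_poly_continuous[OF tp]])
    ultimately show ?thesis by (intro integrable_const_bound[of _ B]) auto
  qed
  have tl: "((\<lambda>e. \<integral>w. Q (X e w) \<partial>M) \<longlongrightarrow> (\<integral>w. Q (Y w) \<partial>M)) F" if "trig_poly Q" for Q
    using that
  proof (induction rule: trig_poly.induct)
    case (trig_poly_cos a s b)
    show ?case by (simp, intro tendsto_intros lim)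
  next
    case (trig_poly_add f g)
    have "(\<integral>w. f (Z w) + g (Z w) \<partial>M) = (\<integral>w. f (Z w) \<partial>M) + (\<integral>w. g (Z w) \<partial>M)"
      if "Z \<in> borel_measurable M" for Z :: "'w \<Rightarrow> 'a"
      using ti[OF trig_poly_add(1) that] ti[OF trig_poly_add(2) that] by simp
    then have *: "(\<integral>w. f (Y w) + g (Y w) \<partial>M) = (\<integral>w. f (Y w) \<partial>M) + (\<integral>w. g (Y w) \<partial>M)"
      "\<forall>\<^sub>F e in F. (\<integral>w. f (X e w) + g (X e w) \<partial>M) = (\<integral>w. f (X e w) \<partial>M) + (\<integral>w. g (X e w) \<partial>M)"
      using X Y by (auto elim: eventually_mono)
    show ?case unfolding *(1) tendsto_cong[OF *(2)] by (rule tendsto_add[OF trig_poly_add(3,4)])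
  qed
  fix g :: "'a \<Rightarrow> real" assume g: "continuous_on UNIV g" and "bounded (range g)"
  then obtain B where B: "\<And>x. \<bar>g x\<bar> \<le> B" by (auto simp: bounded_iff)
  have B0: "0 \<le> B" using B[of 0] by simp
  have gm [measurable]: "g \<in> borel_measurable borel" by (rule borel_measurable_continuous_onI[OF g])
  have C0: "0 \<le> C" using order_trans[OF _ Yi(2)] by simp
  show "((\<lambda>e. \<integral>z. g z \<partial>distr M borel (X e)) \<longlongrightarrow> (\<integral>z. g z \<partial>distr M borel Y)) F"
  proof (rule tendstoI)
    fix r :: real assume r: "0 < r"
    \<comment> \<open>Seven parts: \<open>3 * d\<close> for replacing \<open>g\<close> by
      \<open>Q\<close> at \<open>X e\<close>, \<open>3 * d\<close> at \<open>Y\<close>, and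
      \<open>d\<close> for the convergence of the expectations of \<open>Q\<close>.\<close>
    define d where "d = min 1 (r / 7)"
    have d: "0 < d" "d \<le> 1" "7 * d \<le> r" using r by (auto simp: d_def)
    \<comment> \<open>Makes the expected weighted error at most \<open>d\<close>; the 1 in
      \<open>2 * B + 1\<close> absorbs \<open>d \<le> 1\<close>, and the 1 in \<open>C + 1\<close>
      keeps \<open>L\<close> positive.\<close>
    define L where "L = sqrt ((2 * B + 1) * (C + 1) / d)"
    have L: "0 < L" "L\<^sup>2 = (2 * B + 1) * (C + 1) / d"
      using B0 C0 d by (auto simp: L_def intro!: mult_pos_pos divide_pos_pos)
    obtain Q where Q: "trig_poly Q" "\<And>x. \<bar>g x - Q x\<bar> \<le> 2 * d + (2 * B + d) * ((norm x)\<^sup>2 / L\<^sup>2)"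
      using trig_poly_approx[OF g B d(1) L(1)] by blast
    have approx: "\<bar>(\<integral>w. g (Z w) \<partial>M) - (\<integral>w. Q (Z w) \<partial>M)\<bar> \<le> 3 * d"
      if [measurable]: "Z \<in> borel_measurable M" and i: "integrable M (\<lambda>w. (norm (Z w))\<^sup>2)"
        and c: "(\<integral>w. (norm (Z w))\<^sup>2 \<partial>M) \<le> C" for Z
    proof -
      have gi: "integrable M (\<lambda>w. g (Z w))" by (rule integrable_const_bound[of _ B]) (use B in auto)
      note qi = ti[OF Q(1) that(1)]
      have "\<bar>(\<integral>w. g (Z w) \<partial>M) - (\<integral>w. Q (Z w) \<partial>M)\<bar> = \<bar>\<integral>w. g (Z w) - Q (Z w) \<partial>M\<bar>"
        using gi qi by simp
      also have "\<dots> \<le> (\<integral>w. \<bar>g (Z w) - Q (Z w)\<bar> \<partial>M)" by (rule integral_abs_bound)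
      also have "\<dots> \<le> (\<integral>w. 2 * d + (2 * B + d) * ((norm (Z w))\<^sup>2 / L\<^sup>2) \<partial>M)"
        using gi qi i by (intro integral_mono Q(2)) auto
      also have "\<dots> = 2 * d + (2 * B + d) * ((\<integral>w. (norm (Z w))\<^sup>2 \<partial>M) / L\<^sup>2)"
        using i by (simp add: prob_space)
      also have "\<dots> \<le> 2 * d + (2 * B + 1) * ((C + 1) / L\<^sup>2)"
        using c d B0 C0 by (intro add_left_mono mult_mono divide_right_mono) auto
      also have "\<dots> = 3 * d" using B0 C0 d by (simp add: L)
      finally show ?thesis .
    qed
    have "\<forall>\<^sub>F e in F. \<bar>(\<integral>w. Q (X e w) \<partial>M) - (\<integral>w. Q (Y w) \<partial>M)\<bar> < d"
      using tendstoD[OF tl[OF Q(1)] d(1)] by (simp add: dist_real_def)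
    then show "\<forall>\<^sub>F e in F. dist (\<integral>z. g z \<partial>distr M borel (X e)) (\<integral>z. g z \<partial>distr M borel Y) < r"
      using Xi X
    proof eventually_elim
      case (elim e)
      then show ?case
        using approx[of "X e"] approx[OF Y Yi] d by (simp add: integral_distr dist_real_def)
    qed
  qed
qed

section \<open>The spectral density at the origin\<close>

lemma has_bochner_integral_Gamma:
  fixes a c :: real
  assumes "0 < a" "0 < c"
  shows "has_bochner_integral lborel (\<lambda>s. indicator {0<..} s * (s powr (a - 1) * exp (- (c * s)))) (Gamma a * c powr (- a))"
proof -
  have "((\<lambda>t. t powr (a - 1) / exp t) has_integral Gamma a) {0..}"
    using Gamma_integral_real[of a] assms by simp
  from has_integral_imp_set_lborel[OF this]
  have "set_integrable lborel {0..} (\<lambda>t. t powr (a - 1) / exp t)" "(LBINT t:{0..}. t powr (a - 1) / exp t) = Gamma a"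
    by auto
  moreover have "indicator {0..} t *\<^sub>R (t powr (a - 1) / exp t) = indicator {0<..} t * (t powr (a - 1) * exp (- t))" for t
    by (cases "t = 0") (auto simp: indicator_def exp_minus divide_inverse)
  ultimately have "has_bochner_integral lborel (\<lambda>t. indicator {0<..} t * (t powr (a - 1) * exp (- t))) (Gamma a)"
    by (simp add: has_bochner_integral_iff set_integrable_def set_lebesgue_integral_def)
  then have "has_bochner_integral lborel (\<lambda>s. indicator {0<..} (0 + c * s) * ((0 + c * s) powr (a - 1) * exp (- (0 + c * s)))) (Gamma a /\<^sub>R \<bar>c\<bar>)"
    using assms by (subst (asm) lborel_has_bochner_integral_real_affine_iff[of c _ _ 0]) auto
  then have "has_bochner_integral lborel (\<lambda>s. c powr (1 - a) * (indicator {0<..} (0 + c * s) * ((0 + c * s) powr (a - 1) * exp (- (0 + c * s))))) (c powr (1 - a) * (Gamma a /\<^sub>R \<bar>c\<bar>))"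
    by (rule has_bochner_integral_mult_right)
  moreover have "c powr (1 - a) * (indicator {0<..} (0 + c * s) * ((0 + c * s) powr (a - 1) * exp (- (0 + c * s)))) =
      indicator {0<..} s * (s powr (a - 1) * exp (- (c * s)))" for s
  proof -
    have "c powr (1 - a) * c powr (a - 1) = 1" using assms by (simp add: powr_add[symmetric])
    then show ?thesis
      using assms by (cases "0 < s") (auto simp: powr_mult zero_less_mult_iff)
  qed
  moreover have "c powr (1 - a) * (Gamma a /\<^sub>R \<bar>c\<bar>) = Gamma a * c powr (- a)"
    using assms by (simp add: powr_diff powr_minus field_simps)
  ultimately show ?thesis by (simp only:)
qed

lemma integrable_iexp_mult:
  assumes "integrable lborel h"
  shows "integrable lborel (\<lambda>l. iexp (x * l) * complex_of_real (h l))"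
proof (rule Bochner_Integration.integrable_bound[OF assms])
  have [measurable]: "h \<in> borel_measurable lborel" using assms by auto
  show "(\<lambda>l. iexp (x * l) * complex_of_real (h l)) \<in> borel_measurable lborel" by measurable
qed (simp add: norm_mult)

text \<open>The positive and negative parts have the same transform, in particular the same mass at
  frequency 0. If the mass is positive, dividing by it gives two probability densities with equal
  characteristic functions, and Levy uniqueness applies.\<close>

lemma fourier_eq_0_imp_AE_eq_0:
  fixes h :: "real \<Rightarrow> real"
  assumes h: "integrable lborel h"
    and F: "\<And>x. (LBINT l. iexp (x * l) * complex_of_real (h l)) = 0"
  shows "AE l in lborel. h l = 0"
proof -
  define p q where "p l = max (h l) 0" and "q l = max (- h l) 0" for l
  have pq: "integrable lborel p" "integrable lborel q" unfolding p_def q_def using h by auto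
  have [measurable]: "p \<in> borel_measurable borel" "q \<in> borel_measurable borel"
    using pq by auto
  have nn: "0 \<le> p l" "0 \<le> q l" "h l = p l - q l" for l by (auto simp: p_def q_def)
  have FT: "(LBINT l. iexp (x * l) * complex_of_real (p l)) = (LBINT l. iexp (x * l) * complex_of_real (q l))" for x
    using F[of x] integrable_iexp_mult[OF pq(1), of x] integrable_iexp_mult[OF pq(2), of x] by (simp add: nn(3) right_diff_distrib)
  define m where "m = (LBINT l. p l)"
  have "complex_of_real (LBINT l. p l) = complex_of_real (LBINT l. q l)"
    using FT[of 0] unfolding integral_complex_of_real[symmetric] by simp
  then have mq: "(LBINT l. q l) = m" by (simp add: m_def)
  have m0: "0 \<le> m" unfolding m_def using nn by (intro integral_nonneg_AE) auto
  show ?thesis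
  proof (cases "m = 0")
    case True
    then have "AE l in lborel. p l = 0" "AE l in lborel. q l = 0"
      using pq nn mq by (subst integral_nonneg_eq_0_iff_AE[symmetric]; auto simp: m_def)+
    then show ?thesis by eventually_elim (simp add: nn)
  next
    case False
    then have m: "0 < m" using m0 by simp
    let ?N = "\<lambda>k :: real \<Rightarrow> real. density lborel (\<lambda>l. ennreal (k l / m))"
    have rd: "real_distribution (?N k)" if "integrable lborel k" "\<And>l. 0 \<le> k l" "(LBINT l. k l) = m" for k
    proof -
      have [measurable]: "k \<in> borel_measurable borel" using that(1) by auto
      have "emeasure (?N k) (space (?N k)) = (\<integral>\<^sup>+l. ennreal (k l / m) \<partial>lborel)"
        by (simp add: emeasure_density)
      also have "\<dots> = ennreal (LBINT l. k l / m)"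
        using that m by (intro nn_integral_eq_integral) auto
      also have "\<dots> = 1" using that m by simp
      finally show ?thesis
        by (auto simp: real_distribution_def real_distribution_axioms_def intro: prob_spaceI)
    qed
    have ch: "char (?N k) x = (LBINT l. iexp (x * l) * complex_of_real (k l)) / m"
      if "integrable lborel k" "\<And>l. 0 \<le> k l" for k x
    proof -
      have [measurable]: "k \<in> borel_measurable borel" using that(1) by auto
      have "char (?N k) x = (LBINT l. (k l / m) *\<^sub>R iexp (x * l))"
        unfolding char_def using that m by (subst integral_density) auto
      also have "\<dots> = (LBINT l. iexp (x * l) * complex_of_real (k l) / m)"
        by (simp add: scaleR_conv_of_real mult.commute)
      finally show ?thesis by simp
    qed
    have "?N p = ?N q"
      by (rule Levy_uniqueness[OF rd[OF pq(1) nn(1) m_def[symmetric]] rd[OF pq(2) nn(2) mq]])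
        (use ch[OF pq(1) nn(1)] ch[OF pq(2) nn(2)] FT in auto)
    then have "AE l in lborel. ennreal (p l / m) = ennreal (q l / m)"
      by (intro sigma_finite_measure.density_unique[OF sigma_finite_lborel]) auto
    then show ?thesis
      by eventually_elim (use m nn in \<open>auto simp: divide_nonneg_pos\<close>)
  qed
qed

text \<open>Comes from writing
  \<open>Gamma (\<kappa> / 2) * (1 + x\<^sup>2) powr (- \<kappa> / 2)\<close> as the integral of
  \<open>s powr (\<kappa> / 2 - 1) * exp (- s) * exp (- x\<^sup>2 * s)\<close>: the last factor is
  the characteristic function of a centred normal law of variance \<open>2 * s\<close>.\<close>

definition mix_kernel :: "real \<Rightarrow> real \<Rightarrow> real \<Rightarrow> real" where
  "mix_kernel \<kappa> s l = indicator {0<..} s * (s powr (\<kappa> / 2 - 1) * exp (- s)) * normal_density 0 (sqrt (2 * s)) l"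

text \<open>The density of \<open>(1 + x\<^sup>2) powr (- \<kappa> / 2)\<close>, as a Gamma mixture of centred normal densities.\<close>

definition bessel_density :: "real \<Rightarrow> real \<Rightarrow> real" where
  "bessel_density \<kappa> l = (LBINT s. mix_kernel \<kappa> s l) / Gamma (\<kappa> / 2)"

lemma mix_kernel_nonneg: "0 \<le> mix_kernel \<kappa> s l"
  by (simp add: mix_kernel_def normal_density_nonneg)

lemma mix_kernel_integral:
  "has_bochner_integral lborel (mix_kernel \<kappa> s) (indicator {0<..} s * (s powr (\<kappa> / 2 - 1) * exp (- s)))"
proof (cases "0 < s")
  case True
  then have s: "0 < sqrt (2 * s)" by simp
  have "has_bochner_integral lborel (normal_density 0 (sqrt (2 * s))) 1"
    using integrable_normal_density[OF s] integral_normal_density[OF s] by (simp add: has_bochner_integral_iff)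
  from has_bochner_integral_mult_right[OF this, of "indicator {0<..} s * (s powr (\<kappa> / 2 - 1) * exp (- s))"]
  show ?thesis by (simp add: mix_kernel_def[abs_def])
qed (simp add: mix_kernel_def[abs_def] has_bochner_integral_zero)

lemma mix_kernel_fourier:
  assumes "0 < s"
  shows "(LBINT l. iexp (x * l) * complex_of_real (mix_kernel \<kappa> s l)) =
    complex_of_real (s powr (\<kappa> / 2 - 1) * exp (- ((1 + x\<^sup>2) * s)))"
proof -
  have s: "0 < sqrt (2 * s)" using assms by simp
  have "(LBINT l. iexp (x * l) * complex_of_real (mix_kernel \<kappa> s l)) =
      (LBINT l. complex_of_real (s powr (\<kappa> / 2 - 1) * exp (- s)) * (normal_density 0 (sqrt (2 * s)) l *\<^sub>R iexp (x * l)))"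
    using assms by (simp add: mix_kernel_def scaleR_conv_of_real mult_ac)
  also have "\<dots> = complex_of_real (s powr (\<kappa> / 2 - 1) * exp (- s)) * (LBINT l. normal_density 0 (sqrt (2 * s)) l *\<^sub>R iexp (x * l))"
    by (rule integral_mult_right_zero)
  also have "(LBINT l. normal_density 0 (sqrt (2 * s)) l *\<^sub>R iexp (x * l)) = char (density lborel (normal_density 0 (sqrt (2 * s)))) x"
    unfolding char_def by (subst integral_density) (auto simp: normal_density_nonneg)
  also have "\<dots> = exp (- (x\<^sup>2 * s))"
    using char_normal_density[OF s, of x] assms by simp
  also have "complex_of_real (s powr (\<kappa> / 2 - 1) * exp (- s)) * complex_of_real (exp (- (x\<^sup>2 * s))) =
      complex_of_real (s powr (\<kappa> / 2 - 1) * exp (- ((1 + x\<^sup>2) * s)))"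
  proof -
    have "exp (- s) * exp (- (x\<^sup>2 * s)) = exp (- ((1 + x\<^sup>2) * s))"
      by (simp add: exp_add[symmetric] algebra_simps)
    then show ?thesis by (simp only: of_real_mult[symmetric] mult.assoc)
  qed
  finally show ?thesis .
qed

text \<open>Fubini: integrating the nonnegative kernel over \<open>l\<close> first leaves a Gamma
  integrand, which gives absolute integrability. The inner transform then turns the \<open>s\<close>
  integral into a Gamma integral with rate \<open>1 + x\<^sup>2\<close>.\<close>

lemma bessel_density_fourier:
  assumes k: "0 < \<kappa>"
  shows "integrable lborel (bessel_density \<kappa>)"
    and "(LBINT l. iexp (x * l) * complex_of_real (bessel_density \<kappa> l)) =
      complex_of_real ((1 + x\<^sup>2) powr (- (\<kappa> / 2)))"
proof -
  have G: "0 < Gamma (\<kappa> / 2)" using k by simp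
  have pi: "integrable (lborel \<Otimes>\<^sub>M lborel) (\<lambda>(s, l). iexp (x * l) * complex_of_real (mix_kernel \<kappa> s l))" for x
  proof (rule lborel_pair.Fubini_integrable)
    show "(\<lambda>(s, l). iexp (x * l) * complex_of_real (mix_kernel \<kappa> s l)) \<in> borel_measurable (lborel \<Otimes>\<^sub>M lborel)"
      unfolding mix_kernel_def normal_density_def by measurable
    have "(LBINT l. norm (case (s, l) of (s, l) \<Rightarrow> iexp (x * l) * complex_of_real (mix_kernel \<kappa> s l))) =
        indicator {0<..} s * (s powr (\<kappa> / 2 - 1) * exp (- s))" for s
      using mix_kernel_integral[of \<kappa> s] by (simp add: norm_mult mix_kernel_nonneg has_bochner_integral_iff)
    then show "integrable lborel (\<lambda>s. \<integral>l. norm (case (s, l) of (s, l) \<Rightarrow> iexp (x * l) * complex_of_real (mix_kernel \<kappa> s l)) \<partial>lborel)"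
      using has_bochner_integral_Gamma[of "\<kappa> / 2" 1] k by (simp add: has_bochner_integral_iff)
    have "integrable lborel (\<lambda>l. iexp (x * l) * complex_of_real (mix_kernel \<kappa> s l))" for s
      using mix_kernel_integral[of \<kappa> s] by (intro integrable_iexp_mult) (simp add: has_bochner_integral_iff)
    then show "AE s in lborel. integrable lborel (\<lambda>l. case (s, l) of (s, l) \<Rightarrow> iexp (x * l) * complex_of_real (mix_kernel \<kappa> s l))"
      by simp
  qed
  have sw: "(LBINT s. iexp (x * l) * complex_of_real (mix_kernel \<kappa> s l)) = iexp (x * l) * complex_of_real (bessel_density \<kappa> l) * Gamma (\<kappa> / 2)" for x l
    using G[THEN less_imp_neq, symmetric] k by (simp add: bessel_density_def)
  show "integrable lborel (bessel_density \<kappa>)"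
  proof -
    have "integrable lborel (\<lambda>l. \<integral>s. iexp (0 * l) * complex_of_real (mix_kernel \<kappa> s l) \<partial>lborel)"
      using lborel_pair.integrable_snd[OF pi[of 0]] .
    then have "integrable lborel (\<lambda>l. complex_of_real (bessel_density \<kappa> l) * Gamma (\<kappa> / 2))"
      unfolding sw by simp
    then have "integrable lborel (\<lambda>l. complex_of_real (bessel_density \<kappa> l * Gamma (\<kappa> / 2)))" by simp
    then have "integrable lborel (\<lambda>l. bessel_density \<kappa> l * Gamma (\<kappa> / 2))"
      unfolding complex_of_real_integrable_eq .
    from integrable_divide[OF this, of "Gamma (\<kappa> / 2)"] show ?thesis using G by simp
  qed
  have "(LBINT l. iexp (x * l) * complex_of_real (bessel_density \<kappa> l)) * Gamma (\<kappa> / 2) =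
      (LBINT l. (LBINT s. iexp (x * l) * complex_of_real (mix_kernel \<kappa> s l)))"
    unfolding sw by simp
  also have "\<dots> = (LBINT s. (LBINT l. iexp (x * l) * complex_of_real (mix_kernel \<kappa> s l)))"
    by (rule lborel_pair.Fubini_integral[OF pi])
  also have "\<dots> = (LBINT s. complex_of_real (indicator {0<..} s * (s powr (\<kappa> / 2 - 1) * exp (- ((1 + x\<^sup>2) * s)))))"
  proof (rule Bochner_Integration.integral_cong[OF refl])
    fix s show "(LBINT l. iexp (x * l) * complex_of_real (mix_kernel \<kappa> s l)) =
        complex_of_real (indicator {0<..} s * (s powr (\<kappa> / 2 - 1) * exp (- ((1 + x\<^sup>2) * s))))"
      using mix_kernel_fourier[of s x \<kappa>] by (cases "0 < s") (simp_all add: mix_kernel_def)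
  qed
  also have "\<dots> = complex_of_real (Gamma (\<kappa> / 2) * (1 + x\<^sup>2) powr (- (\<kappa> / 2)))"
    unfolding integral_complex_of_real
    using has_bochner_integral_Gamma[of "\<kappa> / 2" "1 + x\<^sup>2"] k
    by (simp add: has_bochner_integral_iff add_pos_nonneg)
  finally show "(LBINT l. iexp (x * l) * complex_of_real (bessel_density \<kappa> l)) =
      complex_of_real ((1 + x\<^sup>2) powr (- (\<kappa> / 2)))"
    using G by simp
qed

section \<open>The constant and the singularity at the origin\<close>

lemma c2_pos:
  assumes "0 < \<kappa>" "\<kappa> < 1"
  shows "0 < c2 \<kappa>"
proof -
  have "0 < cos (\<kappa> * pi / 2)" using assms by (intro cos_gt_zero) auto
  then show ?thesis using assms by (simp add: c2_def)
qed

lemma c2_alt: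
  assumes "0 < \<kappa>" "\<kappa> < 1"
  shows "c2 \<kappa> = Gamma ((1 - \<kappa>) / 2) / (2 powr \<kappa> * sqrt pi * Gamma (\<kappa> / 2))"
proof -
  obtain a b g d where G: "Gamma (\<kappa> / 2) = a" "Gamma (\<kappa> / 2 + 1 / 2) = b" "Gamma ((1 - \<kappa>) / 2) = g" "Gamma \<kappa> = d"
    by blast
  have pos: "0 < a" "0 < b" "0 < g" "0 < d" using assms unfolding G[symmetric] by (auto intro!: Gamma_real_pos)
  have c: "0 < cos (\<kappa> * pi / 2)" using assms by (intro cos_gt_zero) auto
  define z where "z = complex_of_real (\<kappa> / 2)"
  have e: "z + 1 / 2 = complex_of_real (\<kappa> / 2 + 1 / 2)" "2 * z = complex_of_real \<kappa>"
    "exp ((1 - complex_of_real \<kappa>) * complex_of_real (ln 2)) = complex_of_real (exp ((1 - \<kappa>) * ln 2))"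
    by (simp_all add: z_def exp_of_real[symmetric])
  have "\<kappa> / 2 \<notin> \<int>\<^sub>\<le>\<^sub>0" "\<kappa> / 2 + 1 / 2 \<notin> \<int>\<^sub>\<le>\<^sub>0"
    using nonpos_Ints_nonpos[of "\<kappa> / 2"] nonpos_Ints_nonpos[of "\<kappa> / 2 + 1 / 2"] assms by linarith+
  then have "z \<notin> \<int>\<^sub>\<le>\<^sub>0" "z + 1 / 2 \<notin> \<int>\<^sub>\<le>\<^sub>0"
    unfolding e(1) unfolding z_def of_real_in_nonpos_Ints_iff .
  from Gamma_legendre_duplication[OF this]
  have "complex_of_real (a * b) = complex_of_real (exp ((1 - \<kappa>) * ln 2) * sqrt pi * d)"
    unfolding e unfolding z_def Gamma_complex_of_real G of_real_mult .
  then have dup: "a * b = 2 powr (1 - \<kappa>) * sqrt pi * d"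
    unfolding of_real_eq_iff by (simp add: powr_def)
  have "1 - complex_of_real (\<kappa> / 2 + 1 / 2) = complex_of_real ((1 - \<kappa>) / 2)"
    by (simp add: field_simps)
  from Gamma_reflection_complex[of "complex_of_real (\<kappa> / 2 + 1 / 2)", unfolded this]
  have "complex_of_real (b * g) = complex_of_real (pi / sin (pi * (\<kappa> / 2 + 1 / 2)))"
    unfolding Gamma_complex_of_real G of_real_mult[symmetric] sin_of_real of_real_divide[symmetric] .
  then have "b * g = pi / sin (pi * (\<kappa> / 2 + 1 / 2))" unfolding of_real_eq_iff .
  also have "sin (pi * (\<kappa> / 2 + 1 / 2)) = cos (\<kappa> * pi / 2)"
    unfolding distrib_left sin_add by (simp add: mult.commute)
  finally have refl: "b * g * cos (\<kappa> * pi / 2) = pi" using c by simp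
  \<comment> \<open>Duplication and reflection share the factor
    \<open>b = Gamma (\<kappa> / 2 + 1 / 2)\<close>, which is multiplied in and cancelled.\<close>
  have "g * (2 * d * cos (\<kappa> * pi / 2)) = 2 powr \<kappa> * sqrt pi * a"
  proof -
    have "b * (g * (2 * d * cos (\<kappa> * pi / 2))) = 2 * d * (b * g * cos (\<kappa> * pi / 2))" by (simp only: mult_ac)
    also have "\<dots> = 2 * d * pi" unfolding refl ..
    also have "\<dots> = (2 powr \<kappa> * 2 powr (1 - \<kappa>)) * d * (sqrt pi * sqrt pi)"
      unfolding powr_add[symmetric] by simp
    also have "\<dots> = 2 powr \<kappa> * sqrt pi * (2 powr (1 - \<kappa>) * sqrt pi * d)" by (simp only: mult_ac)
    also have "\<dots> = b * (2 powr \<kappa> * sqrt pi * a)" unfolding dup[symmetric] by (simp only: mult_ac)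
    finally show ?thesis using pos by simp
  qed
  then show ?thesis using pos c unfolding c2_def G by (subst frac_eq_eq) simp_all
qed

text \<open>For \<open>l \<noteq> 0\<close> this is
  \<open>2 * (\<bar>l\<bar> / 2) powr \<nu>\<close> times the modified Bessel function of the second
  kind of order \<nu> = (1 - \<kappa>) / 2 at \<open>\<bar>l\<bar>\<close>. At \<open>l = 0\<close>
  it is a plain Gamma integral.\<close>

definition bessel_integral :: "real \<Rightarrow> real \<Rightarrow> real" where
  "bessel_integral \<kappa> l =
    (LBINT y. indicator {0<..} y * (y powr ((1 - \<kappa>) / 2 - 1) * exp (- (1 * y))) * exp (- (l\<^sup>2 / (4 * y))))"

text \<open>The integrand at \<open>l = 0\<close> dominates all others and is integrable because
  \<kappa> < 1.\<close>

lemma bessel_integral_properties: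
  assumes k: "0 < \<kappa>" "\<kappa> < 1"
  shows "integrable lborel (\<lambda>y. indicator {0<..} y * (y powr ((1 - \<kappa>) / 2 - 1) * exp (- (1 * y))) * exp (- (l\<^sup>2 / (4 * y))))"
    and "(bessel_integral \<kappa> \<longlongrightarrow> Gamma ((1 - \<kappa>) / 2)) (at 0)"
proof -
  let ?w = "\<lambda>y. indicator {0<..} y * (y powr ((1 - \<kappa>) / 2 - 1) * exp (- (1 * y))) :: real"
  let ?h = "\<lambda>l y. ?w y * exp (- (l\<^sup>2 / (4 * y)))"
  have w: "integrable lborel ?w" "(LBINT y. ?w y) = Gamma ((1 - \<kappa>) / 2)"
    using has_bochner_integral_Gamma[of "(1 - \<kappa>) / 2" 1] k by (simp_all add: has_bochner_integral_iff)
  have b: "norm (?h l y) \<le> ?w y" for l y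
  proof (cases "0 < y")
    case True
    then have "exp (- (l\<^sup>2 / (4 * y))) \<le> 1" by simp
    then show ?thesis using True by (simp add: mult_left_le abs_mult)
  qed simp
  show "integrable lborel (?h l)" for l
  proof (rule Bochner_Integration.integrable_bound[OF w(1)])
    show "AE y in lborel. norm (?h l y) \<le> norm (?w y)"
      by (intro AE_I2 order_trans[OF b]) simp
  qed measurable
  show "(bessel_integral \<kappa> \<longlongrightarrow> Gamma ((1 - \<kappa>) / 2)) (at 0)"
    unfolding tendsto_at_iff_sequentially comp_def
  proof (intro allI impI)
    fix X :: "nat \<Rightarrow> real" assume "\<forall>i. X i \<in> UNIV - {0}" and X: "X \<longlonglongrightarrow> 0"
    have "(\<lambda>i. \<integral>y. ?h (X i) y \<partial>lborel) \<longlonglongrightarrow> (LBINT y. ?w y)"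
    proof (rule integral_dominated_convergence[OF _ _ w(1)])
      have "(\<lambda>i. ?h (X i) y) \<longlonglongrightarrow> ?w y * exp (- (0\<^sup>2 / (4 * y)))" if "y \<noteq> 0" for y
        by (intro tendsto_intros X) (use that in auto)
      then show "AE y in lborel. (\<lambda>i. ?h (X i) y) \<longlonglongrightarrow> ?w y"
        by (intro AE_I2, rename_tac y, case_tac "y = 0") auto
      show "AE y in lborel. norm (?h (X i) y) \<le> ?w y" for i using b by (intro AE_I2)
    qed measurable
    then show "(\<lambda>i. bessel_integral \<kappa> (X i)) \<longlonglongrightarrow> Gamma ((1 - \<kappa>) / 2)"
      unfolding bessel_integral_def w(2) .
  qed
qed

text \<open>The substitution \<open>s = l\<^sup>2 / (4 * y)\<close> maps the half-line onto itself
  and exchanges the exponential of the Gamma weight with that of the normal density. The powers of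
  \<open>l\<close> come out as the singular factor, leaving an integral with a finite limit at
  0.\<close>

lemma bessel_density_eq:
  assumes k: "0 < \<kappa>" "\<kappa> < 1" and l: "l \<noteq> 0"
  shows "bessel_density \<kappa> l = \<bar>l\<bar> powr (\<kappa> - 1) * (bessel_integral \<kappa> l / (2 powr \<kappa> * sqrt pi * Gamma (\<kappa> / 2)))"
proof -
  define S :: "real set" where "S = {0<..}"
  define \<phi> where "\<phi> y = l\<^sup>2 / (4 * y)" for y
  define \<phi>' where "\<phi>' y = - (l\<^sup>2 / (4 * y\<^sup>2))" for y
  define C where "C = \<bar>l\<bar> powr (\<kappa> - 1) * 2 powr (- \<kappa>) / sqrt pi"
  define m where "m s = s powr (\<kappa> / 2 - 1) * exp (- s) * normal_density 0 (sqrt (2 * s)) l" for s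
  define h where "h y = y powr ((1 - \<kappa>) / 2 - 1) * exp (- y) * exp (- (l\<^sup>2 / (4 * y)))" for y
  have im: "\<phi> ` S = S"
  proof (intro equalityI subsetI)
    fix s assume "s \<in> S"
    then show "s \<in> \<phi> ` S" using l by (intro image_eqI[of _ _ "l\<^sup>2 / (4 * s)"]) (auto simp: \<phi>_def S_def)
  qed (use l in \<open>auto simp: \<phi>_def S_def\<close>)
  have sub: "\<bar>\<phi>' y\<bar> * m (\<phi> y) = C * h y" if "y \<in> S" for y
  proof -
    have y: "0 < y" using that by (simp add: S_def)
    define a where "a = \<bar>l\<bar>"
    have a: "0 < a" "l\<^sup>2 = a\<^sup>2" using l by (auto simp: a_def)
    have p: "0 < \<phi> y" using y a by (simp add: \<phi>_def)
    have e1: "exp (- l\<^sup>2 / (2 * (sqrt (2 * \<phi> y))\<^sup>2)) = exp (- y)"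
      using p y a by (simp add: \<phi>_def)
    have e2: "sqrt (2 * pi * (sqrt (2 * \<phi> y))\<^sup>2) = 2 * sqrt pi * (a / (2 * sqrt y))"
      using p y a by (simp add: \<phi>_def real_sqrt_mult real_sqrt_divide)
    have e3: "(\<phi> y) powr (\<kappa> / 2 - 1) = a powr (\<kappa> - 2) * 2 powr (2 - \<kappa>) * y powr (1 - \<kappa> / 2)"
    proof -
      have "\<phi> y = (a / 2) powr 2 * y powr (- 1)" using y a by (simp add: \<phi>_def powr_minus power_divide field_simps)
      then have "(\<phi> y) powr (\<kappa> / 2 - 1) = (a / 2) powr (2 * (\<kappa> / 2 - 1)) * y powr (- 1 * (\<kappa> / 2 - 1))"
        by (simp only: powr_mult powr_powr)
      also have "\<dots> = (a / 2) powr (\<kappa> - 2) * y powr (1 - \<kappa> / 2)" by (simp add: right_diff_distrib)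
      finally have "(\<phi> y) powr (\<kappa> / 2 - 1) = (a / 2) powr (\<kappa> - 2) * y powr (1 - \<kappa> / 2)" .
      then show ?thesis using a by (simp add: powr_divide powr_diff field_simps)
    qed
    have e4: "\<bar>\<phi>' y\<bar> = a powr 2 / 4 * y powr (- 2)"
      using y a by (simp add: \<phi>'_def powr_minus field_simps)
    have e5: "exp (- \<phi> y) = exp (- (l\<^sup>2 / (4 * y)))" by (simp add: \<phi>_def)
    \<comment> \<open>Field arithmetic with all powers and exponentials abstracted to variables, so
      that simplification leaves the exponents alone.\<close>
    have gen: "(a2 / 4 * y2) * (ak * t2 * yk * E1 * (1 / (2 * sp * (b / (2 * sy))) * E2)) =
        (a2 * ak / b) * (t2 / 4) / sp * (y2 * yk * sy) * (E2 * E1)"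
      if "b \<noteq> 0" "sy \<noteq> 0" "sp \<noteq> 0" for a2 y2 ak t2 yk E1 sp b sy E2 :: real
      using that by (simp add: field_simps)
    have "\<bar>\<phi>' y\<bar> * m (\<phi> y) = (a powr 2 * a powr (\<kappa> - 2) / a) * (2 powr (2 - \<kappa>) / 4) / sqrt pi *
        (y powr (- 2) * y powr (1 - \<kappa> / 2) * sqrt y) * (exp (- y) * exp (- (l\<^sup>2 / (4 * y))))"
      unfolding m_def normal_density_def diff_0_right e1 e2 e3 e4 e5 using y a by (intro gen) auto
    also have "a powr 2 * a powr (\<kappa> - 2) / a = a powr (\<kappa> - 1)"
    proof -
      have "a powr 2 * a powr (\<kappa> - 2) = a powr \<kappa>" unfolding powr_add[symmetric] by simp
      then show ?thesis using a by (simp add: powr_diff)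
    qed
    also have "2 powr (2 - \<kappa>) / 4 = (2 :: real) powr (- \<kappa>)"
      using powr_add[of "2 :: real" 2 "- \<kappa>"] by simp
    also have "y powr (- 2) * y powr (1 - \<kappa> / 2) * sqrt y = y powr ((1 - \<kappa>) / 2 - 1)"
    proof -
      have "sqrt y = y powr (1 / 2)" using y by (simp add: powr_half_sqrt)
      moreover have "- 2 + (1 - \<kappa> / 2) + 1 / 2 = (1 - \<kappa>) / 2 - 1" by (simp add: field_simps)
      ultimately show ?thesis by (simp only: powr_add[symmetric])
    qed
    finally show ?thesis by (simp only: C_def h_def a_def mult.assoc)
  qed
  have hi: "set_integrable lborel S h" "(LBINT y:S. h y) = bessel_integral \<kappa> l"
    using bessel_integral_properties(1)[OF k, of l]
    by (simp_all add: set_integrable_def set_lebesgue_integral_def bessel_integral_def h_def S_def mult.assoc)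
  have habs: "h absolutely_integrable_on S" and hI: "integral S h = bessel_integral \<kappa> l"
  proof -
    show habs: "h absolutely_integrable_on S"
      using hi(1) unfolding set_integrable_def by (rule integrable_completion[THEN iffD2, rotated]) (use hi(1) in \<open>auto simp: set_integrable_def\<close>)
    have "(LBINT y:S. h y) = (LINT y:S|lebesgue. h y)"
      unfolding set_lebesgue_integral_def
      by (rule integral_completion[symmetric]) (use hi(1) in \<open>auto simp: set_integrable_def\<close>)
    then show "integral S h = bessel_integral \<kappa> l"
      using set_lebesgue_integral_eq_integral(2)[OF habs] hi(2) by simp
  qed
  have "(\<lambda>y. \<bar>\<phi>' y\<bar> * m (\<phi> y)) absolutely_integrable_on S \<and> integral S (\<lambda>y. \<bar>\<phi>' y\<bar> * m (\<phi> y)) = C * bessel_integral \<kappa> l"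
  proof
    have "(\<lambda>y. C * h y) absolutely_integrable_on S" using habs by simp
    then show "(\<lambda>y. \<bar>\<phi>' y\<bar> * m (\<phi> y)) absolutely_integrable_on S"
      by (rule set_integrable_cong[THEN iffD2, rotated 3]) (auto simp: sub)
    have "integral S (\<lambda>y. \<bar>\<phi>' y\<bar> * m (\<phi> y)) = integral S (\<lambda>y. C * h y)"
      by (rule integral_cong) (rule sub)
    then show "integral S (\<lambda>y. \<bar>\<phi>' y\<bar> * m (\<phi> y)) = C * bessel_integral \<kappa> l" using hI by simp
  qed
  \<comment> \<open>The change of variables is read backwards: integrability is known for the
    transformed integrand and concluded for \<open>m\<close>.\<close>
  then have "m absolutely_integrable_on \<phi> ` S \<and> integral (\<phi> ` S) m = C * bessel_integral \<kappa> l"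
  proof (rule has_absolute_integral_change_of_variables_1'[THEN iffD1, rotated 3])
    show "S \<in> sets lebesgue" by (simp add: S_def)
    show "inj_on \<phi> S"
    proof (rule inj_onI)
      fix a b assume "a \<in> S" "b \<in> S" "\<phi> a = \<phi> b"
      then show "a = b" using l by (simp add: \<phi>_def S_def frac_eq_eq)
    qed
    fix y assume "y \<in> S"
    then have "((\<lambda>y. l\<^sup>2 / 4 * inverse y) has_field_derivative l\<^sup>2 / 4 * - (inverse y ^ Suc (Suc 0))) (at y within S)"
      by (intro DERIV_cmult[OF DERIV_inverse]) (simp add: S_def)
    moreover have "(\<lambda>y. l\<^sup>2 / 4 * inverse y) = \<phi>"
      by (rule ext) (simp add: \<phi>_def inverse_eq_divide)
    moreover have "l\<^sup>2 / 4 * - (inverse y ^ Suc (Suc 0)) = \<phi>' y"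
      by (simp add: \<phi>'_def inverse_eq_divide power2_eq_square[of y])
    ultimately show "(\<phi> has_field_derivative \<phi>' y) (at y within S)" by (simp only:)
  qed
  then have m: "m absolutely_integrable_on S" "integral S m = C * bessel_integral \<kappa> l"
    unfolding im by simp_all
  have "(m has_integral C * bessel_integral \<kappa> l) S"
    using integrable_integral[OF set_lebesgue_integral_eq_integral(1)[OF m(1)]] unfolding m(2) .
  moreover have "m \<in> borel_measurable borel"
    unfolding m_def[abs_def] normal_density_def by measurable
  moreover have "0 \<le> m s" for s by (simp add: m_def normal_density_nonneg)
  ultimately have "(LBINT s:S. m s) = C * bessel_integral \<kappa> l"
    by (intro has_integral_imp_set_lborel(2)) (auto simp: S_def)
  moreover have "(LBINT s:S. m s) = (LBINT s. mix_kernel \<kappa> s l)"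
    by (simp add: set_lebesgue_integral_def mix_kernel_def m_def S_def mult.assoc)
  ultimately show ?thesis
    by (simp add: bessel_density_def C_def powr_minus_divide)
qed

lemma bessel_density_asymp:
  assumes k: "0 < \<kappa>" "\<kappa> < 1"
  shows "((\<lambda>l. bessel_density \<kappa> l * \<bar>l\<bar> powr (1 - \<kappa>)) \<longlongrightarrow> c2 \<kappa>) (at 0)"
proof -
  have "0 < Gamma (\<kappa> / 2)" by (rule Gamma_real_pos) (use k in simp)
  then have "Gamma (\<kappa> / 2) \<noteq> 0" by linarith
  then have "((\<lambda>l. bessel_integral \<kappa> l / (2 powr \<kappa> * sqrt pi * Gamma (\<kappa> / 2))) \<longlongrightarrow> c2 \<kappa>) (at 0)"
    unfolding c2_alt[OF k]
    by (intro tendsto_divide bessel_integral_properties k tendsto_const) (simp add: \<open>Gamma (\<kappa> / 2) \<noteq> 0\<close>)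
  moreover have "bessel_density \<kappa> l * \<bar>l\<bar> powr (1 - \<kappa>) = bessel_integral \<kappa> l / (2 powr \<kappa> * sqrt pi * Gamma (\<kappa> / 2))" if "l \<noteq> 0" for l
  proof -
    have "\<bar>l\<bar> powr (\<kappa> - 1) * \<bar>l\<bar> powr (1 - \<kappa>) = 1" using that by (simp add: powr_add[symmetric])
    then show ?thesis unfolding bessel_density_eq[OF k that] by (simp add: mult_ac)
  qed
  ultimately show ?thesis
    by (subst tendsto_cong[where g = "\<lambda>l. bessel_integral \<kappa> l / (2 powr \<kappa> * sqrt pi * Gamma (\<kappa> / 2))"])
      (auto simp: eventually_at_filter)
qed

lemma bessel_density_nonneg: "0 < \<kappa> \<Longrightarrow> 0 \<le> bessel_density \<kappa> l"
  unfolding bessel_density_def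
  by (intro divide_nonneg_nonneg integral_nonneg_AE AE_I2 mix_kernel_nonneg less_imp_le[OF Gamma_real_pos]) simp

text \<open>Dropping the factor \<open>exp (- (l\<^sup>2 / (4 * y)))\<close> leaves the Gamma
  integral, so the asymptotic constant is also a global bound.\<close>

lemma bessel_density_le:
  assumes k: "0 < \<kappa>" "\<kappa> < 1" and l: "l \<noteq> 0"
  shows "bessel_density \<kappa> l \<le> c2 \<kappa> * \<bar>l\<bar> powr (\<kappa> - 1)"
proof -
  let ?w = "\<lambda>y. indicator {0<..} y * (y powr ((1 - \<kappa>) / 2 - 1) * exp (- (1 * y))) :: real"
  have w: "integrable lborel ?w" "(LBINT y. ?w y) = Gamma ((1 - \<kappa>) / 2)"
    using has_bochner_integral_Gamma[of "(1 - \<kappa>) / 2" 1] k by (simp_all add: has_bochner_integral_iff)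
  have "bessel_integral \<kappa> l \<le> (LBINT y. ?w y)"
    unfolding bessel_integral_def
  proof (rule integral_mono[OF bessel_integral_properties(1)[OF k] w(1)])
    fix y :: real
    show "?w y * exp (- (l\<^sup>2 / (4 * y))) \<le> ?w y"
      by (cases "0 < y") (auto intro!: mult_left_le)
  qed
  then have b: "bessel_integral \<kappa> l \<le> Gamma ((1 - \<kappa>) / 2)" using w by simp
  have G: "0 < Gamma (\<kappa> / 2)" by (rule Gamma_real_pos) (use k in simp)
  have "bessel_density \<kappa> l = \<bar>l\<bar> powr (\<kappa> - 1) * (bessel_integral \<kappa> l / (2 powr \<kappa> * sqrt pi * Gamma (\<kappa> / 2)))"
    by (rule bessel_density_eq[OF k l])
  also have "\<dots> \<le> \<bar>l\<bar> powr (\<kappa> - 1) * c2 \<kappa>"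
    unfolding c2_alt[OF k] by (intro mult_left_mono divide_right_mono b mult_nonneg_nonneg less_imp_le[OF G]) auto
  finally show ?thesis by (simp add: mult.commute)
qed

text \<open>For \<open>\<bar>l\<bar> < \<bar>v\<bar> / 2\<close> the shifted argument stays away
  from the singularity, so the density is bounded and the positive power of
  \<open>\<bar>l\<bar>\<close> sends the product to 0.\<close>

lemma bessel_density_shift_asymp:
  assumes k: "0 < \<kappa>" "\<kappa> < 1" and v: "v \<noteq> 0" and a: "0 < a"
  shows "((\<lambda>l. bessel_density \<kappa> (l + v) * \<bar>l\<bar> powr a) \<longlongrightarrow> 0) (at 0)"
proof (rule tendsto_sandwich[OF _ _ tendsto_const])
  let ?K = "c2 \<kappa> * (\<bar>v\<bar> / 2) powr (\<kappa> - 1)"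
  have "((\<lambda>l. \<bar>l\<bar> powr a) \<longlongrightarrow> 0) (at (0 :: real))"
    by (rule tendsto_zero_powrI[OF _ tendsto_const _ a]) (auto intro!: tendsto_eq_intros)
  then show "((\<lambda>l. ?K * \<bar>l\<bar> powr a) \<longlongrightarrow> 0) (at 0)" by (rule tendsto_mult_right_zero)
  have "\<forall>\<^sub>F l in at (0 :: real). \<bar>l\<bar> < \<bar>v\<bar> / 2"
    using v by (intro eventually_at_ball'[THEN eventually_mono, of "\<bar>v\<bar> / 2" 0 UNIV]) (auto simp: dist_real_def)
  then show "\<forall>\<^sub>F l in at 0. bessel_density \<kappa> (l + v) * \<bar>l\<bar> powr a \<le> ?K * \<bar>l\<bar> powr a"
  proof eventually_elim
    case (elim l)
    then have "\<bar>v\<bar> / 2 \<le> \<bar>l + v\<bar>" using abs_triangle_ineq4[of "l + v" l] by simp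
    then have n: "\<bar>v\<bar> / 2 \<le> \<bar>l + v\<bar>" "l + v \<noteq> 0" using v by auto
    have "bessel_density \<kappa> (l + v) \<le> c2 \<kappa> * \<bar>l + v\<bar> powr (\<kappa> - 1)" by (rule bessel_density_le[OF k n(2)])
    also have "\<dots> \<le> ?K" using n v k c2_pos[OF k] by (intro mult_left_mono powr_mono2') auto
    finally show ?case by (intro mult_right_mono) auto
  qed
qed (use bessel_density_nonneg[OF k(1)] in auto)

lemma bessel_density_shift_fourier:
  assumes k: "0 < \<kappa>"
  shows "integrable lborel (\<lambda>l. bessel_density \<kappa> (l + v))"
    and "(LBINT l. iexp (x * l) * complex_of_real (bessel_density \<kappa> (l + v))) =
      iexp (- (x * v)) * complex_of_real ((1 + x\<^sup>2) powr (- (\<kappa> / 2)))"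
proof -
  show "integrable lborel (\<lambda>l. bessel_density \<kappa> (l + v))"
    using lborel_integrable_real_affine[OF bessel_density_fourier(1)[OF k], of 1 v] by (simp add: add.commute)
  have "(LBINT l. iexp (x * l) * complex_of_real (bessel_density \<kappa> (l + v))) =
      (LBINT l. iexp (x * (- v + 1 * l)) * complex_of_real (bessel_density \<kappa> (- v + 1 * l + v)))"
    by (subst lborel_integral_real_affine[of 1 _ "- v"]) simp_all
  also have "\<dots> = (LBINT l. iexp (- (x * v)) * (iexp (x * l) * complex_of_real (bessel_density \<kappa> l)))"
  proof (rule Bochner_Integration.integral_cong[OF refl])
    fix l
    have "\<i> * complex_of_real (x * (- v + 1 * l)) = \<i> * complex_of_real (- (x * v)) + \<i> * complex_of_real (x * l)"
      by (simp add: algebra_simps)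
    then have "iexp (x * (- v + 1 * l)) = iexp (- (x * v)) * iexp (x * l)"
      by (simp only: exp_add)
    then show "iexp (x * (- v + 1 * l)) * complex_of_real (bessel_density \<kappa> (- v + 1 * l + v)) =
        iexp (- (x * v)) * (iexp (x * l) * complex_of_real (bessel_density \<kappa> l))" by simp
  qed
  also have "\<dots> = iexp (- (x * v)) * (LBINT l. iexp (x * l) * complex_of_real (bessel_density \<kappa> l))"
    by (rule integral_mult_right_zero)
  finally show "(LBINT l. iexp (x * l) * complex_of_real (bessel_density \<kappa> (l + v))) =
      iexp (- (x * v)) * complex_of_real ((1 + x\<^sup>2) powr (- (\<kappa> / 2)))"
    unfolding bessel_density_fourier(2)[OF k] .
qed

text \<open>The transform determines \<open>f\<close> only up to a null set, so a limit at 0 makes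
  sense only for a chosen representative \<open>g\<close>.\<close>

lemma spectral_density_asymp:
  fixes A w \<kappa> :: "nat \<Rightarrow> real"
  assumes r: "\<And>x. r x = (\<Sum>j\<le>n. A j * cos (w j * x) / (1 + x\<^sup>2) powr (\<kappa> j / 2))"
    and w: "w 0 = 0" "\<And>j. 1 \<le> j \<Longrightarrow> j \<le> n \<Longrightarrow> 0 < w j"
    and k: "\<And>j. j \<le> n \<Longrightarrow> 0 < \<kappa> j \<and> \<kappa> j < 1"
    and f: "spectral_density r f"
  shows "\<exists>g. (AE l in lborel. f l = g l) \<and> ((\<lambda>l. g l * \<bar>l\<bar> powr (1 - \<kappa> 0)) \<longlongrightarrow> A 0 * c2 (\<kappa> 0)) (at 0)"
proof -
  \<comment> \<open>The cosine is the mean of two exponentials, each shifting the density by plus or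
    minus \<open>w j\<close>; for \<open>j = 0\<close> the two shifts coincide and restore the full
    weight \<open>A 0\<close>.\<close>
  define g where "g l = (\<Sum>j\<le>n. A j / 2 * (bessel_density (\<kappa> j) (l + w j) + bessel_density (\<kappa> j) (l + - w j)))" for l
  have fi: "integrable lborel f"
    and fF: "\<And>x. complex_of_real (r x) = (LBINT l. iexp (x * l) * complex_of_real (f l))"
    using f by (auto simp: spectral_density_def)
  have bi: "integrable lborel (\<lambda>l. bessel_density (\<kappa> j) (l + v))" if "j \<le> n" for j v
    using bessel_density_shift_fourier(1) k[OF that] by blast
  have gi: "integrable lborel g" unfolding g_def by (intro Bochner_Integration.integrable_sum integrable_mult_right Bochner_Integration.integrable_add bi) auto
  have gF: "(LBINT l. iexp (x * l) * complex_of_real (g l)) = complex_of_real (r x)" for x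
  proof -
    let ?e = "\<lambda>j v l. iexp (x * l) * complex_of_real (bessel_density (\<kappa> j) (l + v))"
    have "(LBINT l. iexp (x * l) * complex_of_real (g l)) =
        (LBINT l. (\<Sum>j\<le>n. complex_of_real (A j / 2) * (?e j (w j) l + ?e j (- w j) l)))"
      unfolding g_def of_real_sum sum_distrib_left of_real_mult of_real_add distrib_left
      by (simp only: mult_ac)
    also have "\<dots> = (\<Sum>j\<le>n. complex_of_real (A j / 2) * ((LBINT l. ?e j (w j) l) + (LBINT l. ?e j (- w j) l)))"
    proof (subst Bochner_Integration.integral_sum)
      fix j assume "j \<in> {..n}"
      then have j: "integrable lborel (?e j v)" for v by (intro integrable_iexp_mult bi) simp
      then show "integrable lborel (\<lambda>l. complex_of_real (A j / 2) * (?e j (w j) l + ?e j (- w j) l))"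
        by (intro integrable_mult_right Bochner_Integration.integrable_add)
    next
      have "(LBINT l. complex_of_real (A j / 2) * (?e j (w j) l + ?e j (- w j) l)) =
          complex_of_real (A j / 2) * ((LBINT l. ?e j (w j) l) + (LBINT l. ?e j (- w j) l))" if "j \<le> n" for j
        unfolding integral_mult_right_zero
        by (subst Bochner_Integration.integral_add[OF integrable_iexp_mult[OF bi[OF that]] integrable_iexp_mult[OF bi[OF that]]]) (rule refl)
      then show "(\<Sum>j\<le>n. \<integral>l. complex_of_real (A j / 2) * (?e j (w j) l + ?e j (- w j) l) \<partial>lborel) =
          (\<Sum>j\<le>n. complex_of_real (A j / 2) * ((LBINT l. ?e j (w j) l) + (LBINT l. ?e j (- w j) l)))"
        by (intro sum.cong) auto
    qed
    also have "\<dots> = (\<Sum>j\<le>n. complex_of_real (A j * cos (w j * x) / (1 + x\<^sup>2) powr (\<kappa> j / 2)))"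
    proof (rule sum.cong[OF refl])
      fix j assume "j \<in> {..n}"
      then have kj: "0 < \<kappa> j" using k by auto
      have c: "iexp (- (x * w j)) + iexp (- (x * - w j)) = complex_of_real (2 * cos (w j * x))"
        by (simp add: complex_eq_iff Re_exp Im_exp mult.commute)
      have "complex_of_real (A j / 2) * ((LBINT l. ?e j (w j) l) + (LBINT l. ?e j (- w j) l)) =
          complex_of_real (A j / 2) * ((iexp (- (x * w j)) + iexp (- (x * - w j))) * complex_of_real ((1 + x\<^sup>2) powr (- (\<kappa> j / 2))))"
        unfolding bessel_density_shift_fourier(2)[OF kj] distrib_right ..
      also have "\<dots> = complex_of_real (A j / 2 * (2 * cos (w j * x) * (1 + x\<^sup>2) powr (- (\<kappa> j / 2))))"
        unfolding c of_real_mult ..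
      also have "A j / 2 * (2 * cos (w j * x) * (1 + x\<^sup>2) powr (- (\<kappa> j / 2))) = A j * cos (w j * x) / (1 + x\<^sup>2) powr (\<kappa> j / 2)"
        by (simp add: powr_minus_divide)
      finally show "complex_of_real (A j / 2) * ((LBINT l. ?e j (w j) l) + (LBINT l. ?e j (- w j) l)) =
          complex_of_real (A j * cos (w j * x) / (1 + x\<^sup>2) powr (\<kappa> j / 2))" .
    qed
    finally show ?thesis unfolding r of_real_sum .
  qed
  have "AE l in lborel. f l - g l = 0"
  proof (rule fourier_eq_0_imp_AE_eq_0)
    show "integrable lborel (\<lambda>l. f l - g l)" using fi gi by simp
    fix x
    have "(LBINT l. iexp (x * l) * complex_of_real (f l - g l)) =
        (LBINT l. (iexp (x * l) * complex_of_real (f l) - iexp (x * l) * complex_of_real (g l)))"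
      by (simp add: right_diff_distrib)
    also have "\<dots> = 0"
      unfolding Bochner_Integration.integral_diff[OF integrable_iexp_mult[OF fi] integrable_iexp_mult[OF gi]] fF[symmetric] gF by simp
    finally show "(LBINT l. iexp (x * l) * complex_of_real (f l - g l)) = 0" .
  qed
  then have "AE l in lborel. f l = g l" by eventually_elim simp
  moreover have "((\<lambda>l. g l * \<bar>l\<bar> powr (1 - \<kappa> 0)) \<longlongrightarrow> A 0 * c2 (\<kappa> 0)) (at 0)"
  proof -
    let ?b = "\<lambda>j v l. bessel_density (\<kappa> j) (l + v) * \<bar>l\<bar> powr (1 - \<kappa> 0)"
    have "((\<lambda>l. A j / 2 * (?b j (w j) l + ?b j (- w j) l)) \<longlongrightarrow> (if j = 0 then A 0 * c2 (\<kappa> 0) else 0)) (at 0)"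
      if "j \<le> n" for j
    proof (cases "j = 0")
      case True
      have "((\<lambda>l. A 0 / 2 * (?b 0 0 l + ?b 0 0 l)) \<longlongrightarrow> A 0 / 2 * (c2 (\<kappa> 0) + c2 (\<kappa> 0))) (at 0)"
        using bessel_density_asymp[of "\<kappa> 0"] k[of 0] by (intro tendsto_intros) simp_all
      then show ?thesis using True w(1) by simp
    next
      case False
      have "((\<lambda>l. A j / 2 * (?b j (w j) l + ?b j (- w j) l)) \<longlongrightarrow> A j / 2 * (0 + 0)) (at 0)"
        using w(2)[of j] False that k[of j] k[of 0] by (intro tendsto_intros bessel_density_shift_asymp) auto
      then show ?thesis using False by simp
    qed
    then have "((\<lambda>l. \<Sum>j\<le>n. A j / 2 * (?b j (w j) l + ?b j (- w j) l)) \<longlongrightarrow> (\<Sum>j\<le>n. if j = 0 then A 0 * c2 (\<kappa> 0) else 0)) (at 0)"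
      by (intro tendsto_sum) simp
    moreover have "(\<Sum>j\<le>n. A j / 2 * (?b j (w j) l + ?b j (- w j) l)) = g l * \<bar>l\<bar> powr (1 - \<kappa> 0)" for l
      by (simp add: g_def sum_distrib_right distrib_right mult.assoc)
    ultimately show ?thesis by (simp add: sum.delta)
  qed
  ultimately show ?thesis by blast
qed

section \<open>The scaling limit\<close>

lemma integral_even:
  fixes h :: "real \<Rightarrow> real"
  assumes h: "integrable lborel h" and even: "\<And>l. h (- l) = h l"
  shows "(LBINT l. h l) = 2 * (LBINT l:{0<..}. h l)"
proof -
  let ?p = "\<lambda>l. indicator {0<..} l *\<^sub>R h l"
  have p: "integrable lborel ?p" using integrable_mult_indicator[OF _ h, of "{0<..}"] by simp
  have p': "integrable lborel (\<lambda>l. ?p (- l))" using integrable_lborel_uminus_iff[of ?p] p by simp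
  have "(LBINT l. h l) = (LBINT l. (?p l + ?p (- l)))"
  proof (rule integral_cong_AE)
    show "AE l in lborel. h l = ?p l + ?p (- l)"
      using AE_lborel_singleton[of 0] by eventually_elim (auto simp: indicator_def even)
  qed (use h Bochner_Integration.integrable_add[OF p p'] in \<open>auto dest: borel_measurable_integrable\<close>)
  also have "\<dots> = (LBINT l. ?p l) + (LBINT l. ?p (- l))"
    by (rule Bochner_Integration.integral_add[OF p p'])
  also have "(LBINT l. ?p (- l)) = (LBINT l. ?p l)" by (rule integral_lborel_uminus)
  finally show ?thesis by (simp add: set_lebesgue_integral_def)
qed

text \<open>Dilations preserve null sets; this moves the identification \<open>f = g\<close> to the
  rescaled frequencies.\<close>

lemma AE_lborel_scale:
  assumes "AE l in lborel. P l" and h: "h \<noteq> (0 :: real)"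
  shows "AE v in lborel. P (h * v)"
proof -
  obtain N where N: "{l. \<not> P l} \<subseteq> N" "N \<in> null_sets lborel"
    using assms(1) by (auto simp: eventually_ae_filter)
  then have [measurable]: "N \<in> sets borel" by auto
  have "(\<integral>\<^sup>+l. indicator N l \<partial>lborel) = ennreal \<bar>h\<bar> * (\<integral>\<^sup>+v. indicator N (0 + h * v) \<partial>lborel)"
    by (rule nn_integral_real_affine[OF _ h]) measurable
  moreover have "(\<integral>\<^sup>+l. indicator N l \<partial>lborel) = 0" using N by auto
  ultimately have "(\<integral>\<^sup>+v. indicator N (h * v) \<partial>lborel) = 0" using h by simp
  then have "AE v in lborel. (indicator N (h * v) :: ennreal) = 0"
    by (subst (asm) nn_integral_0_iff_AE) measurable
  then show ?thesis by eventually_elim (use N in \<open>auto simp: indicator_def split: if_splits\<close>)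
qed

text \<open>Positivity of \<kappa> gives integrability at 0. At infinity the exponent is \<kappa> -
  1 - 2 * \<alpha>, which is below -1 exactly when \<alpha> > \<kappa> / 2.\<close>

lemma integrable_spectral_bound:
  assumes k: "0 < \<kappa>" "\<kappa> < 1" and a: "\<kappa> / 2 < \<alpha>"
  shows "integrable lborel (\<lambda>l :: real. \<bar>l\<bar> powr (\<kappa> - 1) / (1 + \<bar>l\<bar> powr \<alpha>)\<^sup>2)"
proof -
  let ?p = "\<lambda>l :: real. indicator {0<..} l * (l powr (\<kappa> - 1) / (1 + l powr \<alpha>)\<^sup>2)"
  let ?b = "\<lambda>l :: real. indicator {0..1} l *\<^sub>R l powr (\<kappa> - 1) + indicator {1..} l *\<^sub>R l powr (\<kappa> - 1 - 2 * \<alpha>)"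
  have "(\<lambda>x. x powr (\<kappa> - 1)) integrable_on {0..1}"
    by (rule integrable_on_powr_from_0) (use k in auto)
  from has_integral_imp_set_lborel(1)[OF integrable_integral[OF this]]
  have i1: "integrable lborel (\<lambda>l :: real. indicator {0..1} l *\<^sub>R l powr (\<kappa> - 1))"
    by (simp add: set_integrable_def)
  have i2: "integrable lborel (\<lambda>l :: real. indicator {1..} l *\<^sub>R l powr (\<kappa> - 1 - 2 * \<alpha>))"
    using has_integral_imp_set_lborel(1)[OF has_integral_powr_to_inf[of "\<kappa> - 1 - 2 * \<alpha>" 1]] a
    by (simp add: set_integrable_def)
  have p: "integrable lborel ?p"
  proof (rule Bochner_Integration.integrable_bound[OF Bochner_Integration.integrable_add[OF i1 i2]])
    have "?p l \<le> ?b l" for l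
    proof (cases "0 < l")
      case True
      have "1 \<le> (1 + l powr \<alpha>)\<^sup>2" by (simp add: one_le_power)
      then have "?p l \<le> l powr (\<kappa> - 1)" using True by (simp add: divide_le_eq mult_le_cancel_left1)
      moreover have "?p l \<le> l powr (\<kappa> - 1 - 2 * \<alpha>)"
      proof -
        have "(l powr \<alpha>)\<^sup>2 \<le> (1 + l powr \<alpha>)\<^sup>2" by (intro power_mono) auto
        moreover have "(l powr \<alpha>)\<^sup>2 = l powr (2 * \<alpha>)" using True by (simp add: power2_eq_square powr_add[symmetric])
        ultimately have "l powr (\<kappa> - 1) / (1 + l powr \<alpha>)\<^sup>2 \<le> l powr (\<kappa> - 1) / l powr (2 * \<alpha>)"
          using True by (intro divide_left_mono mult_pos_pos zero_less_power add_pos_nonneg) auto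
        then show ?thesis using True by (simp add: powr_diff)
      qed
      ultimately show ?thesis using True by (cases "l \<le> 1") (auto intro: add_increasing2)
    qed auto
    moreover have "0 \<le> ?p l" for l by simp
    moreover have "0 \<le> ?b l" for l by simp
    ultimately show "AE l in lborel. norm (?p l) \<le> norm (?b l)"
      by (intro AE_I2) (simp only: real_norm_def abs_of_nonneg)
  qed measurable
  have p': "integrable lborel (\<lambda>l. ?p (- l))" using integrable_lborel_uminus_iff[of ?p] p by simp
  have "?p l + ?p (- l) = \<bar>l\<bar> powr (\<kappa> - 1) / (1 + \<bar>l\<bar> powr \<alpha>)\<^sup>2" for l
    by (cases l "0 :: real" rule: linorder_cases) auto
  then show ?thesis using Bochner_Integration.integrable_add[OF p p'] by simp
qed

text \<open>
  Only the behaviour of the spectral density at the origin survives the rescaling \<open>l = h * v\<close>: on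
  \<open>\<bar>l\<bar> < \<delta>\<close> dominated convergence applies, and the part on \<open>\<bar>l\<bar> \<ge> \<delta>\<close> is of order \<open>h powr (2 * \<alpha> - \<kappa>)\<close>.
\<close>

lemma scaled_integral_limit:
  fixes q :: "real \<Rightarrow> real \<Rightarrow> real" and q0 f g :: "real \<Rightarrow> real"
  assumes k: "0 < \<kappa>" "\<kappa> < 1" and a: "\<kappa> / 2 < \<alpha>"
    and q: "\<And>h v. 0 < h \<Longrightarrow> 0 \<le> q h v" "\<And>h v. 0 < h \<Longrightarrow> q h v \<le> K / (1 + \<bar>v\<bar> powr \<alpha>)\<^sup>2"
    and qm: "\<And>h. q h \<in> borel_measurable borel" "q0 \<in> borel_measurable borel"
    and lim: "\<And>v. ((\<lambda>h. q h v) \<longlongrightarrow> q0 v) (at_right 0)"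
    and f: "integrable lborel f" "\<And>l. 0 \<le> f l" "AE l in lborel. f l = g l"
    and g: "((\<lambda>l. g l * \<bar>l\<bar> powr (1 - \<kappa>)) \<longlongrightarrow> L) (at 0)"
  shows "((\<lambda>h. h powr (- \<kappa>) * (LBINT l. q h (l / h) * f l)) \<longlongrightarrow>
    L * (LBINT v. q0 v * \<bar>v\<bar> powr (\<kappa> - 1))) (at_right 0)"
  \<comment> \<open>With a sequence of scales, dominated convergence applies and the null sets where
    \<open>f\<close> and \<open>g\<close> differ after scaling have a null union.\<close>
  unfolding tendsto_at_iff_sequentially comp_def
proof (intro allI impI)
  fix X :: "nat \<Rightarrow> real" assume "\<forall>i. X i \<in> {0<..} - {0}" and X0: "X \<longlonglongrightarrow> 0"
  then have Xp: "0 < X i" for i by simp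
  have Xn: "X i \<noteq> 0" for i using Xp[of i] by simp
  note [measurable] = qm borel_measurable_integrable[OF f(1)]
  have Kn: "0 \<le> K" using order_trans[OF q(1)[of 1 0] q(2)[of 1 0]] by (simp add: zero_le_divide_iff)
  \<comment> \<open>Fixes the window \<open>\<bar>l\<bar> < d\<close> in which the normalised
    density is at most \<open>\<bar>L\<bar> + 1\<close>, the constant of the later majorant.\<close>
  have "\<forall>\<^sub>F l in at 0. \<bar>g l * \<bar>l\<bar> powr (1 - \<kappa>) - L\<bar> < 1"
    using tendstoD[OF g, of 1] by (simp add: dist_real_def)
  then obtain d where d: "0 < d" and gd: "\<And>l. l \<noteq> 0 \<Longrightarrow> \<bar>l\<bar> < d \<Longrightarrow> \<bar>g l * \<bar>l\<bar> powr (1 - \<kappa>) - L\<bar> < 1"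
    unfolding eventually_at by (auto simp: dist_real_def)
  define I where "I l = (indicator {- d<..<d} l :: real)" for l
  have I1: "I l = 1" if "\<bar>l\<bar> < d" for l using that by (auto simp: I_def indicator_def)
  have I0: "I l = 0" if "\<not> \<bar>l\<bar> < d" for l using that by (auto simp: I_def indicator_def)
  have [measurable]: "I \<in> borel_measurable borel" unfolding I_def by measurable
  let ?q = "\<lambda>i l. q (X i) (l / X i) * f l"
  have qb: "q (X i) v \<le> K" for i v
  proof -
    have "K / (1 + \<bar>v\<bar> powr \<alpha>)\<^sup>2 \<le> K / 1" using Kn by (intro divide_left_mono mult_pos_pos zero_less_power add_pos_nonneg one_le_power) auto
    then show ?thesis using q(2)[OF Xp[of i], of v] by simp
  qed
  have int1: "integrable lborel (\<lambda>l. J l * ?q i l)" if [measurable]: "J \<in> borel_measurable borel" and J: "\<And>l. 0 \<le> J l \<and> J l \<le> 1" for J i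
  proof (rule Bochner_Integration.integrable_bound)
    show "integrable lborel (\<lambda>l. K * f l)" using f(1) by simp
    have "J l * ?q i l \<le> 1 * (K * f l)" for l
      using J[of l] qb[of i "l / X i"] q(1)[OF Xp[of i]] f(2)[of l] Kn by (intro mult_mono) auto
    then show "AE l in lborel. norm (J l * ?q i l) \<le> norm (K * f l)"
      using J q(1)[OF Xp[of i]] f(2) Kn by (intro AE_I2) (simp add: abs_mult)
  qed measurable
  have split: "X i powr (- \<kappa>) * (LBINT l. ?q i l) =
      X i powr (- \<kappa>) * (LBINT l. I l * ?q i l) + X i powr (- \<kappa>) * (LBINT l. (1 - I l) * ?q i l)" for i
  proof -
    have "(LBINT l. ?q i l) = (LBINT l. (I l * ?q i l + (1 - I l) * ?q i l))"
      by (intro Bochner_Integration.integral_cong) (auto simp: algebra_simps)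
    also have "\<dots> = (LBINT l. I l * ?q i l) + (LBINT l. (1 - I l) * ?q i l)"
      by (intro Bochner_Integration.integral_add int1) (auto simp: I_def indicator_def)
    finally show ?thesis by (simp add: distrib_left)
  qed
  let ?D = "\<lambda>v :: real. \<bar>v\<bar> powr (\<kappa> - 1) / (1 + \<bar>v\<bar> powr \<alpha>)\<^sup>2"
  \<comment> \<open>The integrand after \<open>l = X i * v\<close>; the Jacobian raises
    \<open>X i powr (- \<kappa>)\<close> to \<open>X i powr (1 - \<kappa>)\<close>, which matches
    the singularity of \<open>f\<close>.\<close>
  define T where "T i v = I (X i * v) * (q (X i) v * (X i powr (1 - \<kappa>) * f (X i * v)))" for i v
  have [measurable]: "T i \<in> borel_measurable borel" for i unfolding T_def by measurable
  have inner: "X i powr (- \<kappa>) * (LBINT l. I l * ?q i l) = (LBINT v. T i v)" for i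
  proof -
    have "(LBINT l. I l * ?q i l) = \<bar>X i\<bar> *\<^sub>R (LBINT v. I (0 + X i * v) * ?q i (0 + X i * v))"
      by (rule lborel_integral_real_affine) (use Xp[of i] in simp)
    also have "\<dots> = X i * (LBINT v. I (X i * v) * (q (X i) v * f (X i * v)))"
      using Xp[of i] by simp
    finally have "X i powr (- \<kappa>) * (LBINT l. I l * ?q i l) =
        (X i powr (- \<kappa>) * X i) * (LBINT v. I (X i * v) * (q (X i) v * f (X i * v)))" by simp
    also have "X i powr (- \<kappa>) * X i = X i powr (1 - \<kappa>)"
      using Xp[of i] powr_add[of "X i" "- \<kappa>" 1] by simp
    also have "X i powr (1 - \<kappa>) * (LBINT v. I (X i * v) * (q (X i) v * f (X i * v))) = (LBINT v. T i v)"
      unfolding integral_mult_right_zero[symmetric] T_def by (simp only: mult_ac)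
    finally show ?thesis .
  qed
  have fg: "AE v in lborel. v \<noteq> 0 \<and> (\<forall>i. f (X i * v) = g (X i * v))"
  proof -
    have "AE v in lborel. \<forall>i. f (X i * v) = g (X i * v)"
      unfolding AE_all_countable by (intro allI AE_lborel_scale f(3)) (use Xp in \<open>simp add: less_imp_neq[symmetric]\<close>)
    then show ?thesis using AE_lborel_singleton[of 0] by eventually_elim simp
  qed
  have sc: "X i powr (1 - \<kappa>) * g (X i * v) = \<bar>v\<bar> powr (\<kappa> - 1) * (g (X i * v) * \<bar>X i * v\<bar> powr (1 - \<kappa>))" if "v \<noteq> 0" for i v
  proof -
    have "\<bar>X i * v\<bar> powr (1 - \<kappa>) = X i powr (1 - \<kappa>) * \<bar>v\<bar> powr (1 - \<kappa>)"
      using Xp[of i] by (simp add: abs_mult powr_mult)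
    moreover have "\<bar>v\<bar> powr (\<kappa> - 1) * \<bar>v\<bar> powr (1 - \<kappa>) = 1"
      unfolding powr_add[symmetric] using that by simp
    moreover have "\<bar>v\<bar> powr (\<kappa> - 1) * (g (X i * v) * (X i powr (1 - \<kappa>) * \<bar>v\<bar> powr (1 - \<kappa>))) =
        (\<bar>v\<bar> powr (\<kappa> - 1) * \<bar>v\<bar> powr (1 - \<kappa>)) * (X i powr (1 - \<kappa>) * g (X i * v))"
      by (simp only: mult_ac)
    ultimately show ?thesis by simp
  qed
  have "(\<lambda>i. \<integral>v. T i v \<partial>lborel) \<longlonglongrightarrow> (LBINT v. L * (q0 v * \<bar>v\<bar> powr (\<kappa> - 1)))"
  proof (rule integral_dominated_convergence[where w = "\<lambda>v. (\<bar>L\<bar> + 1) * K * ?D v"])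
    show "integrable lborel (\<lambda>v. (\<bar>L\<bar> + 1) * K * ?D v)"
      using integrable_spectral_bound[OF k a] by (rule integrable_mult_right)
    show "AE v in lborel. norm (T i v) \<le> (\<bar>L\<bar> + 1) * K * ?D v" for i
      using fg
    proof eventually_elim
      case (elim v)
      show ?case
      proof (cases "\<bar>X i * v\<bar> < d")
        case True
        have v: "X i * v \<noteq> 0" using elim Xp[of i] by auto
        have "norm (T i v) \<le> \<bar>q (X i) v\<bar> * \<bar>X i powr (1 - \<kappa>) * g (X i * v)\<bar>"
          using elim by (auto simp: T_def I_def abs_mult indicator_def)
        also have "\<bar>X i powr (1 - \<kappa>) * g (X i * v)\<bar> = \<bar>v\<bar> powr (\<kappa> - 1) * \<bar>g (X i * v) * \<bar>X i * v\<bar> powr (1 - \<kappa>)\<bar>"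
          using sc[of v i] elim by (simp only: abs_mult) simp
        also have "\<bar>q (X i) v\<bar> * (\<bar>v\<bar> powr (\<kappa> - 1) * \<bar>g (X i * v) * \<bar>X i * v\<bar> powr (1 - \<kappa>)\<bar>) \<le>
            K / (1 + \<bar>v\<bar> powr \<alpha>)\<^sup>2 * (\<bar>v\<bar> powr (\<kappa> - 1) * (\<bar>L\<bar> + 1))"
          using q(1,2)[OF Xp[of i], of v] gd[OF v True] Kn
          by (intro mult_mono mult_left_mono mult_nonneg_nonneg divide_nonneg_nonneg) auto
        finally show ?thesis by (simp add: mult_ac)
      next
        case False
        then have "T i v = 0" using I0 by (simp add: T_def)
        then show ?thesis using Kn by simp
      qed
    qed
    show "AE v in lborel. (\<lambda>i. T i v) \<longlonglongrightarrow> L * (q0 v * \<bar>v\<bar> powr (\<kappa> - 1))"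
      using fg
    proof eventually_elim
      case (elim v)
      have Xr: "filterlim X (at_right 0) sequentially"
        using X0 Xp Xn by (simp add: filterlim_at)
      have Xv: "(\<lambda>i. X i * v) \<longlonglongrightarrow> 0" using tendsto_mult_left_zero[OF X0] .
      have Xa: "filterlim (\<lambda>i. X i * v) (at 0) sequentially"
        using Xv elim Xn by (auto simp: filterlim_at)
      have q': "(\<lambda>i. q (X i) v) \<longlonglongrightarrow> q0 v" by (rule filterlim_compose[OF lim Xr])
      have g': "(\<lambda>i. g (X i * v) * \<bar>X i * v\<bar> powr (1 - \<kappa>)) \<longlonglongrightarrow> L" by (rule filterlim_compose[OF g Xa])
      have "(\<lambda>i. q (X i) v * (\<bar>v\<bar> powr (\<kappa> - 1) * (g (X i * v) * \<bar>X i * v\<bar> powr (1 - \<kappa>)))) \<longlonglongrightarrow>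
          q0 v * (\<bar>v\<bar> powr (\<kappa> - 1) * L)"
        by (intro tendsto_intros q' g')
      \<comment> \<open>For fixed \<open>v\<close> the point \<open>X i * v\<close> eventually lies
        in the window, so the cutoff disappears.\<close>
      moreover have "\<forall>\<^sub>F i in sequentially. T i v = q (X i) v * (\<bar>v\<bar> powr (\<kappa> - 1) * (g (X i * v) * \<bar>X i * v\<bar> powr (1 - \<kappa>)))"
      proof -
        have "\<forall>\<^sub>F i in sequentially. \<bar>X i * v\<bar> < d" using tendstoD[OF Xv d] by (simp add: dist_real_def)
        then show ?thesis
        proof (rule eventually_mono)
          fix i assume "\<bar>X i * v\<bar> < d"
          then have "T i v = q (X i) v * (X i powr (1 - \<kappa>) * g (X i * v))" using elim by (simp add: T_def I1)
          then show "T i v = q (X i) v * (\<bar>v\<bar> powr (\<kappa> - 1) * (g (X i * v) * \<bar>X i * v\<bar> powr (1 - \<kappa>)))"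
            using sc[of v i] elim by simp
        qed
      qed
      ultimately have "(\<lambda>i. T i v) \<longlonglongrightarrow> q0 v * (\<bar>v\<bar> powr (\<kappa> - 1) * L)"
        by (simp add: tendsto_cong)
      then show ?case by (simp add: mult_ac)
    qed
  qed measurable
  then have lim_inner: "(\<lambda>i. X i powr (- \<kappa>) * (LBINT l. I l * ?q i l)) \<longlonglongrightarrow> L * (LBINT v. q0 v * \<bar>v\<bar> powr (\<kappa> - 1))"
    unfolding inner by simp
  have lim_outer: "(\<lambda>i. X i powr (- \<kappa>) * (LBINT l. (1 - I l) * ?q i l)) \<longlonglongrightarrow> 0"
  proof (rule tendsto_sandwich[OF _ _ tendsto_const])
    let ?R = "K / d powr (2 * \<alpha>) * (LBINT l. f l)"
    have "(\<lambda>i. X i powr (2 * \<alpha> - \<kappa>)) \<longlonglongrightarrow> 0"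
      by (rule tendsto_zero_powrI[OF X0 tendsto_const]) (use a Xp in \<open>auto intro: less_imp_le always_eventually\<close>)
    then show "(\<lambda>i. X i powr (2 * \<alpha> - \<kappa>) * ?R) \<longlonglongrightarrow> 0" by (rule tendsto_mult_left_zero)
    have nn: "0 \<le> (1 - I l) * ?q i l" for i l
      using q(1)[OF Xp[of i]] f(2)[of l] by (intro mult_nonneg_nonneg) (auto simp: I_def indicator_def)
    show "\<forall>\<^sub>F i in sequentially. 0 \<le> X i powr (- \<kappa>) * (LBINT l. (1 - I l) * ?q i l)"
      by (intro always_eventually allI mult_nonneg_nonneg[OF powr_ge_zero] integral_nonneg_AE AE_I2 nn)
    have "X i powr (- \<kappa>) * (LBINT l. (1 - I l) * ?q i l) \<le> X i powr (2 * \<alpha> - \<kappa>) * ?R" for i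
    proof -
      \<comment> \<open>The decay bound on \<open>q\<close> at
        \<open>\<bar>l / X i\<bar> \<ge> d / X i\<close>. Outside the window integrability of
        \<open>f\<close> is enough.\<close>
      let ?c = "K * X i powr (2 * \<alpha>) / d powr (2 * \<alpha>)"
      have "(LBINT l. (1 - I l) * ?q i l) \<le> (LBINT l. ?c * f l)"
      proof (rule integral_mono)
        show "integrable lborel (\<lambda>l. (1 - I l) * ?q i l)" by (intro int1) (auto simp: I_def indicator_def)
        show "integrable lborel (\<lambda>l. ?c * f l)" using f(1) by simp
        fix l
        show "(1 - I l) * ?q i l \<le> ?c * f l"
        proof (cases "\<bar>l\<bar> < d")
          case True
          then have "I l = 1" by (rule I1)
          then show ?thesis using Kn f(2)[of l] by simp
        next
          case False
          then have Il: "I l = 0" by (rule I0)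
          have "d / X i \<le> \<bar>l / X i\<bar>" using False Xp[of i] by (simp add: abs_divide divide_right_mono)
          then have "(d / X i) powr \<alpha> \<le> 1 + \<bar>l / X i\<bar> powr \<alpha>"
            using powr_mono2[of \<alpha> "d / X i" "\<bar>l / X i\<bar>"] k a d Xp[of i] by simp
          then have "((d / X i) powr \<alpha>)\<^sup>2 \<le> (1 + \<bar>l / X i\<bar> powr \<alpha>)\<^sup>2" by (intro power_mono) auto
          moreover have "((d / X i) powr \<alpha>)\<^sup>2 = d powr (2 * \<alpha>) / X i powr (2 * \<alpha>)"
            using d Xp[of i] by (simp add: powr_divide power2_eq_square powr_add[symmetric])
          moreover have "0 < d powr (2 * \<alpha>) / X i powr (2 * \<alpha>)" using d Xp[of i] by simp
          ultimately have "K / (1 + \<bar>l / X i\<bar> powr \<alpha>)\<^sup>2 \<le> K / (d powr (2 * \<alpha>) / X i powr (2 * \<alpha>))"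
            using Kn by (intro divide_left_mono mult_pos_pos zero_less_power add_pos_nonneg) auto
          then have "q (X i) (l / X i) \<le> ?c"
            using q(2)[OF Xp[of i], of "l / X i"] by simp
          from mult_right_mono[OF this f(2)[of l]] show ?thesis using Il by simp
        qed
      qed
      then have "X i powr (- \<kappa>) * (LBINT l. (1 - I l) * ?q i l) \<le> X i powr (- \<kappa>) * (LBINT l. ?c * f l)"
        by (intro mult_left_mono) auto
      also have "\<dots> = (X i powr (- \<kappa>) * X i powr (2 * \<alpha>)) * ?R"
        by simp
      also have "X i powr (- \<kappa>) * X i powr (2 * \<alpha>) = X i powr (2 * \<alpha> - \<kappa>)"
        by (simp add: powr_add[symmetric])
      finally show ?thesis .
    qed
    then show "\<forall>\<^sub>F i in sequentially. X i powr (- \<kappa>) * (LBINT l. (1 - I l) * ?q i l) \<le> X i powr (2 * \<alpha> - \<kappa>) * ?R"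
      by (intro always_eventually allI)
  qed
  show "(\<lambda>i. X i powr (- \<kappa>) * (LBINT l. ?q i l)) \<longlonglongrightarrow> L * (LBINT v. q0 v * \<bar>v\<bar> powr (\<kappa> - 1))"
    unfolding split using tendsto_add[OF lim_inner lim_outer] by simp
qed

text \<open>A negative limit would make \<open>g\<close> negative on an interval, a set of positive
  measure on which \<open>f = g\<close> fails. The conclusion makes
  \<open>sqrt (c2 (\<kappa> 0) * A 0)\<close> a genuine square root, where the hypotheses only give
  \<open>A 0 \<noteq> 0\<close>.\<close>

lemma limit_at_0_nonneg:
  fixes f g :: "real \<Rightarrow> real"
  assumes f: "\<And>l. 0 \<le> f l" "AE l in lborel. f l = g l"
    and g: "((\<lambda>l. g l * \<bar>l\<bar> powr a) \<longlongrightarrow> L) (at 0)"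
  shows "0 \<le> L"
proof (rule ccontr)
  assume "\<not> 0 \<le> L"
  then have "\<forall>\<^sub>F l in at 0. g l * \<bar>l\<bar> powr a < 0" by (intro order_tendstoD(2)[OF g]) simp
  then obtain d where d: "0 < d" and gd: "\<And>l. l \<noteq> 0 \<Longrightarrow> \<bar>l\<bar> < d \<Longrightarrow> g l * \<bar>l\<bar> powr a < 0"
    unfolding eventually_at by (auto simp: dist_real_def)
  have "AE l in lborel. l \<notin> {0<..<d}"
    using f(2)
  proof eventually_elim
    case (elim l)
    show ?case
    proof
      assume l: "l \<in> {0<..<d}"
      then have "g l * \<bar>l\<bar> powr a < 0" by (intro gd) auto
      moreover have "0 \<le> g l * \<bar>l\<bar> powr a" using elim f(1)[of l] by simp
      ultimately show False by simp
    qed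
  qed
  then have "emeasure lborel {0<..<d} = 0"
    by (subst (asm) AE_iff_null_sets[symmetric]) auto
  then show False using d by simp
qed

context prob_space
begin

text \<open>The characteristic function at 1 is real, so the sine term of the addition formula has
  expectation 0.\<close>

lemma gaussian_rv_expectation_cos:
  assumes X: "gaussian_rv M X" "expectation X = 0"
  shows "expectation (\<lambda>w. cos (X w + b)) = cos b * exp (- expectation (\<lambda>w. (X w)\<^sup>2) / 2)"
proof -
  have [measurable]: "X \<in> borel_measurable M" using X by (simp add: gaussian_rv_def)
  have i: "integrable M (\<lambda>w. iexp (X w))"
    by (rule integrable_const_bound[of _ 1]) auto
  have E: "expectation (\<lambda>w. iexp (X w)) = complex_of_real (exp (- expectation (\<lambda>w. (X w)\<^sup>2) / 2))"
    using gaussian_rv_char[OF X, of 1] by (simp add: char_def integral_distr)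
  have c: "expectation (\<lambda>w. cos (X w)) = exp (- expectation (\<lambda>w. (X w)\<^sup>2) / 2)"
    using integral_Re[OF i] unfolding E by (simp add: Re_exp)
  have s: "expectation (\<lambda>w. sin (X w)) = 0"
    using integral_Im[OF i] unfolding E by (simp add: Im_exp)
  have "expectation (\<lambda>w. cos (X w + b)) = expectation (\<lambda>w. cos b * cos (X w) - sin b * sin (X w))"
    by (simp add: cos_add mult.commute)
  also have "\<dots> = cos b * expectation (\<lambda>w. cos (X w)) - sin b * expectation (\<lambda>w. sin (X w))"
  proof -
    have "integrable M (\<lambda>w. cos (X w))" "integrable M (\<lambda>w. sin (X w))"
      by (rule integrable_const_bound[of _ 1]; auto)+
    then show ?thesis by simp
  qed
  finally show ?thesis by (simp add: c s)
qed

end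

context white_noise
begin

lemma has_real_stoch_integral_sum:
  assumes "\<And>i. i \<in> J \<Longrightarrow> has_stoch_integral M W (g i) (\<lambda>w. of_real (X i w))"
  shows "has_stoch_integral M W (\<lambda>l. \<Sum>i\<in>J. of_real (c i) * g i l) (\<lambda>w. of_real (\<Sum>i\<in>J. c i * X i w))"
  using has_stoch_integral_sum[where c = "\<lambda>i. complex_of_real (c i)" and J = J and g = g and X = "\<lambda>i w. complex_of_real (X i w)"] assms
  by simp

text \<open>Polarisation of the isometry, applied to the sum of the two kernels.\<close>

lemma real_stoch_integral_covariance:
  assumes X: "has_stoch_integral M W g (\<lambda>w. of_real (X w))"
    and Y: "has_stoch_integral M W h (\<lambda>w. of_real (Y w))"
  shows "expectation (\<lambda>w. X w * Y w) = (LBINT l. Re (g l * cnj (h l)))"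
proof -
  have XY: "has_stoch_integral M W (\<lambda>l. g l + h l) (\<lambda>w. of_real (X w + Y w))"
    using has_stoch_integral_add[OF X Y] by simp
  note x = real_stoch_integral_gaussian[OF X] and y = real_stoch_integral_gaussian[OF Y]
  note gs = has_stoch_integralD(1)[OF X] and hs = has_stoch_integralD(1)[OF Y]
  note gi = sq_integrableD(2)[OF gs] and hi = sq_integrableD(2)[OF hs]
  have pi: "integrable M (\<lambda>w. X w * Y w)"
    using integrable_Re[OF sq_integrable_mult_cnj[OF has_stoch_integralD(2)[OF X] has_stoch_integralD(2)[OF Y]]] by simp
  have qi: "integrable lborel (\<lambda>l. Re (g l * cnj (h l)))"
    by (rule integrable_Re[OF sq_integrable_mult_cnj[OF gs hs]])
  have "expectation (\<lambda>w. (X w + Y w)\<^sup>2) = expectation (\<lambda>w. ((X w)\<^sup>2 + (Y w)\<^sup>2) + 2 * (X w * Y w))"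
    by (simp add: power2_sum mult.assoc)
  also have "\<dots> = expectation (\<lambda>w. (X w)\<^sup>2) + expectation (\<lambda>w. (Y w)\<^sup>2) + 2 * expectation (\<lambda>w. X w * Y w)"
    using x(2) y(2) pi by simp
  finally have 1: "expectation (\<lambda>w. (X w + Y w)\<^sup>2) = \<dots>" .
  have "(msq lborel (\<lambda>l. g l + h l)) = (LBINT l. (((cmod (g l))\<^sup>2 + (cmod (h l))\<^sup>2) + 2 * Re (g l * cnj (h l))))"
    by (intro Bochner_Integration.integral_cong refl) (simp add: cmod_power2 power2_sum algebra_simps)
  also have "\<dots> = (msq lborel (\<lambda>l. g l)) + (msq lborel (\<lambda>l. h l)) + 2 * (LBINT l. Re (g l * cnj (h l)))"
    using gi hi qi by (simp del: times_complex.simps)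
  finally have 2: "(msq lborel (\<lambda>l. g l + h l)) = \<dots>" .
  show ?thesis
    using real_stoch_integral_gaussian(5)[OF XY] 1 2 x(5) y(5) by linarith
qed

end

text \<open>The frequency response after the substitution \<open>l = h * v\<close> with \<open>h powr \<alpha> = \<epsilon> powr \<beta>\<close>; \<open>h = 0\<close> is the limit.\<close>

definition response :: "real \<Rightarrow> real \<Rightarrow> real \<Rightarrow> real \<Rightarrow> real \<Rightarrow> real \<Rightarrow> real \<Rightarrow> real" where
  "response \<beta> \<mu> \<alpha> \<gamma> h t v = mittag_leffler \<beta> (- \<mu> * \<bar>v\<bar> powr \<alpha> * (1 + (h * v)\<^sup>2) powr (\<gamma> / 2) * t powr \<beta>)"

text \<open>The factor \<open>m\<close>, later the Bessel factor, only enlarges the denominator and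
  is dropped, so the bound is uniform in the scale. \<open>min 1 c\<close> serves because it is at
  most each coefficient of \<open>1 + c * a\<close>.\<close>

lemma mittag_leffler_bound:
  assumes b: "0 < \<beta>" "\<beta> \<le> 1" and c: "0 < c" and a: "0 \<le> a" and m: "1 \<le> m"
  shows "\<bar>mittag_leffler \<beta> (- (c * a * m))\<bar> \<le> ((1 + Gamma (1 + \<beta>)) / min 1 c) / (1 + a)"
proof -
  have G: "0 < Gamma (1 + \<beta>)" using b by (intro Gamma_real_pos) simp
  have "\<bar>mittag_leffler \<beta> (- (c * a * m))\<bar> \<le> (1 + Gamma (1 + \<beta>)) / (1 + c * a * m)"
    using a c m by (intro mittag_leffler_decay b) auto
  also have "\<dots> \<le> (1 + Gamma (1 + \<beta>)) / (min 1 c * (1 + a))"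
  proof (rule divide_left_mono)
    have "min 1 c * (1 + a) = min 1 c + min 1 c * a" by (simp add: distrib_left)
    also have "\<dots> \<le> 1 + c * a" using a by (intro add_mono mult_right_mono) auto
    also have "\<dots> \<le> 1 + c * a * m" using mult_left_mono[OF m, of "c * a"] a c by simp
    finally show "min 1 c * (1 + a) \<le> 1 + c * a * m" .
    show "0 < (1 + c * a * m) * (min 1 c * (1 + a))"
      using a c m by (intro mult_pos_pos add_pos_nonneg mult_nonneg_nonneg) auto
  qed (use G in linarith)
  finally show ?thesis by simp
qed

lemma response_bound:
  assumes "0 < \<beta>" "\<beta> \<le> 1" "0 < \<mu>" "0 < t" "0 < \<gamma>"
  shows "\<bar>response \<beta> \<mu> \<alpha> \<gamma> h t v\<bar> \<le> ((1 + Gamma (1 + \<beta>)) / min 1 (\<mu> * t powr \<beta>)) / (1 + \<bar>v\<bar> powr \<alpha>)"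
proof -
  have e: "- \<mu> * \<bar>v\<bar> powr \<alpha> * (1 + (h * v)\<^sup>2) powr (\<gamma> / 2) * t powr \<beta> =
      - ((\<mu> * t powr \<beta>) * \<bar>v\<bar> powr \<alpha> * (1 + (h * v)\<^sup>2) powr (\<gamma> / 2))" by simp
  show ?thesis
    unfolding response_def e by (rule mittag_leffler_bound) (use assms in \<open>auto intro: ge_one_powr_ge_zero\<close>)
qed

lemma response_tendsto:
  assumes "0 < \<beta>"
  shows "((\<lambda>h. response \<beta> \<mu> \<alpha> \<gamma> h t v) \<longlongrightarrow> response \<beta> \<mu> \<alpha> \<gamma> 0 t v) (at_right 0)"
  unfolding response_def
proof (rule isCont_tendsto_compose[where g = "mittag_leffler \<beta>"])
  show "isCont (mittag_leffler \<beta>) (- \<mu> * \<bar>v\<bar> powr \<alpha> * (1 + (0 * v)\<^sup>2) powr (\<gamma> / 2) * t powr \<beta>)"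
    by (rule DERIV_isCont[OF DERIV_mittag_leffler[OF assms]])
  show "((\<lambda>h. - \<mu> * \<bar>v\<bar> powr \<alpha> * (1 + (h * v)\<^sup>2) powr (\<gamma> / 2) * t powr \<beta>) \<longlongrightarrow>
      - \<mu> * \<bar>v\<bar> powr \<alpha> * (1 + (0 * v)\<^sup>2) powr (\<gamma> / 2) * t powr \<beta>) (at_right 0)"
    by (intro tendsto_intros) auto
qed

lemma response_measurable [measurable]:
  assumes "0 < \<beta>"
  shows "(\<lambda>v. response \<beta> \<mu> \<alpha> \<gamma> h t v) \<in> borel_measurable borel"
proof -
  note [measurable] = measurable_mittag_leffler2[OF assms, of 1]
  show ?thesis unfolding response_def mittag_leffler_eq by measurable
qed

text \<open>The \<open>Q\<^sub>h\<close> of the overview: the kernel of a Cramer-Wold combination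
  with coefficients \<open>s\<close>, without the density and the normalisation.\<close>

definition response_sum ::
  "real \<Rightarrow> real \<Rightarrow> real \<Rightarrow> real \<Rightarrow> ('k::finite \<Rightarrow> real) \<Rightarrow> ('k \<Rightarrow> real) \<Rightarrow> ('k \<Rightarrow> real) \<Rightarrow> real \<Rightarrow> real \<Rightarrow> complex" where
  "response_sum \<beta> \<mu> \<alpha> \<gamma> s t x h v =
    (\<Sum>i\<in>UNIV. of_real (s i) * (iexp (x i * v) * complex_of_real (response \<beta> \<mu> \<alpha> \<gamma> h (t i) v)))"

lemma response_sum_limit:
  fixes s t x :: "'k::finite \<Rightarrow> real"
  assumes b: "0 < \<beta>" "\<beta> \<le> 1" and p: "0 < \<mu>" "0 < \<gamma>" and t: "\<And>i. 0 < t i"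
    and k: "0 < \<kappa>" "\<kappa> < 1" "\<kappa> / 2 < \<alpha>"
    and f: "integrable lborel f" "\<And>l. 0 \<le> f l" "AE l in lborel. f l = g l"
    and g: "((\<lambda>l. g l * \<bar>l\<bar> powr (1 - \<kappa>)) \<longlongrightarrow> L) (at 0)"
  shows "((\<lambda>h. h powr (- \<kappa>) * (LBINT l. (cmod (response_sum \<beta> \<mu> \<alpha> \<gamma> s t x h (l / h)))\<^sup>2 * f l)) \<longlongrightarrow>
    L * (LBINT v. (cmod (response_sum \<beta> \<mu> \<alpha> \<gamma> s t x 0 v))\<^sup>2 * \<bar>v\<bar> powr (\<kappa> - 1))) (at_right 0)"
proof -
  define K where "K i = (1 + Gamma (1 + \<beta>)) / min 1 (\<mu> * t i powr \<beta>)" for i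
  note [measurable] = response_measurable[OF b(1)]
  have m: "response_sum \<beta> \<mu> \<alpha> \<gamma> s t x h \<in> borel_measurable borel" for h
    unfolding response_sum_def[abs_def] by measurable
  have bd: "cmod (response_sum \<beta> \<mu> \<alpha> \<gamma> s t x h v) \<le> (\<Sum>i\<in>UNIV. \<bar>s i\<bar> * K i) / (1 + \<bar>v\<bar> powr \<alpha>)" for h v
  proof -
    have "cmod (response_sum \<beta> \<mu> \<alpha> \<gamma> s t x h v) \<le> (\<Sum>i\<in>UNIV. \<bar>s i\<bar> * \<bar>response \<beta> \<mu> \<alpha> \<gamma> h (t i) v\<bar>)"
      unfolding response_sum_def by (rule order_trans[OF norm_sum]) (simp add: norm_mult)
    also have "\<dots> \<le> (\<Sum>i\<in>UNIV. \<bar>s i\<bar> * (K i / (1 + \<bar>v\<bar> powr \<alpha>)))"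
      unfolding K_def by (intro sum_mono mult_left_mono response_bound b p t) auto
    finally show ?thesis by (simp add: sum_divide_distrib)
  qed
  show ?thesis
  proof (rule scaled_integral_limit[where K = "(\<Sum>i\<in>UNIV. \<bar>s i\<bar> * K i)\<^sup>2", OF k])
    show "(cmod (response_sum \<beta> \<mu> \<alpha> \<gamma> s t x h v))\<^sup>2 \<le> (\<Sum>i\<in>UNIV. \<bar>s i\<bar> * K i)\<^sup>2 / (1 + \<bar>v\<bar> powr \<alpha>)\<^sup>2" for h v
      using power_mono[OF bd[of h v], of 2] by (simp add: power_divide)
    show "(\<lambda>v. (cmod (response_sum \<beta> \<mu> \<alpha> \<gamma> s t x h v))\<^sup>2) \<in> borel_measurable borel" for h
      using m[of h] by measurable
    then show "(\<lambda>v. (cmod (response_sum \<beta> \<mu> \<alpha> \<gamma> s t x 0 v))\<^sup>2) \<in> borel_measurable borel" .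
    show "((\<lambda>h. (cmod (response_sum \<beta> \<mu> \<alpha> \<gamma> s t x h v))\<^sup>2) \<longlongrightarrow> (cmod (response_sum \<beta> \<mu> \<alpha> \<gamma> s t x 0 v))\<^sup>2) (at_right 0)" for v
      unfolding response_sum_def by (intro tendsto_intros response_tendsto b)
  qed (use f g in auto)
qed

lemma limit_kernel_sq_integrable:
  assumes b: "0 < \<beta>" "\<beta> \<le> 1" and p: "0 < \<mu>" "0 < t" and k: "0 < \<kappa>" "\<kappa> < 1" "\<kappa> / 2 < \<alpha>"
  shows "sq_integrable lborel (\<lambda>l. iexp (l * x) *
             complex_of_real (mittag_leffler \<beta> (- \<mu> * \<bar>l\<bar> powr \<alpha> * t powr \<beta>)) /
             complex_of_real (\<bar>l\<bar> powr ((1 - \<kappa>) / 2)))" (is "sq_integrable lborel ?z")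
proof -
  define K where "K = (1 + Gamma (1 + \<beta>)) / min 1 (\<mu> * t powr \<beta>)"
  note [measurable] = response_measurable[OF b(1)]
  \<comment> \<open>At \<open>h = 0\<close> the Bessel factor is 1 for every exponent; 1 is a
    convenient positive value for \<gamma>.\<close>
  have e: "mittag_leffler \<beta> (- \<mu> * \<bar>l\<bar> powr \<alpha> * t powr \<beta>) = response \<beta> \<mu> \<alpha> 1 0 t l" for l
    by (simp add: response_def)
  have m: "?z \<in> borel_measurable lborel" unfolding e by measurable
  have "integrable lborel (\<lambda>l. K\<^sup>2 * (\<bar>l\<bar> powr (\<kappa> - 1) / (1 + \<bar>l\<bar> powr \<alpha>)\<^sup>2))"
    by (intro integrable_mult_right integrable_spectral_bound k)
  then have "integrable lborel (\<lambda>l. (cmod (?z l))\<^sup>2)"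
  proof (rule Bochner_Integration.integrable_bound)
    show "(\<lambda>l. (cmod (?z l))\<^sup>2) \<in> borel_measurable lborel" using m by measurable
    have "(cmod (?z l))\<^sup>2 \<le> K\<^sup>2 * (\<bar>l\<bar> powr (\<kappa> - 1) / (1 + \<bar>l\<bar> powr \<alpha>)\<^sup>2)" for l
    \<comment> \<open>At \<open>l = 0\<close> both sides are 0, since \<open>0 powr a = 0\<close>
      and division by 0 gives 0.\<close>
    proof (cases "l = 0")
      case False
      have pw: "(\<bar>l\<bar> powr ((1 - \<kappa>) / 2))\<^sup>2 = \<bar>l\<bar> powr (1 - \<kappa>)"
        unfolding power2_eq_square powr_add[symmetric] by simp
      have "(cmod (?z l))\<^sup>2 = (response \<beta> \<mu> \<alpha> 1 0 t l)\<^sup>2 / \<bar>l\<bar> powr (1 - \<kappa>)"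
        unfolding e by (simp add: norm_mult norm_divide power_divide pw)
      also have "\<dots> = \<bar>response \<beta> \<mu> \<alpha> 1 0 t l\<bar>\<^sup>2 * \<bar>l\<bar> powr (\<kappa> - 1)"
        using powr_minus_divide[of "\<bar>l\<bar>" "1 - \<kappa>"] by simp
      also have "\<dots> \<le> (K / (1 + \<bar>l\<bar> powr \<alpha>))\<^sup>2 * \<bar>l\<bar> powr (\<kappa> - 1)"
        unfolding K_def by (intro mult_right_mono power_mono response_bound b p) auto
      finally show ?thesis by (simp add: power_divide)
    qed simp
    then show "AE l in lborel. norm ((cmod (?z l))\<^sup>2) \<le> norm (K\<^sup>2 * (\<bar>l\<bar> powr (\<kappa> - 1) / (1 + \<bar>l\<bar> powr \<alpha>)\<^sup>2))"
      by (intro AE_I2) simp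
  qed
  then show ?thesis using m by (simp add: sq_integrable_def)
qed

section \<open>From convergence of variances to convergence of laws\<close>

context white_noise
begin

text \<open>A vector of real stochastic integrals is centred Gaussian, so the squared norms of all
  linear combinations of its kernels determine both its cosine expectations and its second moments,
  the two inputs of \<open>weak_conv_measure_trig\<close>.\<close>

lemma weak_conv_real_stoch_integrals:
  fixes X :: "'e \<Rightarrow> 'k::finite \<Rightarrow> 'w \<Rightarrow> real" and Y :: "'k \<Rightarrow> 'w \<Rightarrow> real"
  assumes X: "\<forall>\<^sub>F e in F. \<forall>i. has_stoch_integral M W (G e i) (\<lambda>w. of_real (X e i w))"
    and Y: "\<And>i. has_stoch_integral M W (H i) (\<lambda>w. of_real (Y i w))"
    and lim: "\<And>s :: 'k \<Rightarrow> real. ((\<lambda>e. \<integral>l. (cmod (\<Sum>i\<in>UNIV. of_real (s i) * G e i l))\<^sup>2 \<partial>lborel) \<longlongrightarrow>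
      (msq lborel (\<lambda>l. \<Sum>i\<in>UNIV. of_real (s i) * H i l))) F"
  shows "weak_conv_measure F (\<lambda>e. distr M borel (\<lambda>w. (\<chi> i. X e i w) :: real ^ 'k))
    (distr M borel (\<lambda>w. (\<chi> i. Y i w) :: real ^ 'k))"
proof -
  have dot: "s \<bullet> (\<chi> i. y i) = (\<Sum>i\<in>UNIV. s $ i * y i)" for s :: "real ^ 'k" and y
    by (simp add: inner_vec_def)
  have nrm: "(norm ((\<chi> i. y i) :: real ^ 'k))\<^sup>2 = (\<Sum>i\<in>UNIV. (y i)\<^sup>2)" for y
    unfolding power2_norm_eq_inner inner_vec_def by (simp add: power2_eq_square)
  have vm: "(\<lambda>w. (\<chi> i. y i w) :: real ^ 'k) \<in> borel_measurable M" if "\<And>i. y i \<in> borel_measurable M" for y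
    unfolding borel_measurable_euclidean_space[of "\<lambda>w. (\<chi> i. y i w) :: real ^ 'k"]
    using that by (auto simp: Basis_vec_def inner_axis)
  define V where "V T s = (msq lborel (\<lambda>l. \<Sum>i\<in>UNIV. of_real (s i) * T i l))"
    for T :: "'k \<Rightarrow> real \<Rightarrow> complex" and s :: "'k \<Rightarrow> real"
  have limV: "((\<lambda>e. V (G e) s) \<longlongrightarrow> V H s) F" for s unfolding V_def by (rule lim)
  have vec: "(\<lambda>w. (\<chi> i. y i w) :: real ^ 'k) \<in> borel_measurable M"
      "expectation (\<lambda>w. cos (v \<bullet> (\<chi> i. y i w) + b)) = cos b * exp (- V T (\<lambda>i. v $ i) / 2)"
      "integrable M (\<lambda>w. (norm ((\<chi> i. y i w) :: real ^ 'k))\<^sup>2)"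
      "expectation (\<lambda>w. (norm ((\<chi> i. y i w) :: real ^ 'k))\<^sup>2) = (\<Sum>j\<in>UNIV. V T (\<lambda>i. if i = j then 1 else 0))"
    if y: "\<And>i. has_stoch_integral M W (T i) (\<lambda>w. of_real (y i w))" for T y v b
  proof -
    note S = real_stoch_integral_gaussian[OF has_real_stoch_integral_sum[where J = UNIV, OF y]]
    note R = real_stoch_integral_gaussian[OF y]
    show "(\<lambda>w. (\<chi> i. y i w) :: real ^ 'k) \<in> borel_measurable M" by (rule vm[OF R(1)])
    show "expectation (\<lambda>w. cos (v \<bullet> (\<chi> i. y i w) + b)) = cos b * exp (- V T (\<lambda>i. v $ i) / 2)"
      unfolding dot gaussian_rv_expectation_cos[OF S(3,4)] S(5) V_def ..
    show "integrable M (\<lambda>w. (norm ((\<chi> i. y i w) :: real ^ 'k))\<^sup>2)"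
      unfolding nrm by (intro Bochner_Integration.integrable_sum R(2))
    \<comment> \<open>Unit coefficient vectors express the second moments through \<open>V\<close>,
      whose convergence is assumed.\<close>
    have "expectation (\<lambda>w. (y j w)\<^sup>2) = V T (\<lambda>i. if i = j then 1 else 0)" for j
    proof -
      have "(\<Sum>i\<in>UNIV. complex_of_real (if i = j then 1 else 0) * T i l) = T j l" for l
        by (simp add: if_distrib[of complex_of_real] if_distrib[of "\<lambda>c. c * _"] cong: if_cong)
      then show ?thesis unfolding V_def R(5) by simp
    qed
    then show "expectation (\<lambda>w. (norm ((\<chi> i. y i w) :: real ^ 'k))\<^sup>2) = (\<Sum>j\<in>UNIV. V T (\<lambda>i. if i = j then 1 else 0))"
      unfolding nrm by (subst Bochner_Integration.integral_sum) (use R(2) in simp_all)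
  qed
  \<comment> \<open>The extra 1 lets convergent second moments fall strictly below the bound
    eventually.\<close>
  define C where "C = (\<Sum>j\<in>UNIV. V H (\<lambda>i. if i = j then 1 else 0)) + 1"
  have "((\<lambda>e. \<Sum>j\<in>UNIV. V (G e) (\<lambda>i. if i = j then 1 else 0)) \<longlongrightarrow> (\<Sum>j\<in>UNIV. V H (\<lambda>i. if i = j then 1 else 0))) F"
    by (intro tendsto_sum limV)
  then have ev: "\<forall>\<^sub>F e in F. (\<Sum>j\<in>UNIV. V (G e) (\<lambda>i. if i = j then 1 else 0)) < C"
    by (intro order_tendstoD(2)) (auto simp: C_def)
  show ?thesis
  proof (rule weak_conv_measure_trig[where C = C])
    show "prob_space M" by (rule prob_space_axioms)
    show "\<forall>\<^sub>F e in F. (\<lambda>w. (\<chi> i. X e i w) :: real ^ 'k) \<in> borel_measurable M"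
      using X by eventually_elim (blast intro: vec(1))
    show "(\<lambda>w. (\<chi> i. Y i w) :: real ^ 'k) \<in> borel_measurable M" by (rule vec(1)[OF Y])
    show "integrable M (\<lambda>w. (norm ((\<chi> i. Y i w) :: real ^ 'k))\<^sup>2)" by (rule vec(3)[OF Y])
    show "expectation (\<lambda>w. (norm ((\<chi> i. Y i w) :: real ^ 'k))\<^sup>2) \<le> C"
      unfolding vec(4)[OF Y] by (simp add: C_def)
    show "\<forall>\<^sub>F e in F. integrable M (\<lambda>w. (norm ((\<chi> i. X e i w) :: real ^ 'k))\<^sup>2) \<and>
        expectation (\<lambda>w. (norm ((\<chi> i. X e i w) :: real ^ 'k))\<^sup>2) \<le> C"
      using X ev
    proof eventually_elim
      case (elim e)
      then have x: "has_stoch_integral M W (G e i) (\<lambda>w. of_real (X e i w))" for i by simp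
      show ?case using vec(3)[OF x] elim(2) unfolding vec(4)[OF x] by simp
    qed
    fix v :: "real ^ 'k" and b
    have "\<forall>\<^sub>F e in F. expectation (\<lambda>w. cos (v \<bullet> (\<chi> i. X e i w) + b)) = cos b * exp (- V (G e) (\<lambda>i. v $ i) / 2)"
      using X
    proof eventually_elim
      case (elim e)
      then have x: "has_stoch_integral M W (G e i) (\<lambda>w. of_real (X e i w))" for i by simp
      show ?case by (rule vec(2)[OF x])
    qed
    then show "((\<lambda>e. expectation (\<lambda>w. cos (v \<bullet> (\<chi> i. X e i w) + b))) \<longlongrightarrow> expectation (\<lambda>w. cos (v \<bullet> (\<chi> i. Y i w) + b))) F"
      unfolding vec(2)[OF Y] by (subst tendsto_cong) (assumption, intro tendsto_intros limV, simp)
  qed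
qed

end

text \<open>The stochastic integral is fixed only up to null sets, so the conclusion concerns every
  version \<open>Z\<close> of it; the existence clause ensures that there is one.\<close>

theorem theorem3p2:
  fixes M :: "'w measure" and W :: "real set \<Rightarrow> 'w \<Rightarrow> complex"
    and \<alpha> \<beta> \<gamma> \<mu> :: real and n :: nat and A w \<kappa> :: "nat \<Rightarrow> real"
    and r f :: "real \<Rightarrow> real" and \<xi> :: "real \<Rightarrow> 'w \<Rightarrow> real"
    and u :: "real \<Rightarrow> real \<Rightarrow> 'w \<Rightarrow> real"
  assumes "prob_space M" and "hermitian_white_noise M W"
    and "0 < \<beta>" and "\<beta> \<le> 1" and "0 < \<mu>" and "0 < \<gamma>"
    and r: "\<And>x. r x = (\<Sum>j\<le>n. A j * cos (w j * x) / (1 + x\<^sup>2) powr (\<kappa> j / 2))"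
    and "(\<Sum>j\<le>n. A j) = 1" and "w 0 = 0" and "\<And>j. 1 \<le> j \<Longrightarrow> j \<le> n \<Longrightarrow> 0 < w j"
    and "\<And>j. j \<le> n \<Longrightarrow> 0 < \<kappa> j \<and> \<kappa> j < 1" and "A 0 \<noteq> 0"
    and "measurable_process M \<xi>" and "zero_mean M UNIV \<xi>" and "stationary_process M \<xi>"
    and "gaussian_process M UNIV \<xi>" and "\<And>x. covariance M (\<xi> 0) (\<xi> x) = r x"
    and "spectral_density r f"
    and "\<And>x. has_stoch_integral M W
           (\<lambda>l. exp (\<i> * complex_of_real (l * x)) * complex_of_real (sqrt (f l)))
           (\<lambda>\<omega>. complex_of_real (\<xi> x \<omega>))"
    and "riesz_bessel_ms_solution M W f \<beta> \<mu> \<alpha> \<gamma> \<xi> u"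
    and "\<kappa> 0 / 2 < \<alpha>"
  defines "U \<equiv> (\<lambda>\<epsilon> t x \<omega>.
      \<epsilon> powr (- (\<kappa> 0 * \<beta> / (2 * \<alpha>))) * u (t / \<epsilon>) (x / \<epsilon> powr (\<beta> / \<alpha>)) \<omega>)"
    and "is_limit_integral \<equiv> (\<lambda>Z :: real \<Rightarrow> real \<Rightarrow> 'w \<Rightarrow> real. \<forall>t>0. \<forall>x.
      has_stoch_integral M W
        (\<lambda>l. exp (\<i> * complex_of_real (l * x)) *
             complex_of_real (mittag_leffler \<beta> (- \<mu> * \<bar>l\<bar> powr \<alpha> * t powr \<beta>)) /
             complex_of_real (\<bar>l\<bar> powr ((1 - \<kappa> 0) / 2)))
        (\<lambda>\<omega>. complex_of_real (Z t x \<omega>)))"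
  shows "(\<exists>Z. is_limit_integral Z) \<and>
    (\<forall>Z U0. is_limit_integral Z \<and> U0 = (\<lambda>t x \<omega>. sqrt (c2 (\<kappa> 0) * A 0) * Z t x \<omega>) \<longrightarrow>
      (\<forall>(t :: 'k::finite \<Rightarrow> real) (x :: 'k \<Rightarrow> real). (\<forall>i. 0 < t i) \<longrightarrow>
         weak_conv_measure (at_right 0)
           (\<lambda>\<epsilon>. distr M borel (\<lambda>\<omega>. (\<chi> i. U \<epsilon> (t i) (x i) \<omega>) :: real ^ 'k))
           (distr M borel (\<lambda>\<omega>. (\<chi> i. U0 (t i) (x i) \<omega>) :: real ^ 'k))) \<and>
      gaussian_process M ({0<..} \<times> UNIV) (\<lambda>(t, x). U0 t x) \<and>
      zero_mean M ({0<..} \<times> UNIV) (\<lambda>(t, x). U0 t x) \<and>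
      (\<forall>t>0. \<forall>t'>0. \<forall>x x'.
         covariance M (U0 t x) (U0 t' x') =
           2 * A 0 * c2 (\<kappa> 0) *
           (LBINT l:{0<..}. cos (l * (x - x')) / \<bar>l\<bar> powr (1 - \<kappa> 0) *
              mittag_leffler \<beta> (- \<mu> * \<bar>l\<bar> powr \<alpha> * t powr \<beta>) *
              mittag_leffler \<beta> (- \<mu> * \<bar>l\<bar> powr \<alpha> * t' powr \<beta>))))"
proof -
  interpret white_noise M W
    using assms(1,2) by (simp add: white_noise_def white_noise_axioms_def)
  note b = assms(3,4) and mu = assms(5) and gm = assms(6)
  have k: "0 < \<kappa> 0" "\<kappa> 0 < 1" using assms(11)[of 0] by auto
  have a: "0 < \<alpha>" using assms(21) k by simp
  have f: "integrable lborel f" "\<And>l. 0 \<le> f l" using assms(18) by (auto simp: spectral_density_def)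
  define L where "L = A 0 * c2 (\<kappa> 0)"
  obtain g where fg: "AE l in lborel. f l = g l" and g: "((\<lambda>l. g l * \<bar>l\<bar> powr (1 - \<kappa> 0)) \<longlongrightarrow> L) (at 0)"
    using spectral_density_asymp[OF r assms(9) assms(10) assms(11) assms(18)] unfolding L_def by blast
  have L: "0 \<le> L" by (rule limit_at_0_nonneg[OF f(2) fg g])
  define z where "z t x l = iexp (l * x) *
      complex_of_real (mittag_leffler \<beta> (- \<mu> * \<bar>l\<bar> powr \<alpha> * t powr \<beta>)) /
      complex_of_real (\<bar>l\<bar> powr ((1 - \<kappa> 0) / 2))" for t x l
  have zs: "sq_integrable lborel (z t x)" if "0 < t" for t x
    unfolding z_def[abs_def] by (rule limit_kernel_sq_integrable[OF b mu that k assms(21)])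
  \<comment> \<open>The Hermitian symmetry that allows a real-valued version of the
    integral.\<close>
  have zh: "z t x (- l) = cnj (z t x l)" for t x l
    by (simp add: z_def exp_cnj)
  have pw: "(\<bar>l\<bar> powr ((1 - \<kappa> 0) / 2))\<^sup>2 = \<bar>l\<bar> powr (1 - \<kappa> 0)" for l :: real
    unfolding power2_eq_square powr_add[symmetric] by simp
  have lim_iff: "is_limit_integral Z \<longleftrightarrow> (\<forall>t>0. \<forall>x. has_stoch_integral M W (z t x) (\<lambda>\<omega>. of_real (Z t x \<omega>)))" for Z
    unfolding assms(23) z_def[abs_def] ..
  \<comment> \<open>The guard sits under the existential so that choice yields a single field over
    all \<open>t\<close> and \<open>x\<close>.\<close>
  have "\<forall>t x. \<exists>X. 0 < t \<longrightarrow> has_stoch_integral M W (z t x) (\<lambda>\<omega>. of_real (X \<omega>))"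
  proof (intro allI)
    fix t x
    show "\<exists>X. 0 < t \<longrightarrow> has_stoch_integral M W (z t x) (\<lambda>\<omega>. of_real (X \<omega>))"
    proof (cases "0 < t")
      case True
      show ?thesis using real_stoch_integral_exists[OF zs[OF True, of x] zh] by (rule ex_forward) simp
    qed simp
  qed
  then have "\<exists>Z. \<forall>t x. 0 < t \<longrightarrow> has_stoch_integral M W (z t x) (\<lambda>\<omega>. of_real (Z t x \<omega>))"
    unfolding choice_iff .
  then have ex: "\<exists>Z. is_limit_integral Z"
    unfolding lim_iff by (rule ex_forward) simp
  show ?thesis
  proof (rule conjI[OF ex], intro allI impI, elim conjE, intro conjI)
    fix Z U0
    assume Z: "is_limit_integral Z" and U0: "U0 = (\<lambda>t x \<omega>. sqrt (c2 (\<kappa> 0) * A 0) * Z t x \<omega>)"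
    have U0h: "has_stoch_integral M W (\<lambda>l. of_real (sqrt L) * z t x l) (\<lambda>\<omega>. of_real (U0 t x \<omega>))"
      if "0 < t" for t x
      using has_stoch_integral_scale[of "z t x" "\<lambda>\<omega>. complex_of_real (Z t x \<omega>)" "complex_of_real (sqrt L)"] Z that
      by (simp add: lim_iff U0 L_def mult.commute)
    note U0g = real_stoch_integral_gaussian[OF U0h]
    have U0i: "integrable M (U0 t x)" if "0 < t" for t x
      by (rule expectation_abs_le_sqrt(1)[OF U0g(1)[OF that] U0g(2)[OF that]])
    show "zero_mean M ({0<..} \<times> UNIV) (\<lambda>(t, x). U0 t x)" using U0i U0g(4) by (auto simp: zero_mean_def)
    show "gaussian_process M ({0<..} \<times> UNIV) (\<lambda>(t, x). U0 t x)"
      unfolding gaussian_process_def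
    proof (intro allI impI, elim conjE)
      fix J :: "(real \<times> real) set" and c assume J: "finite J" "J \<subseteq> {0<..} \<times> UNIV"
      have "has_stoch_integral M W (\<lambda>l. \<Sum>i\<in>J. of_real (c i) * (of_real (sqrt L) * z (fst i) (snd i) l))
          (\<lambda>\<omega>. of_real (\<Sum>i\<in>J. c i * (case i of (t, x) \<Rightarrow> U0 t x) \<omega>))"
        by (rule has_real_stoch_integral_sum) (use J U0h in auto)
      from real_stoch_integral_gaussian(3)[OF this]
      show "gaussian_rv M (\<lambda>\<omega>. \<Sum>i\<in>J. c i * (case i of (t, x) \<Rightarrow> U0 t x) \<omega>)" .
    qed
    show "\<forall>t>0. \<forall>t'>0. \<forall>x x'. covariance M (U0 t x) (U0 t' x') = 2 * A 0 * c2 (\<kappa> 0) *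
        (LBINT l:{0<..}. cos (l * (x - x')) / \<bar>l\<bar> powr (1 - \<kappa> 0) *
          mittag_leffler \<beta> (- \<mu> * \<bar>l\<bar> powr \<alpha> * t powr \<beta>) *
          mittag_leffler \<beta> (- \<mu> * \<bar>l\<bar> powr \<alpha> * t' powr \<beta>))"
      (is "\<forall>t>0. \<forall>t'>0. \<forall>x x'. ?cov t t' x x'")
    proof (intro allI impI)
      fix t t' x x' :: real assume t: "0 < t" "0 < t'"
      define h where "h l = cos (l * (x - x')) / \<bar>l\<bar> powr (1 - \<kappa> 0) *
              mittag_leffler \<beta> (- \<mu> * \<bar>l\<bar> powr \<alpha> * t powr \<beta>) *
              mittag_leffler \<beta> (- \<mu> * \<bar>l\<bar> powr \<alpha> * t' powr \<beta>)" for l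
      have zz: "Re (z t x l * cnj (z t' x' l)) = h l" for l
      proof -
        have e: "iexp (l * x) * cnj (iexp (l * x')) = cis (l * (x - x'))"
          by (simp add: cis_conv_exp exp_cnj exp_add[symmetric] algebra_simps)
        have "z t x l * cnj (z t' x' l) = cis (l * (x - x')) *
            complex_of_real (mittag_leffler \<beta> (- \<mu> * \<bar>l\<bar> powr \<alpha> * t powr \<beta>) *
              mittag_leffler \<beta> (- \<mu> * \<bar>l\<bar> powr \<alpha> * t' powr \<beta>) / (\<bar>l\<bar> powr ((1 - \<kappa> 0) / 2))\<^sup>2)"
          unfolding e[symmetric] by (simp add: z_def power2_eq_square)
        then show ?thesis unfolding pw h_def by simp
      qed
      \<comment> \<open>Folding the two-sided integral onto the half-line produces the factor 2 of
        the covariance formula.\<close>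
      have even: "h (- l) = h l" for l by (simp add: h_def)
      have hi: "integrable lborel h"
        using integrable_Re[OF sq_integrable_mult_cnj[OF zs[OF t(1), of x] zs[OF t(2), of x']]] unfolding zz .
      have "covariance M (U0 t x) (U0 t' x') = expectation (\<lambda>\<omega>. U0 t x \<omega> * U0 t' x' \<omega>)"
        unfolding covariance_def U0g(4)[OF t(1)] U0g(4)[OF t(2)] by simp
      also have "\<dots> = (LBINT l. Re ((of_real (sqrt L) * z t x l) * cnj (of_real (sqrt L) * z t' x' l)))"
        by (rule real_stoch_integral_covariance[OF U0h[OF t(1)] U0h[OF t(2)]])
      also have "\<dots> = (LBINT l. L * h l)"
      proof (rule Bochner_Integration.integral_cong[OF refl])
        fix l
        have "(of_real (sqrt L) * z t x l) * cnj (of_real (sqrt L) * z t' x' l) =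
            complex_of_real (sqrt L * sqrt L) * (z t x l * cnj (z t' x' l))"
          unfolding complex_cnj_mult complex_cnj_complex_of_real of_real_mult by (simp only: mult_ac)
        also have "sqrt L * sqrt L = L" using L by simp
        finally show "Re ((of_real (sqrt L) * z t x l) * cnj (of_real (sqrt L) * z t' x' l)) = L * h l"
          unfolding zz[symmetric] scaleR_conv_of_real[symmetric] by (simp only: scaleR_complex.sel)
      qed
      also have "\<dots> = L * (2 * (LBINT l:{0<..}. h l))"
        unfolding integral_mult_right_zero integral_even[OF hi even] ..
      finally show "?cov t t' x x'"
        unfolding h_def[symmetric] L_def by simp
    qed
    show "\<forall>(t :: 'k \<Rightarrow> real) (x :: 'k \<Rightarrow> real). (\<forall>i. 0 < t i) \<longrightarrow>
         weak_conv_measure (at_right 0)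
           (\<lambda>\<epsilon>. distr M borel (\<lambda>\<omega>. (\<chi> i. U \<epsilon> (t i) (x i) \<omega>) :: real ^ 'k))
           (distr M borel (\<lambda>\<omega>. (\<chi> i. U0 (t i) (x i) \<omega>) :: real ^ 'k))"
      (is "\<forall>t x. _ \<longrightarrow> ?conv t x")
    proof (intro allI impI)
      fix t x :: "'k \<Rightarrow> real" assume "\<forall>i. 0 < t i"
      then have t: "\<And>i. 0 < t i" by simp
      \<comment> \<open>Its square is \<open>h \<epsilon> powr (- \<kappa> 0)\<close>, the
        normalisation in \<open>response_sum_limit\<close>.\<close>
      define c where "c \<epsilon> = \<epsilon> powr (- (\<kappa> 0 * \<beta> / (2 * \<alpha>)))" for \<epsilon> :: real
      define h where "h \<epsilon> = \<epsilon> powr (\<beta> / \<alpha>)" for \<epsilon> :: real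
      define G where "G \<epsilon> i l = complex_of_real (c \<epsilon>) * (iexp (x i / h \<epsilon> * l) *
             complex_of_real
               (mittag_leffler \<beta> (- \<mu> * \<bar>l\<bar> powr \<alpha> * (1 + \<bar>l\<bar>\<^sup>2) powr (\<gamma> / 2) * (t i / \<epsilon>) powr \<beta>)) *
             complex_of_real (sqrt (f l)))" for \<epsilon> i l
      let ?R = "\<lambda>s. response_sum \<beta> \<mu> \<alpha> \<gamma> s t x"
      have hlim: "filterlim h (at_right 0) (at_right 0)"
      proof -
        have "((\<lambda>\<epsilon>. \<epsilon> powr (\<beta> / \<alpha>)) \<longlongrightarrow> 0) (at_right (0 :: real))"
          by (rule tendsto_zero_powrI[OF tendsto_ident_at tendsto_const])
            (use b a in \<open>auto simp: eventually_at_filter\<close>)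
        then show ?thesis
          unfolding filterlim_at h_def by (auto simp: eventually_at_filter)
      qed
      show "?conv t x"
      proof (rule weak_conv_real_stoch_integrals[where G = G and H = "\<lambda>i l. of_real (sqrt L) * z (t i) (x i) l"])
        show "\<forall>\<^sub>F \<epsilon> in at_right 0. \<forall>i. has_stoch_integral M W (G \<epsilon> i) (\<lambda>\<omega>. of_real (U \<epsilon> (t i) (x i) \<omega>))"
          unfolding eventually_at_filter
        proof (intro always_eventually allI impI)
          fix \<epsilon> :: real and i assume "\<epsilon> \<noteq> 0" "\<epsilon> \<in> {0<..}"
          then have "0 < t i / \<epsilon>" using t[of i] by simp
          then have u: "has_stoch_integral M W
             (\<lambda>l. iexp (x i / h \<epsilon> * l) *
               complex_of_real
                 (mittag_leffler \<beta> (- \<mu> * \<bar>l\<bar> powr \<alpha> * (1 + \<bar>l\<bar>\<^sup>2) powr (\<gamma> / 2) * (t i / \<epsilon>) powr \<beta>)) *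
               complex_of_real (sqrt (f l)))
             (\<lambda>\<omega>. of_real (u (t i / \<epsilon>) (x i / h \<epsilon>) \<omega>))"
            using assms(20) unfolding riesz_bessel_ms_solution_def by blast
          show "has_stoch_integral M W (G \<epsilon> i) (\<lambda>\<omega>. of_real (U \<epsilon> (t i) (x i) \<omega>))"
            using has_stoch_integral_scale[OF u, of "complex_of_real (c \<epsilon>)"]
            unfolding assms(22) G_def[abs_def] c_def h_def of_real_mult .
        qed
        show "has_stoch_integral M W (\<lambda>l. of_real (sqrt L) * z (t i) (x i) l) (\<lambda>\<omega>. of_real (U0 (t i) (x i) \<omega>))" for i
          by (rule U0h[OF t])
        fix s :: "'k \<Rightarrow> real"
        have lhs: "(msq lborel (\<lambda>l. \<Sum>i\<in>UNIV. of_real (s i) * G \<epsilon> i l)) =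
            h \<epsilon> powr (- \<kappa> 0) * (LBINT l. (cmod (?R s (h \<epsilon>) (l / h \<epsilon>)))\<^sup>2 * f l)" if e: "0 < \<epsilon>" for \<epsilon>
        proof -
          have hp: "0 < h \<epsilon>" using e by (simp add: h_def)
          have ha: "h \<epsilon> powr \<alpha> = \<epsilon> powr \<beta>" using a by (simp add: h_def powr_powr)
          have c2: "(c \<epsilon>)\<^sup>2 = h \<epsilon> powr (- \<kappa> 0)"
            unfolding power2_eq_square c_def h_def powr_powr powr_add[symmetric]
            using a by (simp add: field_simps)
          have "(\<Sum>i\<in>UNIV. of_real (s i) * G \<epsilon> i l) = complex_of_real (c \<epsilon> * sqrt (f l)) * ?R s (h \<epsilon>) (l / h \<epsilon>)" for l
            unfolding response_sum_def sum_distrib_left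
          proof (rule sum.cong[OF refl])
            fix i
            \<comment> \<open>Dividing the frequency by \<open>h \<epsilon>\<close> replaces the
              time scaling because
              \<open>h \<epsilon> powr \<alpha> = \<epsilon> powr \<beta>\<close>, while the Bessel
              factor still sees the unscaled \<open>l\<close>.\<close>
            have m: "- \<mu> * \<bar>l / h \<epsilon>\<bar> powr \<alpha> * (1 + (h \<epsilon> * (l / h \<epsilon>))\<^sup>2) powr (\<gamma> / 2) * t i powr \<beta> =
                - \<mu> * \<bar>l\<bar> powr \<alpha> * (1 + \<bar>l\<bar>\<^sup>2) powr (\<gamma> / 2) * (t i / \<epsilon>) powr \<beta>"
              using hp e t[of i] by (simp add: abs_divide powr_divide ha less_imp_le)
            have x: "x i / h \<epsilon> * l = x i * (l / h \<epsilon>)" by simp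
            show "of_real (s i) * G \<epsilon> i l = complex_of_real (c \<epsilon> * sqrt (f l)) *
                (of_real (s i) * (iexp (x i * (l / h \<epsilon>)) *
                  complex_of_real (response \<beta> \<mu> \<alpha> \<gamma> (h \<epsilon>) (t i) (l / h \<epsilon>))))"
              unfolding response_def m G_def x of_real_mult by (simp only: mult_ac)
          qed
          then have "(cmod (\<Sum>i\<in>UNIV. of_real (s i) * G \<epsilon> i l))\<^sup>2 =
              h \<epsilon> powr (- \<kappa> 0) * ((cmod (?R s (h \<epsilon>) (l / h \<epsilon>)))\<^sup>2 * f l)" for l
            using f(2)[of l] by (simp add: norm_mult power_mult_distrib c2)
          then show ?thesis by simp
        qed
        have rhs: "(msq lborel (\<lambda>l. \<Sum>i\<in>UNIV. of_real (s i) * (of_real (sqrt L) * z (t i) (x i) l))) =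
            L * (LBINT v. (cmod (?R s 0 v))\<^sup>2 * \<bar>v\<bar> powr (\<kappa> 0 - 1))"
        proof -
          have "(\<Sum>i\<in>UNIV. of_real (s i) * (of_real (sqrt L) * z (t i) (x i) l)) =
              complex_of_real (sqrt L / \<bar>l\<bar> powr ((1 - \<kappa> 0) / 2)) * ?R s 0 l" for l
            unfolding response_sum_def sum_distrib_left
          proof (rule sum.cong[OF refl])
            fix i
            show "of_real (s i) * (of_real (sqrt L) * z (t i) (x i) l) =
                complex_of_real (sqrt L / \<bar>l\<bar> powr ((1 - \<kappa> 0) / 2)) *
                (of_real (s i) * (iexp (x i * l) *
                  complex_of_real (response \<beta> \<mu> \<alpha> \<gamma> 0 (t i) l)))"
              by (simp add: z_def response_def mult.commute[of "x i" l])
          qed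
          then have "(cmod (\<Sum>i\<in>UNIV. of_real (s i) * (of_real (sqrt L) * z (t i) (x i) l)))\<^sup>2 =
              L * ((cmod (?R s 0 l))\<^sup>2 * \<bar>l\<bar> powr (\<kappa> 0 - 1))" for l
            using L powr_minus_divide[of "\<bar>l\<bar>" "1 - \<kappa> 0"]
            by (simp add: norm_mult norm_divide power_mult_distrib power_divide pw)
          then show ?thesis by simp
        qed
        have "((\<lambda>\<epsilon>. h \<epsilon> powr (- \<kappa> 0) * (LBINT l. (cmod (?R s (h \<epsilon>) (l / h \<epsilon>)))\<^sup>2 * f l)) \<longlongrightarrow>
            L * (LBINT v. (cmod (?R s 0 v))\<^sup>2 * \<bar>v\<bar> powr (\<kappa> 0 - 1))) (at_right 0)"
          by (rule filterlim_compose[OF response_sum_limit[OF b mu gm t k assms(21) f fg g] hlim])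
        moreover have "\<forall>\<^sub>F \<epsilon> in at_right 0. (msq lborel (\<lambda>l. \<Sum>i\<in>UNIV. of_real (s i) * G \<epsilon> i l)) =
            h \<epsilon> powr (- \<kappa> 0) * (LBINT l. (cmod (?R s (h \<epsilon>) (l / h \<epsilon>)))\<^sup>2 * f l)"
          unfolding eventually_at_filter by (intro always_eventually allI impI lhs) simp
        ultimately show "((\<lambda>\<epsilon>. \<integral>l. (cmod (\<Sum>i\<in>UNIV. of_real (s i) * G \<epsilon> i l))\<^sup>2 \<partial>lborel) \<longlongrightarrow>
            (msq lborel (\<lambda>l. \<Sum>i\<in>UNIV. of_real (s i) * (of_real (sqrt L) * z (t i) (x i) l)))) (at_right 0)"
          unfolding rhs by (subst tendsto_cong)
      qed
    qed
  qed
qed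

end
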